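(* Let $d>1$ be an integer, let $m\in\mathbb{N}$, let $B(0,1)$ be the open unit ball in $\mathbb{R}^d$, and assume that $u\in\mathrm{C}^\infty_c(B(0,1),\mathbb{R}^m)$ is not identically zero. Then there is no sequence of piecewise constant functions $u_j\in\mathrm{BV}(B(0,1),\mathbb{R}^m)$ such that $u_j\to u$ $\langle\cdot\rangle$-strictly in $\mathrm{BV}$.
   Context: For a finite vector measure $\mu$ on an open set $\Omega\subset\mathbb{R}^d$ with Lebesgue--Radon--Nikodym decomposition $\mu=\frac{\mathrm{d}\mu}{\mathrm{d}\mathcal{L}^d}\mathcal{L}^d+\mu^s$, define for Borel sets $A\subset\Omega$ $$\langle\mu\rangle(A):=\int_A\sqrt{1+\Bigl|\frac{\mathrm{d}\mu}{\mathrm{d}\mathcal{L}^d}\Bigr|^2}\,\mathrm{d}x+|\mu^s|(A),$$ where $|\mu^s|$ is the total variation measure of $\mu^s$ with respect to the Euclidean norm. A sequence $(u_j)\subset\mathrm{BV}(\Omega;\mathbb{R}^m)$ converges $\langle\cdot\rangle$-strictly (area-strictly) to $u\in\mathrm{BV}(\Omega;\mathbb{R}^m)$ if $\|u_j-u\|_{\mathrm{L}^1}\to0$ and $\langle Du_j\rangle(\Omega)\to\langle Du\rangle(\Omega)$. Piecewise constant means countably piecewise constant: up to an $\mathcal{L}^d$-null set, the domain is a countable disjoint union of Borel sets on each of which the function is ($\mathcal{L}^d$-almost everywhere) constant. *)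

theory Defs
  imports "HOL-Analysis.Analysis"
begin

text \<open>Only the values on \<open>sets M\<close> are meaningful.  Countable additivity of a set function with
  values in a finite-dimensional space already makes its total variation finite.\<close>

definition vector_measure :: "'a measure \<Rightarrow> ('a set \<Rightarrow> 'v::euclidean_space) \<Rightarrow> bool" where
  "vector_measure M \<mu> \<longleftrightarrow>
     (\<forall>A::nat \<Rightarrow> 'a set. range A \<subseteq> sets M \<longrightarrow> disjoint_family A \<longrightarrow>
        (\<lambda>n. \<mu> (A n)) sums \<mu> (\<Union>n. A n))"

definition variation :: "'a measure \<Rightarrow> ('a set \<Rightarrow> 'v::euclidean_space) \<Rightarrow> 'a set \<Rightarrow> ennreal" where
  "variation M \<mu> A =
     (SUP P \<in> {P :: nat \<Rightarrow> 'a set. range P \<subseteq> sets M \<and> disjoint_family P \<and> (\<Union>n. P n) = A}.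
        \<Sum>n. ennreal (norm (\<mu> (P n))))"

text \<open>The Jordan decomposition of a signed measure: \<open>\<mu>\<^sup>+ A = sup {\<mu> B | B \<subseteq> A}\<close> and
  \<open>\<mu>\<^sup>- = (-\<mu>)\<^sup>+\<close>.  The coercion \<open>ennreal\<close> cuts negative numbers off at \<open>0\<close>, which is harmless
  since \<open>\<mu> {} = 0\<close>.\<close>

definition positive_part :: "'a measure \<Rightarrow> ('a set \<Rightarrow> real) \<Rightarrow> 'a measure" where
  "positive_part M \<mu> =
     measure_of (space M) (sets M) (\<lambda>A. SUP B \<in> {B \<in> sets M. B \<subseteq> A}. ennreal (\<mu> B))"

definition signed_integral :: "'a measure \<Rightarrow> ('a set \<Rightarrow> real) \<Rightarrow> ('a \<Rightarrow> real) \<Rightarrow> real" where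
  "signed_integral M \<mu> \<phi> =
     integral\<^sup>L (positive_part M \<mu>) \<phi> - integral\<^sup>L (positive_part M (\<lambda>A. - \<mu> A)) \<phi>"

abbreviation borel_on :: "'a::topological_space set \<Rightarrow> 'a measure" where
  "borel_on \<Omega> \<equiv> restrict_space borel \<Omega>"

definition lebesgue_decomposition ::
  "'a::euclidean_space set \<Rightarrow> ('a set \<Rightarrow> 'v::euclidean_space) \<Rightarrow> ('a \<Rightarrow> 'v) \<Rightarrow> ('a set \<Rightarrow> 'v) \<Rightarrow> bool"
  where
  "lebesgue_decomposition \<Omega> \<mu> f \<nu> \<longleftrightarrow>
     set_integrable lebesgue \<Omega> f \<and>
     vector_measure (borel_on \<Omega>) \<nu> \<and>
     (\<exists>N \<in> sets (borel_on \<Omega>). N \<in> null_sets lebesgue \<and> variation (borel_on \<Omega>) \<nu> (\<Omega> - N) = 0) \<and>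
     (\<forall>A \<in> sets (borel_on \<Omega>). \<mu> A = (LINT x:A|lebesgue. f x) + \<nu> A)"

text \<open>The density is unique almost everywhere and the singular part is unique on the Borel subsets
  of \<open>\<Omega>\<close>, so the choice below does not matter.\<close>

definition ac_density ::
  "'a::euclidean_space set \<Rightarrow> ('a set \<Rightarrow> 'v::euclidean_space) \<Rightarrow> 'a \<Rightarrow> 'v" where
  "ac_density \<Omega> \<mu> = (SOME f. \<exists>\<nu>. lebesgue_decomposition \<Omega> \<mu> f \<nu>)"

definition singular_part ::
  "'a::euclidean_space set \<Rightarrow> ('a set \<Rightarrow> 'v::euclidean_space) \<Rightarrow> 'a set \<Rightarrow> 'v" where
  "singular_part \<Omega> \<mu> A = \<mu> A - (LINT x:A|lebesgue. ac_density \<Omega> \<mu> x)"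

definition area_measure ::
  "'a::euclidean_space set \<Rightarrow> ('a set \<Rightarrow> 'v::euclidean_space) \<Rightarrow> 'a set \<Rightarrow> ennreal" where
  "area_measure \<Omega> \<mu> A =
     (\<integral>\<^sup>+x\<in>A. ennreal (sqrt (1 + (norm (ac_density \<Omega> \<mu> x))\<^sup>2)) \<partial>lebesgue)
     + variation (borel_on \<Omega>) (singular_part \<Omega> \<mu>) A"

text \<open>For open \<open>S\<close>.  The derivatives along all fixed directions being \<open>C\<^sup>k\<close> is, in finite
  dimensions, the same as the partial derivatives being \<open>C\<^sup>k\<close>.\<close>

primrec Ck_on ::
  "nat \<Rightarrow> 'a::euclidean_space set \<Rightarrow> ('a \<Rightarrow> 'b::real_normed_vector) \<Rightarrow> bool" where
  "Ck_on 0 S f \<longleftrightarrow> continuous_on S f"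
| "Ck_on (Suc k) S f \<longleftrightarrow>
     f differentiable_on S \<and> (\<forall>v. Ck_on k S (\<lambda>x. frechet_derivative f (at x) v))"

definition smooth_compact_support ::
  "'a::euclidean_space set \<Rightarrow> ('a \<Rightarrow> 'b::real_normed_vector) \<Rightarrow> bool" where
  "smooth_compact_support \<Omega> f \<longleftrightarrow>
     (\<forall>k. Ck_on k \<Omega> f) \<and>
     compact (closure {x \<in> \<Omega>. f x \<noteq> 0}) \<and> closure {x \<in> \<Omega>. f x \<noteq> 0} \<subseteq> \<Omega>"

text \<open>Functions on \<open>\<Omega>\<close> are represented by total functions whose values outside \<open>\<Omega>\<close> play no role.
  The derivative takes values in the matrices \<^typ>\<open>real^'d^'m\<close> (rows are gradients of the components),
  on which \<open>norm\<close> is the Euclidean (Frobenius) norm.\<close>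

definition distributional_derivative ::
  "(real^'d) set \<Rightarrow> (real^'d \<Rightarrow> real^'m) \<Rightarrow> ((real^'d) set \<Rightarrow> real^'d^'m) \<Rightarrow> bool" where
  "distributional_derivative \<Omega> u \<mu> \<longleftrightarrow>
     vector_measure (borel_on \<Omega>) \<mu> \<and>
     (\<forall>\<phi> :: real^'d \<Rightarrow> real. smooth_compact_support \<Omega> \<phi> \<longrightarrow>
        (\<forall>i k. (LINT x:\<Omega>|lebesgue. u x $ i * frechet_derivative \<phi> (at x) (axis k 1))
               = - signed_integral (borel_on \<Omega>) (\<lambda>A. \<mu> A $ i $ k) \<phi>))"

definition BV :: "(real^'d) set \<Rightarrow> (real^'d \<Rightarrow> real^'m) set" where
  "BV \<Omega> = {u. set_integrable lebesgue \<Omega> u \<and> (\<exists>\<mu>. distributional_derivative \<Omega> u \<mu>)}"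

text \<open>For \<open>u \<in> BV \<Omega>\<close> the measure is unique on the Borel subsets of \<open>\<Omega>\<close>.\<close>

definition D_measure ::
  "(real^'d) set \<Rightarrow> (real^'d \<Rightarrow> real^'m) \<Rightarrow> (real^'d) set \<Rightarrow> real^'d^'m" where
  "D_measure \<Omega> u = (SOME \<mu>. distributional_derivative \<Omega> u \<mu>)"

definition area_strictly_converges ::
  "(real^'d) set \<Rightarrow> (nat \<Rightarrow> real^'d \<Rightarrow> real^'m) \<Rightarrow> (real^'d \<Rightarrow> real^'m) \<Rightarrow> bool" where
  "area_strictly_converges \<Omega> U u \<longleftrightarrow>
     (\<forall>j. U j \<in> BV \<Omega>) \<and> u \<in> BV \<Omega> \<and>
     (\<lambda>j. LINT x:\<Omega>|lebesgue. norm (U j x - u x)) \<longlonglongrightarrow> 0 \<and>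
     (\<lambda>j. area_measure \<Omega> (D_measure \<Omega> (U j)) \<Omega>) \<longlonglongrightarrow> area_measure \<Omega> (D_measure \<Omega> u) \<Omega>"

definition piecewise_constant ::
  "'a::euclidean_space set \<Rightarrow> ('a \<Rightarrow> 'b) \<Rightarrow> bool" where
  "piecewise_constant \<Omega> f \<longleftrightarrow>
     (\<exists>P :: nat \<Rightarrow> 'a set. (\<forall>n. P n \<in> sets borel \<and> P n \<subseteq> \<Omega>) \<and> disjoint_family P \<and>
        \<Omega> - (\<Union>n. P n) \<in> null_sets lebesgue \<and>
        (\<forall>n. \<exists>c. AE x in lebesgue. x \<in> P n \<longrightarrow> f x = c))"

end

theory Submission
  imports Defs
begin

text \<open>Let \<open>G\<close> be the gradient of \<open>u\<close>, \<open>s = sqrt (1 + \<bar>G\<bar>\<^sup>2)\<close> and \<open>\<Phi> = G / s\<close>, a smooth compactly supported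
  field with \<open>\<bar>\<Phi>\<bar> \<le> 1\<close>.  The absolutely continuous part of the derivative of a piecewise constant \<open>U\<close>
  vanishes, so the area of \<open>DU\<close> is \<open>\<bar>\<Omega>\<bar> + \<bar>DU\<bar>(\<Omega>)\<close>, which is at least
  \<open>\<bar>\<Omega>\<bar> + \<integral> \<Phi> : dDU = \<bar>\<Omega>\<bar> - \<integral> U \<bullet> div \<Phi>\<close>.  In the limit \<open>U \<rightarrow> u\<close>
  area-strict convergence forces \<open>\<bar>\<Omega>\<bar> + \<integral> \<bar>G\<bar>\<^sup>2 / s \<le> \<integral> s\<close>, that is \<open>\<integral> (1 - 1 / s) \<le> 0\<close>.  Hence \<open>s = 1\<close>,
  \<open>G = 0\<close>, and \<open>u\<close> is constant on the ball, so zero.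

  That the absolutely continuous part vanishes on a set where \<open>U\<close> is constant is seen by translation: as
  measures, \<open>U(\<cdot> + h e) - U\<close> equals \<open>\<integral>\<^sub>0\<^sup>h DU(\<cdot> + t e) e dt\<close>.  If the density \<open>f\<close> of \<open>DU e\<close> were positive on
  a compact subset \<open>K\<close> of that set which avoids the singular part, then on \<open>K \<inter> (K - h e)\<close> the left-hand
  side would be \<open>0\<close>, while for small \<open>h\<close> every \<open>DU(\<cdot> + t e) e\<close> is close to \<open>\<integral>\<^sub>K f > 0\<close>.\<close>

subsection \<open>Smooth functions and cutoffs\<close>

text \<open>The gap behind the contradiction is pointwise: once the absolutely continuous part
  vanishes, the derivative is charged by 1 + |t| instead of sqrt (1 + |t|^2), which is strictly
  larger unless t = 0. Testing the variation with G / |G| would exhibit this gap directly, but that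
  field is discontinuous at the zeros of G. The field G / s is smooth because 1 + |G|^2 stays
  positive, its norm is still at most 1, and it is the derivative of the area integrand at G.

  The obstacle is the density on the level sets. These are merely Borel, so no test function can be
  localised to one of them. The translation formula is an equality of measures and can therefore be
  evaluated on any Borel set whose translates stay in the domain; convexity keeps the whole segment
  inside once its end points are.

  The remaining effort makes the definitions usable: positive parts given by suprema must be shown
  to be finite measures, the chosen density must be shown to come from an existing decomposition,
  and smooth test functions must be shown to determine a signed measure.\<close>

lemma frechet_derivative_eqI: "(f has_derivative f') (at x) \<Longrightarrow> frechet_derivative f (at x) = f'"
  using frechet_derivative_at by metis

lemma has_derivative_frechet:
  "\<lbrakk>f differentiable_on S; open S; x \<in> S\<rbrakk> \<Longrightarrow> (f has_derivative frechet_derivative f (at x)) (at x)"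
  by (metis at_within_open differentiable_on_def frechet_derivative_works)

lemma differentiable_on_derivI:
  "(\<And>x. x \<in> S \<Longrightarrow> (f has_derivative D x) (at x)) \<Longrightarrow> f differentiable_on S"
  unfolding differentiable_on_def by (blast intro: differentiableI differentiable_at_withinI)

text \<open>\<open>frechet_derivative\<close> chooses among all derivatives at the point. Functions
  equal near the point have the same ones, so the choices coincide even if there is none.\<close>

lemma frechet_derivative_cong_open:
  assumes "open S" "x \<in> S" "\<And>y. y \<in> S \<Longrightarrow> f y = g y"
  shows "frechet_derivative f (at x) = frechet_derivative g (at x)"
proof -
  have "(f has_derivative D) (at x) \<longleftrightarrow> (g has_derivative D) (at x)" for D
    using assms has_derivative_transform_within_open by metis
  then show ?thesis
    unfolding frechet_derivative_def by simp
qed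

text \<open>In the closure properties the derivative is given by a formula on the open set S alone.
  This lemma carries \<open>Ck_on\<close> from the formula to the chosen derivative, a total
  function.\<close>

lemma Ck_on_cong_imp:
  assumes "open S" "\<And>y. y \<in> S \<Longrightarrow> f y = g y" "Ck_on k S f"
  shows "Ck_on k S g"
  using assms(2,3)
proof (induction k arbitrary: f g)
  case 0
  then show ?case using continuous_on_cong by (metis Ck_on.simps(1))
next
  case (Suc k)
  have "g differentiable_on S"
    using Suc.prems differentiable_transform_within[of f _ S 1 g]
    by (auto simp: differentiable_on_def)
  moreover have "Ck_on k S (\<lambda>x. frechet_derivative g (at x) v)" for v
    by (rule Suc.IH[of "\<lambda>x. frechet_derivative f (at x) v"])
      (use Suc.prems frechet_derivative_cong_open[OF assms(1)] in \<open>auto, metis\<close>)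
  ultimately show ?case by simp
qed

text \<open>The product and chain rules leave one factor undifferentiated, which is then used one
  order lower.\<close>

lemma Ck_on_Suc_imp: "Ck_on (Suc k) S f \<Longrightarrow> Ck_on k S f"
proof (induction k arbitrary: f)
  case 0
  then show ?case by (simp add: differentiable_imp_continuous_on)
qed auto

lemma Ck_on_subset:
  assumes "open S" "open T" "T \<subseteq> S" "Ck_on k S f"
  shows "Ck_on k T f"
  using assms(4)
proof (induction k arbitrary: f)
  case 0 then show ?case using assms continuous_on_subset by auto
next
  case (Suc k)
  then show ?case using assms(3) differentiable_on_subset by auto
qed

text \<open>Both sets are open, so the derivatives at their points are full ones and nothing has to
  match on the overlap. This yields smoothness of extensions by zero.\<close>

lemma Ck_on_Un:
  assumes "open S" "open T" "Ck_on k S f" "Ck_on k T f"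
  shows "Ck_on k (S \<union> T) f"
  using assms(3,4)
proof (induction k arbitrary: f)
  case 0 then show ?case using assms continuous_on_open_Un by auto
next
  case (Suc k)
  have "f differentiable_on S \<union> T"
    using Suc.prems assms(1,2) unfolding Ck_on.simps differentiable_on_def
    by (metis Un_iff at_within_open open_Un)
  then show ?case using Suc by auto
qed

section \<open>Algebra and composition of C^k functions\<close>

lemma Ck_on_const: "Ck_on k S (\<lambda>x. c)"
proof (induction k arbitrary: c)
  case (Suc k)
  then show ?case by (simp add: frechet_derivative_const)
qed auto

lemma Ck_on_add:
  assumes "open S" "Ck_on k S f" "Ck_on k S g"
  shows "Ck_on k S (\<lambda>x. f x + g x)"
  using assms(2,3)
proof (induction k arbitrary: f g)
  case 0 then show ?case by (simp add: continuous_on_add)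
next
  case (Suc k)
  have d: "f differentiable_on S" "g differentiable_on S" using Suc.prems by auto
  have "Ck_on k S (\<lambda>x. frechet_derivative (\<lambda>x. f x + g x) (at x) v)" for v
  proof (rule Ck_on_cong_imp[OF assms(1) _ Suc.IH])
    show "frechet_derivative f (at x) v + frechet_derivative g (at x) v =
          frechet_derivative (\<lambda>x. f x + g x) (at x) v" if "x \<in> S" for x
      by (subst frechet_derivative_eqI[OF has_derivative_add[OF
            has_derivative_frechet[OF d(1) assms(1) that] has_derivative_frechet[OF d(2) assms(1) that]]]) simp
  qed (use Suc.prems in auto)
  then show ?case using d by (simp add: differentiable_on_add)
qed

lemma Ck_on_mult:
  fixes f g :: "'a::euclidean_space \<Rightarrow> real"
  assumes "open S" "Ck_on k S f" "Ck_on k S g"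
  shows "Ck_on k S (\<lambda>x. f x * g x)"
  using assms(2,3)
proof (induction k arbitrary: f g)
  case 0 then show ?case by (simp add: continuous_on_mult)
next
  case (Suc k)
  have d: "f differentiable_on S" "g differentiable_on S" using Suc.prems by auto
  have "Ck_on k S (\<lambda>x. frechet_derivative (\<lambda>x. f x * g x) (at x) v)" for v
  proof (rule Ck_on_cong_imp[OF assms(1) _ Ck_on_add[OF assms(1) Suc.IH Suc.IH]])
    show "f x * frechet_derivative g (at x) v + frechet_derivative f (at x) v * g x =
          frechet_derivative (\<lambda>x. f x * g x) (at x) v" if "x \<in> S" for x
      by (subst frechet_derivative_eqI[OF has_derivative_mult[OF
            has_derivative_frechet[OF d(1) assms(1) that] has_derivative_frechet[OF d(2) assms(1) that]]]) simp
  qed (use Suc.prems Ck_on_Suc_imp[OF Suc.prems(1)] Ck_on_Suc_imp[OF Suc.prems(2)] in auto)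
  moreover have "(\<lambda>x. f x * g x) differentiable_on S"
    using d by (simp add: differentiable_on_mult)
  ultimately show ?case by simp
qed

lemma Ck_on_sum:
  assumes "open S" "\<And>i. i \<in> I \<Longrightarrow> Ck_on k S (f i)"
  shows "Ck_on k S (\<lambda>x. \<Sum>i\<in>I. f i x)"
  using assms(2) by (induction I rule: infinite_finite_induct) (auto simp: Ck_on_const Ck_on_add assms(1))

lemma Ck_on_prod:
  fixes f :: "'i \<Rightarrow> 'a::euclidean_space \<Rightarrow> real"
  assumes "open S" "\<And>i. i \<in> I \<Longrightarrow> Ck_on k S (f i)"
  shows "Ck_on k S (\<lambda>x. \<Prod>i\<in>I. f i x)"
  using assms(2) by (induction I rule: infinite_finite_induct) (auto simp: Ck_on_const Ck_on_mult assms(1))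

lemma Ck_on_bounded_linear:
  assumes "open S" "bounded_linear L" "Ck_on k S f"
  shows "Ck_on k S (\<lambda>x. L (f x))"
  using assms(3)
proof (induction k arbitrary: f)
  case 0 then show ?case using assms(2) by (simp add: bounded_linear.continuous_on)
next
  case (Suc k)
  have d: "f differentiable_on S" using Suc.prems by auto
  have D: "((\<lambda>x. L (f x)) has_derivative (\<lambda>v. L (frechet_derivative f (at x) v))) (at x)" if "x \<in> S" for x
    using bounded_linear.has_derivative[OF assms(2) has_derivative_frechet[OF d assms(1) that]] .
  have "(\<lambda>x. L (f x)) differentiable_on S"
    by (rule differentiable_on_derivI[OF D])
  moreover have "Ck_on k S (\<lambda>x. frechet_derivative (\<lambda>x. L (f x)) (at x) v)" for v
    by (rule Ck_on_cong_imp[OF assms(1) _ Suc.IH[of "\<lambda>x. frechet_derivative f (at x) v"]])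
      (use Suc.prems in \<open>auto simp: frechet_derivative_eqI[OF D]\<close>)
  ultimately show ?case by simp
qed

lemma Ck_on_affine:
  assumes "bounded_linear L"
  shows "Ck_on k S (\<lambda>x. c + L x)"
proof (cases k)
  case 0
  then show ?thesis using assms by (simp add: linear_continuous_on continuous_on_add)
next
  case (Suc k)
  have D: "((\<lambda>x. c + L x) has_derivative L) (at x)" for x
    using has_derivative_add[OF has_derivative_const[of c] bounded_linear_imp_has_derivative[OF assms]] by simp
  show ?thesis
    unfolding Suc Ck_on.simps frechet_derivative_eqI[OF D]
    using differentiable_on_derivI[OF D] by (simp add: Ck_on_const)
qed

text \<open>The derivative is h'(f x) times the derivative of f, so the induction varies h and keeps
  f fixed. The set T admits outer functions that are smooth on a half line only, such as
  powers.\<close>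

lemma Ck_on_compose_real:
  fixes f :: "'a::euclidean_space \<Rightarrow> real" and h :: "real \<Rightarrow> real"
  assumes "open S" "open T" "f ` S \<subseteq> T" "Ck_on k S f" "Ck_on k T h"
  shows "Ck_on k S (\<lambda>x. h (f x))"
  using assms(4,5)
proof (induction k arbitrary: h)
  case 0
  then show ?case using continuous_on_compose2[of T h S f] assms(3) by auto
next
  case (Suc k)
  have d: "f differentiable_on S" "h differentiable_on T" using Suc.prems by auto
  have D: "((\<lambda>x. h (f x)) has_derivative
      (\<lambda>v. frechet_derivative h (at (f x)) 1 * frechet_derivative f (at x) v)) (at x)" if "x \<in> S" for x
  proof -
    have fx: "f x \<in> T" using that assms(3) by auto
    have "((h \<circ> f) has_derivative frechet_derivative h (at (f x)) \<circ> frechet_derivative f (at x)) (at x)"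
      by (rule diff_chain_at)
        (use has_derivative_frechet[OF d(1) assms(1) that] has_derivative_frechet[OF d(2) assms(2) fx] in auto)
    moreover have "linear (frechet_derivative h (at (f x)))"
      using has_derivative_frechet[OF d(2) assms(2) fx] has_derivative_linear by auto
    then have "frechet_derivative h (at (f x)) t = frechet_derivative h (at (f x)) 1 * t" for t
      using linear_cmul[of "frechet_derivative h (at (f x))" t 1] by simp
    then have "frechet_derivative h (at (f x)) \<circ> frechet_derivative f (at x) =
      (\<lambda>v. frechet_derivative h (at (f x)) 1 * frechet_derivative f (at x) v)" by (metis comp_apply)
    ultimately show ?thesis by (simp add: o_def)
  qed
  have "(\<lambda>x. h (f x)) differentiable_on S"
    by (rule differentiable_on_derivI[OF D])
  moreover have "Ck_on k S (\<lambda>x. frechet_derivative (\<lambda>x. h (f x)) (at x) v)" for v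
  proof (rule Ck_on_cong_imp[OF assms(1)])
    show "Ck_on k S (\<lambda>x. frechet_derivative h (at (f x)) 1 * frechet_derivative f (at x) v)"
    proof (rule Ck_on_mult[OF assms(1)])
      show "Ck_on k S (\<lambda>x. frechet_derivative h (at (f x)) 1)"
        by (rule Suc.IH[of "\<lambda>t. frechet_derivative h (at t) 1", OF Ck_on_Suc_imp[OF Suc.prems(1)]])
          (use Suc.prems in auto)
    qed (use Suc.prems in auto)
  qed (auto simp: frechet_derivative_eqI[OF D])
  ultimately show ?case by simp
qed

lemma frechet_derivative_real:
  "(h has_real_derivative D) (at t) \<Longrightarrow> frechet_derivative h (at t) v = D * v"
  by (subst frechet_derivative_eqI[of h "\<lambda>v. D * v"]) (auto simp: has_field_derivative_def)

lemma Ck_on_SucI_real: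
  fixes h h' :: "real \<Rightarrow> real"
  assumes "open T" "\<And>t. t \<in> T \<Longrightarrow> (h has_real_derivative h' t) (at t)" "Ck_on k T h'"
  shows "Ck_on (Suc k) T h"
proof -
  have "h differentiable_on T"
    using assms(2) by (meson differentiable_on_def differentiable_at_withinI real_differentiable_def)
  moreover have "Ck_on k T (\<lambda>x. frechet_derivative h (at x) v)" for v
    by (rule Ck_on_cong_imp[OF assms(1) _ Ck_on_mult[OF assms(1,3) Ck_on_const[of k T v]]])
       (use frechet_derivative_real[OF assms(2)] in auto)
  ultimately show ?thesis by simp
qed

text \<open>Differentiation changes the exponent and adds a constant factor, hence the induction
  over all exponents. The cutoffs use the exponent -1, the field of the main proof uses
  -1/2.\<close>

lemma Ck_on_powr: "Ck_on k {-1<..} (\<lambda>t::real. (1 + t) powr a)"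
proof (induction k arbitrary: a)
  case 0
  then show ?case by (auto intro!: continuous_intros)
next
  case (Suc k)
  show ?case
  proof (rule Ck_on_SucI_real)
    show "((\<lambda>t. (1 + t) powr a) has_real_derivative a * (1 + t) powr (a - 1)) (at t)" if "t \<in> {-1<..}" for t
      using that by (auto intro!: derivative_eq_intros)
    show "Ck_on k {-1<..} (\<lambda>t. a * (1 + t) powr (a - 1))"
      by (intro Ck_on_mult Suc.IH Ck_on_const) auto
  qed auto
qed

text \<open>The powers of \<open>1 / t\<close> make the family closed under differentiation.\<close>

definition flat_exp :: "nat \<Rightarrow> real \<Rightarrow> real" where
  "flat_exp n t = (if t > 0 then exp (- (1 / t)) / t ^ n else 0)"

lemma flat_exp_tendsto_0: "(flat_exp n \<longlongrightarrow> 0) (at 0)"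
proof -
  have "((\<lambda>t. exp (- (1 / t)) / t ^ n) \<longlongrightarrow> 0) (at_right (0::real))"
  proof -
    have "((\<lambda>x. x ^ n / exp x) \<longlongrightarrow> (0::real)) at_top" by (rule tendsto_power_div_exp_0)
    then have "((\<lambda>t. inverse t ^ n / exp (inverse t)) \<longlongrightarrow> (0::real)) (at_right 0)"
      by (rule filterlim_compose[OF _ filterlim_inverse_at_top_right])
    then show ?thesis
      by (simp add: exp_minus field_simps)
  qed
  then have r: "(flat_exp n \<longlongrightarrow> 0) (at_right 0)"
    by (rule Lim_transform_eventually) (auto simp: flat_exp_def eventually_at_filter)
  have l: "(flat_exp n \<longlongrightarrow> 0) (at_left 0)"
    by (rule Lim_transform_eventually[OF tendsto_const]) (auto simp: flat_exp_def eventually_at_filter)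
  show ?thesis using r l by (simp add: filterlim_split_at)
qed

text \<open>At t = 0 the difference quotient of \<open>flat_exp n\<close> is
  \<open>flat_exp (n + 1)\<close>, which tends to 0, and both terms on the right are 0 there; so one
  formula covers the whole line.\<close>

lemma flat_exp_derivative:
  "(flat_exp n has_real_derivative flat_exp (n + 2) t - real n * flat_exp (n + 1) t) (at t)"
proof -
  consider "t > 0" | "t < 0" | "t = 0" by linarith
  then show ?thesis
  proof cases
    case 1
    have "((\<lambda>t. exp (- (1 / t)) / t ^ n) has_real_derivative
        flat_exp (n + 2) t - real n * flat_exp (n + 1) t) (at t)"
    proof (cases n)
      case (Suc m)
      have "((\<lambda>t. exp (- (1 / t)) / t ^ Suc m) has_real_derivative
        (exp (- (1 / t)) * (1 / t^2) * t ^ Suc m - exp (- (1 / t)) * (real (Suc m) * t ^ m)) / (t ^ Suc m)^2) (at t)" (is "(_ has_real_derivative ?D) _")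
        using 1 by (auto intro!: derivative_eq_intros simp: power2_eq_square; cases m; simp add: algebra_simps)
      moreover have "?D = flat_exp (n + 2) t - real n * flat_exp (n + 1) t"
        using 1 Suc by (simp add: flat_exp_def field_simps power2_eq_square)
      ultimately show ?thesis
        using Suc by simp
    qed (use 1 in \<open>auto intro!: derivative_eq_intros simp: flat_exp_def field_simps power2_eq_square\<close>)
    then show ?thesis
      by (rule has_field_derivative_transform_within_open[of _ _ _ "{0<..}"]) (use 1 in \<open>auto simp: flat_exp_def\<close>)
  next
    case 2
    have "((\<lambda>t. 0) has_real_derivative flat_exp (n + 2) t - real n * flat_exp (n + 1) t) (at t)"
      using 2 by (auto simp: flat_exp_def)
    then show ?thesis
      by (rule has_field_derivative_transform_within_open[of _ _ _ "{..<0}"]) (use 2 in \<open>auto simp: flat_exp_def\<close>)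
  next
    case 3
    have "((\<lambda>y. (flat_exp n y - flat_exp n 0) / (y - 0)) \<longlongrightarrow> 0) (at 0)"
      by (rule Lim_transform_eventually[OF flat_exp_tendsto_0[of "n+1"]])
         (auto simp: flat_exp_def eventually_at_filter)
    then show ?thesis using 3 by (simp add: has_field_derivative_iff flat_exp_def)
  qed
qed

lemma Ck_on_flat_exp: "Ck_on k UNIV (flat_exp n)"
proof (induction k arbitrary: n)
  case 0
  then show ?case
    using DERIV_isCont[OF flat_exp_derivative] by (auto simp: continuous_on_eq_continuous_at)
next
  case (Suc k)
  have "Ck_on k UNIV (\<lambda>t. flat_exp (n + 2) t + (- real n) * flat_exp (n + 1) t)"
    by (intro Ck_on_add Ck_on_mult Suc.IH Ck_on_const) auto
  then show ?case
    by (intro Ck_on_SucI_real[OF _ flat_exp_derivative]) auto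
qed

lemma flat_exp_nonneg: "flat_exp n t \<ge> 0"
  by (simp add: flat_exp_def)

text \<open>Boxes are chosen because the open ones form an intersection-stable generator of the
  Borel sets. Each coordinate contributes a factor that is positive exactly between its two
  bounds.\<close>

definition box_bump :: "'a::euclidean_space \<Rightarrow> 'a \<Rightarrow> 'a \<Rightarrow> real" where
  "box_bump a b x = (\<Prod>i\<in>Basis. flat_exp 0 ((x - a) \<bullet> i) * flat_exp 0 ((b - x) \<bullet> i))"

lemma box_bump_nonneg: "box_bump a b x \<ge> 0"
  unfolding box_bump_def by (intro prod_nonneg) (auto simp: flat_exp_nonneg)

lemma box_bump_pos_iff: "box_bump a b x > 0 \<longleftrightarrow> x \<in> box a b"
proof -
  have "box_bump a b x \<noteq> 0 \<longleftrightarrow> x \<in> box a b"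
    by (auto simp: box_bump_def flat_exp_def mem_box inner_diff_left)
  then show ?thesis using box_bump_nonneg[of a b x] by auto
qed

lemma Ck_on_box_bump: "Ck_on k UNIV (box_bump a b)"
proof -
  have 1: "Ck_on k UNIV (\<lambda>x. flat_exp 0 ((x - a) \<bullet> i))" for i :: 'a
    using Ck_on_compose_real[OF open_UNIV open_UNIV subset_UNIV
        Ck_on_affine[OF bounded_linear_inner_left, of k UNIV "- (a \<bullet> i)" i] Ck_on_flat_exp, of 0]
    by (simp add: inner_diff_left)
  have 2: "Ck_on k UNIV (\<lambda>x. flat_exp 0 ((b - x) \<bullet> i))" for i :: 'a
    using Ck_on_compose_real[OF open_UNIV open_UNIV subset_UNIV
        Ck_on_affine[OF bounded_linear_minus[OF bounded_linear_inner_left], of k UNIV "b \<bullet> i" i]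
        Ck_on_flat_exp, of 0]
    by (simp add: inner_diff_left)
  show ?thesis
    unfolding box_bump_def[abs_def] by (intro Ck_on_prod Ck_on_mult 1 2 open_UNIV)
qed

text \<open>With \<open>b = box_bump\<close> this is \<open>n b / (1 + n b)\<close>.\<close>

definition box_cutoff :: "nat \<Rightarrow> 'a::euclidean_space \<Rightarrow> 'a \<Rightarrow> 'a \<Rightarrow> real" where
  "box_cutoff n a b x = 1 - (1 + real n * box_bump a b x) powr (-1)"

lemma Ck_on_box_cutoff: "Ck_on k UNIV (box_cutoff n a b)"
proof -
  have gt: "-1 < real n * box_bump a b x" for x
    using mult_nonneg_nonneg[OF of_nat_0_le_iff box_bump_nonneg, of n a b x] by linarith
  have "Ck_on k UNIV (\<lambda>x. real n * box_bump a b x)"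
    by (rule Ck_on_mult[OF open_UNIV Ck_on_const Ck_on_box_bump])
  then have "Ck_on k UNIV (\<lambda>x. (1 + real n * box_bump a b x) powr (-1))"
    using Ck_on_compose_real[OF open_UNIV open_greaterThan _ _ Ck_on_powr, of "\<lambda>x. real n * box_bump a b x" k "-1"] gt
    by (simp add: image_subset_iff)
  from Ck_on_add[OF open_UNIV Ck_on_const[of k UNIV 1] Ck_on_mult[OF open_UNIV Ck_on_const[of k UNIV "-1"] this]]
  moreover have "box_cutoff n a b = (\<lambda>x. 1 + (- 1) * (1 + real n * box_bump a b x) powr (-1))"
    by (simp add: box_cutoff_def fun_eq_iff)
  ultimately show ?thesis by simp
qed

lemma box_cutoff_bounds: "0 \<le> box_cutoff n a b x" "box_cutoff n a b x \<le> 1"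
  using mult_nonneg_nonneg[OF of_nat_0_le_iff box_bump_nonneg, of n a b x]
  by (auto simp: box_cutoff_def powr_minus field_simps)

lemma box_cutoff_outside: "x \<notin> box a b \<Longrightarrow> box_cutoff n a b x = 0"
  using box_bump_pos_iff[of a b x] box_bump_nonneg[of a b x] by (simp add: box_cutoff_def)

text \<open>Where the bump is positive, n times the bump tends to infinity; elsewhere every cutoff
  is 0. Together with the bounds 0 and 1, dominated convergence turns integrals of test functions
  into measures of open boxes.\<close>

lemma box_cutoff_tendsto: "(\<lambda>n. box_cutoff n a b x) \<longlonglongrightarrow> indicator (box a b) x"
proof (cases "x \<in> box a b")
  case True
  then have "box_bump a b x > 0" by (simp add: box_bump_pos_iff)
  then have "filterlim (\<lambda>n. 1 + real n * box_bump a b x) at_top sequentially"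
    by (intro filterlim_tendsto_add_at_top[OF tendsto_const]
        filterlim_at_top_mult_tendsto_pos[OF tendsto_const _ filterlim_real_sequentially])
  from tendsto_neg_powr[OF _ this, of "-1"]
  have "(\<lambda>n. 1 - (1 + real n * box_bump a b x) powr - 1) \<longlonglongrightarrow> 1 - 0"
    by (intro tendsto_intros) auto
  with True show ?thesis by (simp add: box_cutoff_def)
qed (simp add: box_cutoff_outside)

text \<open>Any compact K off which f vanishes may replace the closed support, which is then a
  closed subset of K.\<close>

lemma smooth_compact_supportI:
  assumes "open S" "\<And>k. Ck_on k S f" "compact K" "K \<subseteq> S" "\<And>x. x \<in> S - K \<Longrightarrow> f x = 0"
  shows "smooth_compact_support S f"
proof -
  have "closure {x \<in> S. f x \<noteq> 0} \<subseteq> K"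
    by (rule closure_minimal) (use assms compact_imp_closed in auto)
  moreover from this have "compact (closure {x \<in> S. f x \<noteq> 0})"
    using compact_Int_closed[OF assms(3) closed_closure, of "{x \<in> S. f x \<noteq> 0}"] by (simp add: inf.absorb2)
  ultimately show ?thesis
    unfolding smooth_compact_support_def using assms(2,4) by auto
qed

lemma smooth_compact_supportE:
  assumes "open S" "smooth_compact_support S f"
  obtains K where "compact K" "K \<subseteq> S" "\<And>x. x \<in> S - K \<Longrightarrow> f x = 0" "\<And>k. Ck_on k S f"
proof (rule that[of "closure {x \<in> S. f x \<noteq> 0}"])
  show "f x = 0" if "x \<in> S - closure {x \<in> S. f x \<noteq> 0}" for x
    using that closure_subset[of "{x \<in> S. f x \<noteq> 0}"] by auto
qed (use assms in \<open>auto simp: smooth_compact_support_def\<close>)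

lemma smooth_compact_support_box_cutoff:
  assumes "open S" "cbox a b \<subseteq> S"
  shows "smooth_compact_support S (box_cutoff n a b)"
proof (rule smooth_compact_supportI[of _ _ "cbox a b"])
  show "Ck_on k S (box_cutoff n a b)" for k
    using Ck_on_subset[OF _ assms(1) _ Ck_on_box_cutoff] by auto
  show "box_cutoff n a b x = 0" if "x \<in> S - cbox a b" for x
    using that box_subset_cbox[of a b] by (intro box_cutoff_outside) auto
qed (use assms in auto)

text \<open>S and the complement of the compact K are open and cover the space. The extension equals
  f on the first and 0 on the second.\<close>

lemma smooth_compact_support_extend:
  fixes f :: "'a::euclidean_space \<Rightarrow> 'b::real_normed_vector"
  assumes "open S" "smooth_compact_support S f"
  shows "Ck_on k UNIV (\<lambda>x. if x \<in> S then f x else 0)"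
proof -
  obtain K where K: "compact K" "K \<subseteq> S" "\<And>x. x \<in> S - K \<Longrightarrow> f x = 0" and f: "\<And>k. Ck_on k S f"
    using smooth_compact_supportE[OF assms] by metis
  have o: "open (- K)" using K(1) compact_imp_closed by auto
  have "Ck_on k (S \<union> - K) (\<lambda>x. if x \<in> S then f x else 0)"
  proof (rule Ck_on_Un[OF assms(1) o])
    show "Ck_on k S (\<lambda>x. if x \<in> S then f x else 0)"
      by (rule Ck_on_cong_imp[OF assms(1) _ f]) auto
    show "Ck_on k (-K) (\<lambda>x. if x \<in> S then f x else 0)"
      by (rule Ck_on_cong_imp[OF o _ Ck_on_const[of k "-K" 0]]) (use K(3) in auto)
  qed
  moreover have "S \<union> - K = UNIV" using K(2) by auto
  ultimately show ?thesis by simp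
qed

lemma Ck_on_translate:
  assumes "open S" "Ck_on k S f"
  shows "Ck_on k ((\<lambda>x. x + c) -` S) (\<lambda>x. f (x + c))"
  using assms(2)
proof (induction k arbitrary: f)
  case 0
  then show ?case by (auto intro!: continuous_intros continuous_on_compose2[of S f])
next
  case (Suc k)
  have o: "open ((\<lambda>x. x + c) -` S)"
    by (intro open_vimage assms(1) continuous_intros)
  have d: "f differentiable_on S" using Suc.prems by auto
  have D: "((\<lambda>x. f (x + c)) has_derivative frechet_derivative f (at (x + c))) (at x)"
    if "x \<in> (\<lambda>x. x + c) -` S" for x
  proof -
    have "((\<lambda>x. x + c) has_derivative (\<lambda>x. x)) (at x)" by (auto intro!: derivative_eq_intros)
    from diff_chain_at[OF this, of f "frechet_derivative f (at (x + c))"]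
    show ?thesis using has_derivative_frechet[OF d assms(1), of "x + c"] that by (simp add: o_def)
  qed
  have "(\<lambda>x. f (x + c)) differentiable_on (\<lambda>x. x + c) -` S"
    by (rule differentiable_on_derivI[OF D])
  moreover have "Ck_on k ((\<lambda>x. x + c) -` S) (\<lambda>x. frechet_derivative (\<lambda>x. f (x + c)) (at x) v)" for v
    by (rule Ck_on_cong_imp[OF o _ Suc.IH[of "\<lambda>x. frechet_derivative f (at x) v"]])
      (use Suc.prems in \<open>auto simp: frechet_derivative_eqI[OF D]\<close>)
  ultimately show ?case by simp
qed

subsection \<open>Jordan decomposition of signed measures\<close>

lemma vector_measure_sums:
  "\<lbrakk>vector_measure M \<mu>; range A \<subseteq> sets M; disjoint_family A\<rbrakk> \<Longrightarrow> (\<lambda>n. \<mu> (A n)) sums \<mu> (\<Union>n. A n)"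
  unfolding vector_measure_def by blast

text \<open>The constant sequence of empty sets is disjoint, and a series of equal terms converges
  only if they are 0.\<close>

lemma vector_measure_empty:
  assumes "vector_measure M \<mu>"
  shows "\<mu> {} = 0"
proof -
  have "(\<lambda>n::nat. \<mu> {}) sums \<mu> {}"
    using vector_measure_sums[OF assms, of "\<lambda>n. {}"] by (simp add: disjoint_family_on_def)
  then have "summable (\<lambda>n::nat. \<mu> {})" by (rule sums_summable)
  then show ?thesis by (simp add: summable_const_iff)
qed

lemma vector_measure_Un:
  assumes "vector_measure M \<mu>" "A \<in> sets M" "B \<in> sets M" "A \<inter> B = {}"
  shows "\<mu> (A \<union> B) = \<mu> A + \<mu> B"
proof -
  have "(\<lambda>n. \<mu> (binaryset A B n)) sums \<mu> (\<Union>n. binaryset A B n)"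
    by (rule vector_measure_sums[OF assms(1)])
      (use assms in \<open>auto simp: range_binaryset_eq disjoint_family_on_def binaryset_def\<close>)
  moreover have "(\<lambda>n. \<mu> (binaryset A B n)) sums (\<mu> A + \<mu> B)"
    by (rule binaryset_sums) (rule vector_measure_empty[OF assms(1)])
  ultimately show ?thesis by (metis sums_unique2 UN_binaryset_eq)
qed

lemma vector_measure_Diff:
  assumes "vector_measure M \<mu>" "A \<in> sets M" "B \<in> sets M" "B \<subseteq> A"
  shows "\<mu> (A - B) = \<mu> A - \<mu> B"
proof -
  have "(A - B) \<union> B = A" "(A - B) \<inter> B = {}" using assms(4) by auto
  then show ?thesis
    using vector_measure_Un[OF assms(1), of "A - B" B] assms(2,3) by simp
qed

lemma vector_measure_bounded_linear:
  assumes "vector_measure M \<mu>" "bounded_linear L"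
  shows "vector_measure M (\<lambda>A. L (\<mu> A))"
  using assms bounded_linear.sums unfolding vector_measure_def by blast

lemma vector_measure_uminus: "vector_measure M \<mu> \<Longrightarrow> vector_measure M (\<lambda>A. - \<mu> A)"
  by (rule vector_measure_bounded_linear) (auto intro: bounded_linear_minus bounded_linear_ident)

lemma ennreal_sum_le: "ennreal (\<Sum>i\<in>I. f i) \<le> (\<Sum>i\<in>I. ennreal (f i))"
proof (induction I rule: infinite_finite_induct)
  case (insert i I)
  have "ennreal (f i + sum f I) \<le> ennreal (max 0 (f i) + max 0 (sum f I))"
    by (intro ennreal_leI) auto
  also have "\<dots> = ennreal (f i) + ennreal (sum f I)"
    by (subst ennreal_plus) (auto simp: max_def ennreal_neg)
  finally show ?case using insert by (simp add: add_mono order_trans[OF _ add_left_mono])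
qed auto

lemma sums_ennreal_le:
  assumes "f sums x"
  shows "ennreal x \<le> (\<Sum>n. ennreal (f n))"
proof (rule LIMSEQ_le_const2)
  show "(\<lambda>n. ennreal (\<Sum>i<n. f i)) \<longlonglongrightarrow> ennreal x"
    using assms by (intro tendsto_ennrealI) (simp add: sums_def)
  have "ennreal (\<Sum>i<n. f i) \<le> (\<Sum>n. ennreal (f n))" for n
    by (rule order_trans[OF ennreal_sum_le sum_le_suminf]) auto
  then show "\<exists>N. \<forall>n\<ge>N. ennreal (\<Sum>i<n. f i) \<le> (\<Sum>n. ennreal (f n))" by blast
qed

text \<open>Competitors for A and for B are disjoint, so their union competes for the union of A and
  B.\<close>

lemma sup_subsets_superadditive:
  fixes \<mu> :: "'a set \<Rightarrow> real"
  assumes "vector_measure M \<mu>" "A \<inter> B = {}"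
  shows "(SUP C\<in>{C\<in>sets M. C \<subseteq> A}. ennreal (\<mu> C)) + (SUP C\<in>{C\<in>sets M. C \<subseteq> B}. ennreal (\<mu> C))
         \<le> (SUP C\<in>{C\<in>sets M. C \<subseteq> A \<union> B}. ennreal (\<mu> C))" (is "?u A + ?u B \<le> _")
proof -
  have le: "ennreal (\<mu> C) + ennreal (\<mu> D) \<le> ?u (A \<union> B)"
    if C: "C \<in> sets M" "C \<subseteq> A" and D: "D \<in> sets M" "D \<subseteq> B" for C D
  proof -
    \<comment> \<open>\<open>ennreal\<close> turns a negative value into 0, which is also the value
      of the empty set. Replacing competitors of negative measure by the empty set makes the sum
      exact.\<close>
    define C' D' where "C' = (if \<mu> C \<ge> 0 then C else {})" and "D' = (if \<mu> D \<ge> 0 then D else {})"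
    have "ennreal (\<mu> C) + ennreal (\<mu> D) = ennreal (\<mu> C') + ennreal (\<mu> D')"
      by (auto simp: C'_def D'_def ennreal_neg vector_measure_empty[OF assms(1)])
    also have "\<dots> = ennreal (\<mu> C' + \<mu> D')"
      by (subst ennreal_plus) (auto simp: C'_def D'_def vector_measure_empty[OF assms(1)])
    also have "\<dots> = ennreal (\<mu> (C' \<union> D'))"
      using C D assms(2) by (subst vector_measure_Un[OF assms(1)]) (auto simp: C'_def D'_def)
    also have "\<dots> \<le> ?u (A \<union> B)"
      using C D by (intro SUP_upper) (auto simp: C'_def D'_def)
    finally show ?thesis .
  qed
  have ne: "{C\<in>sets M. C \<subseteq> X} \<noteq> {}" for X by auto
  have "?u A + ennreal (\<mu> D) \<le> ?u (A \<union> B)" if "D \<in> sets M" "D \<subseteq> B" for D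
    unfolding ennreal_SUP_add_left[OF ne, symmetric] using le that by (intro SUP_least) auto
  then show ?thesis
    by (subst ennreal_SUP_add_right[OF ne]) (intro SUP_least, auto)
qed

lemma space_positive_part [simp]: "space (positive_part M \<mu>) = space M"
  and sets_positive_part [simp, measurable_cong]: "sets (positive_part M \<mu>) = sets M"
  using sets.space_closed[of M] by (auto simp: positive_part_def)

text \<open>\<open>measure_of\<close> returns the given set function only if it is countably
  additive. Superadditivity bounds the partial sums by the supremum over the union; conversely, a
  competitor for the union splits into its intersections with the pieces.\<close>

lemma emeasure_positive_part:
  fixes \<mu> :: "'a set \<Rightarrow> real"
  assumes v: "vector_measure M \<mu>" and A: "A \<in> sets M"
  shows "emeasure (positive_part M \<mu>) A = (SUP B \<in> {B \<in> sets M. B \<subseteq> A}. ennreal (\<mu> B))"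
    (is "_ = ?u A")
proof -
  have "{B \<in> sets M. B \<subseteq> {}} = {{}}" by auto
  then have pos: "positive (sets M) ?u"
    by (simp add: positive_def vector_measure_empty[OF v])
  moreover have "countably_additive (sets M) ?u"
  proof (rule countably_additiveI)
    fix A :: "nat \<Rightarrow> 'a set" assume A: "range A \<subseteq> sets M" "disjoint_family A"
    show "(\<Sum>i. ?u (A i)) = ?u (\<Union>i. A i)"
    proof (rule antisym)
      have "(\<Sum>i<n. ?u (A i)) \<le> ?u (\<Union>i<n. A i)" for n
      proof (induction n)
        case 0 then show ?case by simp
      next
        case (Suc n)
        have d: "(\<Union>i<n. A i) \<inter> A n = {}"
          using A(2) by (auto simp: disjoint_family_on_def dest: less_not_refl3)
        have "(\<Sum>i<Suc n. ?u (A i)) \<le> ?u (\<Union>i<n. A i) + ?u (A n)"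
          using Suc by (simp add: add_right_mono)
        also have "\<dots> \<le> ?u ((\<Union>i<n. A i) \<union> A n)"
          by (rule sup_subsets_superadditive[OF v d])
        finally show ?case by (simp add: lessThan_Suc Un_commute)
      qed
      also have "?u (\<Union>i<n. A i) \<le> ?u (\<Union>i. A i)" for n
        by (rule SUP_subset_mono) auto
      finally show "(\<Sum>i. ?u (A i)) \<le> ?u (\<Union>i. A i)"
        by (intro suminf_le_const) auto
    next
      show "?u (\<Union>i. A i) \<le> (\<Sum>i. ?u (A i))"
      proof (rule SUP_least)
        fix B assume B: "B \<in> {B \<in> sets M. B \<subseteq> (\<Union>i. A i)}"
        have "(\<lambda>i. \<mu> (B \<inter> A i)) sums \<mu> (\<Union>i. B \<inter> A i)"
          by (rule vector_measure_sums[OF v]) (use A B in \<open>auto simp: disjoint_family_on_def\<close>)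
        moreover have "(\<Union>i. B \<inter> A i) = B" using B by auto
        ultimately have "ennreal (\<mu> B) \<le> (\<Sum>i. ennreal (\<mu> (B \<inter> A i)))"
          using sums_ennreal_le by metis
        also have "\<dots> \<le> (\<Sum>i. ?u (A i))"
          using A B by (intro suminf_le SUP_upper) auto
        finally show "ennreal (\<mu> B) \<le> (\<Sum>i. ?u (A i))" .
      qed
    qed
  qed
  ultimately show ?thesis
    unfolding positive_part_def using A by (subst emeasure_measure_of_sigma) (auto simp: sets.sigma_algebra_axioms)
qed

text \<open>Iterated from the whole space, this step produces disjoint sets whose measures do not tend to \<open>0\<close>;
  so the positive part of a real-valued signed measure is finite.\<close>

lemma emeasure_positive_part_infinite_step:
  fixes \<mu> :: "'a set \<Rightarrow> real" and M :: "'a measure"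
  defines "T \<equiv> \<lambda>A. emeasure (positive_part M \<mu>) A + emeasure (positive_part M (\<lambda>A. - \<mu> A)) A"
  assumes v: "vector_measure M \<mu>" and A: "A \<in> sets M" "T A = \<infinity>"
  shows "\<exists>B\<in>sets M. B \<subseteq> A \<and> T B = \<infinity> \<and> \<bar>\<mu> (A - B)\<bar> \<ge> 1"
proof -
  note v' = vector_measure_uminus[OF v]
  \<comment> \<open>The margin 1 makes both |\<mu> E| and |\<mu> (A - E)| at least 1. So whichever
    of E and A - E has infinite mass can be kept and the other removed.\<close>
  have "\<exists>E\<in>sets M. E \<subseteq> A \<and> \<bar>\<mu> E\<bar> \<ge> \<bar>\<mu> A\<bar> + 1"
  proof -
    have "emeasure (positive_part M \<mu>) A = \<infinity> \<or> emeasure (positive_part M (\<lambda>A. - \<mu> A)) A = \<infinity>"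
      using A(2) unfolding T_def by auto
    then have "ennreal (\<bar>\<mu> A\<bar> + 1) < emeasure (positive_part M \<mu>) A \<or>
        ennreal (\<bar>\<mu> A\<bar> + 1) < emeasure (positive_part M (\<lambda>A. - \<mu> A)) A"
      by auto
    then obtain E where "E \<in> sets M" "E \<subseteq> A"
      "ennreal (\<bar>\<mu> A\<bar> + 1) < ennreal (\<mu> E) \<or> ennreal (\<bar>\<mu> A\<bar> + 1) < ennreal (- \<mu> E)"
      unfolding emeasure_positive_part[OF v A(1)] emeasure_positive_part[OF v' A(1)] less_SUP_iff by auto
    then show ?thesis by (intro bexI[of _ E]) (auto simp: ennreal_less_iff simp del: ennreal_plus)
  qed
  then obtain E where E: "E \<in> sets M" "E \<subseteq> A" "\<bar>\<mu> E\<bar> \<ge> \<bar>\<mu> A\<bar> + 1" by auto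
  have "T A = T E + T (A - E)"
    using plus_emeasure[of E "positive_part M \<mu>" "A - E"]
      plus_emeasure[of E "positive_part M (\<lambda>A. - \<mu> A)" "A - E"] A(1) E
    by (simp add: T_def Un_absorb1 algebra_simps)
  then have "T E = \<infinity> \<or> T (A - E) = \<infinity>"
    using A(2) ennreal_add_eq_top by (metis infinity_ennreal_def)
  then show ?thesis
  proof
    assume "T E = \<infinity>"
    then show ?thesis using E vector_measure_Diff[OF v A(1) E(1,2)] by (intro bexI[of _ E]) auto
  next
    assume "T (A - E) = \<infinity>"
    moreover have "A - (A - E) = E" using E by auto
    ultimately show ?thesis using E A(1) by (intro bexI[of _ "A - E"]) auto
  qed
qed

lemma finite_positive_part:
  fixes \<mu> :: "'a set \<Rightarrow> real"
  assumes v: "vector_measure M \<mu>"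
  shows "finite_measure (positive_part M \<mu>)"
proof
  let ?T = "\<lambda>A. emeasure (positive_part M \<mu>) A + emeasure (positive_part M (\<lambda>A. - \<mu> A)) A"
  have "?T (space M) \<noteq> \<infinity>"
  proof
    assume inf: "?T (space M) = \<infinity>"
    have "\<exists>A. \<forall>n. (A n \<in> sets M \<and> ?T (A n) = \<infinity>) \<and> (A (Suc n) \<subseteq> A n \<and> \<bar>\<mu> (A n - A (Suc n))\<bar> \<ge> 1)"
    proof (rule dependent_nat_choice)
      show "\<exists>A. A \<in> sets M \<and> ?T A = \<infinity>" using inf by auto
      show "\<exists>B. (B \<in> sets M \<and> ?T B = \<infinity>) \<and> B \<subseteq> A \<and> 1 \<le> \<bar>\<mu> (A - B)\<bar>"
        if "A \<in> sets M \<and> ?T A = \<infinity>" for A and n :: nat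
        using emeasure_positive_part_infinite_step[OF v] that by blast
    qed
    then obtain A where A: "\<And>n. A n \<in> sets M" "\<And>n. A (Suc n) \<subseteq> A n"
      "\<And>n. \<bar>\<mu> (A n - A (Suc n))\<bar> \<ge> 1" by blast
    have dec: "A n \<subseteq> A m" if "m \<le> n" for m n
      using lift_Suc_antimono_le[of A, OF A(2) that] .
    have disj: "(A m - A (Suc m)) \<inter> (A n - A (Suc n)) = {}" if "m < n" for m n
      using dec[of "Suc m" n] that by auto
    then have "disjoint_family (\<lambda>n. A n - A (Suc n))"
      unfolding disjoint_family_on_def by (metis Int_commute linorder_neqE_nat)
    then have "(\<lambda>n. \<mu> (A n - A (Suc n))) sums \<mu> (\<Union>n. A n - A (Suc n))"
      using A(1) by (intro vector_measure_sums[OF v]) auto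
    then have "(\<lambda>n. \<mu> (A n - A (Suc n))) \<longlonglongrightarrow> 0"
      using sums_summable summable_LIMSEQ_zero by blast
    then have "\<forall>\<^sub>F n in sequentially. \<bar>\<mu> (A n - A (Suc n))\<bar> < 1"
      using order_tendstoD(2)[OF tendsto_rabs_zero, of _ _ 1] by auto
    then show False using A(3) by (auto simp: eventually_sequentially not_less[symmetric])
  qed
  then show "emeasure (positive_part M \<mu>) (space (positive_part M \<mu>)) \<noteq> \<infinity>" by auto
qed

lemma measure_positive_part_ge:
  fixes \<mu> :: "'a set \<Rightarrow> real"
  assumes v: "vector_measure M \<mu>" and "A \<in> sets M" "B \<in> sets M" "B \<subseteq> A"
  shows "\<mu> B \<le> measure (positive_part M \<mu>) A"
proof -
  interpret finite_measure "positive_part M \<mu>" by (rule finite_positive_part[OF v])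
  have "ennreal (\<mu> B) \<le> emeasure (positive_part M \<mu>) A"
    unfolding emeasure_positive_part[OF v assms(2)] using assms by (intro SUP_upper) auto
  then show ?thesis by (simp add: emeasure_eq_measure)
qed

text \<open>For every B inside A, \<mu> B = \<mu> A - \<mu> (A - B), and -\<mu> (A - B) is at most
  the negative part of A. The supremum over B gives the bound.\<close>

lemma measure_positive_part_le:
  fixes \<mu> :: "'a set \<Rightarrow> real"
  assumes v: "vector_measure M \<mu>" and A: "A \<in> sets M"
  shows "measure (positive_part M \<mu>) A \<le> \<mu> A + measure (positive_part M (\<lambda>A. - \<mu> A)) A"
proof -
  note v' = vector_measure_uminus[OF v]
  have *: "\<mu> B \<le> \<mu> A + measure (positive_part M (\<lambda>A. - \<mu> A)) A" if "B \<in> sets M" "B \<subseteq> A" for B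
    using measure_positive_part_ge[OF v' A, of "A - B"] vector_measure_Diff[OF v A that] that A by auto
  interpret finite_measure "positive_part M \<mu>" by (rule finite_positive_part[OF v])
  have "emeasure (positive_part M \<mu>) A \<le> ennreal (\<mu> A + measure (positive_part M (\<lambda>A. - \<mu> A)) A)"
    unfolding emeasure_positive_part[OF v A] using * by (intro SUP_least ennreal_leI) auto
  moreover have "0 \<le> \<mu> A + measure (positive_part M (\<lambda>A. - \<mu> A)) A"
    using *[of "{}"] vector_measure_empty[OF v] by simp
  ultimately show ?thesis by (simp add: emeasure_eq_measure)
qed

text \<open>The preceding bound for \<mu> and for -\<mu> gives the two inequalities; a Hahn set is
  never constructed. Finiteness of both parts makes the difference of real numbers
  meaningful.\<close>

lemma jordan_decomposition:
  fixes \<mu> :: "'a set \<Rightarrow> real"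
  assumes v: "vector_measure M \<mu>" and A: "A \<in> sets M"
  shows "\<mu> A = measure (positive_part M \<mu>) A - measure (positive_part M (\<lambda>A. - \<mu> A)) A"
  using measure_positive_part_le[OF v A] measure_positive_part_le[OF vector_measure_uminus[OF v] A] by simp

text \<open>Transported to the whole space, where it can be compared with \<^const>\<open>lborel\<close>.\<close>

definition borel_positive_part ::
  "'a::euclidean_space set \<Rightarrow> ('a set \<Rightarrow> real) \<Rightarrow> 'a measure" where
  "borel_positive_part \<Omega> \<mu> = distr (positive_part (borel_on \<Omega>) \<mu>) borel (\<lambda>x. x)"

lemma measurable_id_positive_part: "(\<lambda>x. x) \<in> measurable (positive_part (borel_on \<Omega>) \<mu>) borel"
  by (subst measurable_cong_sets[OF sets_positive_part refl]) (rule measurable_ident[unfolded id_def, THEN measurable_restrict_space1])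

lemma sets_borel_positive_part [simp, measurable_cong]: "sets (borel_positive_part \<Omega> \<mu>) = sets borel"
  and space_borel_positive_part [simp]: "space (borel_positive_part \<Omega> \<mu>) = UNIV"
  by (simp_all add: borel_positive_part_def)

lemma sets_borel_on: "\<Omega> \<in> sets borel \<Longrightarrow> sets (borel_on \<Omega>) = {A \<in> sets borel. A \<subseteq> \<Omega>}"
  using sets_restrict_space_iff[of \<Omega> borel] by (auto dest: sets.sets_into_space)

lemma finite_borel_positive_part:
  "vector_measure (borel_on \<Omega>) \<mu> \<Longrightarrow> finite_measure (borel_positive_part \<Omega> \<mu>)"
  unfolding borel_positive_part_def
  by (rule finite_measure.finite_measure_distr[OF finite_positive_part measurable_id_positive_part])

lemma measure_borel_positive_part:
  "A \<in> sets borel \<Longrightarrow>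
    measure (borel_positive_part \<Omega> \<mu>) A = measure (positive_part (borel_on \<Omega>) \<mu>) (A \<inter> \<Omega>)"
  unfolding borel_positive_part_def
  by (subst measure_distr[OF measurable_id_positive_part]) (auto simp: space_restrict_space)

lemma borel_jordan_decomposition:
  assumes "vector_measure (borel_on \<Omega>) \<mu>" "\<Omega> \<in> sets borel" "A \<in> sets borel" "A \<subseteq> \<Omega>"
  shows "\<mu> A = measure (borel_positive_part \<Omega> \<mu>) A - measure (borel_positive_part \<Omega> (\<lambda>A. - \<mu> A)) A"
proof -
  have "A \<inter> \<Omega> = A" using assms by auto
  then show ?thesis
    using jordan_decomposition[OF assms(1), of A] assms by (simp add: measure_borel_positive_part sets_borel_on)
qed

text \<open>A test function may be arbitrary off \<Omega>, whereas integration against a measure on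
  the whole space asks for a Borel function \<psi>.\<close>

lemma signed_integral_eq:
  assumes "\<psi> \<in> borel_measurable borel" "\<And>x. x \<in> \<Omega> \<Longrightarrow> \<psi> x = \<phi> x"
  shows "signed_integral (borel_on \<Omega>) \<mu> \<phi> =
    integral\<^sup>L (borel_positive_part \<Omega> \<mu>) \<psi> - integral\<^sup>L (borel_positive_part \<Omega> (\<lambda>A. - \<mu> A)) \<psi>"
proof -
  have "integral\<^sup>L (positive_part (borel_on \<Omega>) \<nu>) \<phi> = integral\<^sup>L (borel_positive_part \<Omega> \<nu>) \<psi>" for \<nu>
    unfolding borel_positive_part_def integral_distr[OF measurable_id_positive_part assms(1)]
    by (rule Bochner_Integration.integral_cong) (auto simp: space_restrict_space assms(2))
  then show ?thesis unfolding signed_integral_def by simp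
qed

subsection \<open>Total variation and test fields\<close>

text \<open>The variation is a supremum over sequences of sets. A finite partition is enumerated and
  padded with empty sets, whose measure is 0.\<close>

lemma variation_ge_sum:
  assumes v: "vector_measure M \<mu>" and I: "finite I" "\<And>i. i \<in> I \<Longrightarrow> A i \<in> sets M"
    "disjoint_family_on A I" "(\<Union>i\<in>I. A i) = X"
  shows "(\<Sum>i\<in>I. ennreal (norm (\<mu> (A i)))) \<le> variation M \<mu> X"
proof -
  obtain e where e: "bij_betw e {0..<card I} I"
    using ex_bij_betw_nat_finite[OF I(1)] by auto
  define P where "P n = (if n < card I then A (e n) else {})" for n
  have eI: "e n \<in> I" if "n < card I" for n using e that by (auto simp: bij_betw_def)
  have inj: "m = n" if "e m = e n" "m < card I" "n < card I" for m n
    using e that by (auto simp: bij_betw_def inj_on_def)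
  have "(\<Union>n. P n) = (\<Union>n\<in>{0..<card I}. A (e n))" by (auto simp: P_def split: if_splits)
  also have "\<dots> = (\<Union>i\<in>I. A i)"
    using bij_betw_imp_surj_on[OF e] image_image[of A e "{0..<card I}"] by simp
  finally have "(\<Union>n. P n) = X" using I(4) by simp
  moreover have "disjoint_family P"
    using I(3) eI inj unfolding disjoint_family_on_def P_def by (auto; metis disjoint_iff)
  moreover have "range P \<subseteq> sets M" using I(2) eI by (auto simp: P_def)
  ultimately have "(\<Sum>n. ennreal (norm (\<mu> (P n)))) \<le> variation M \<mu> X"
    unfolding variation_def by (intro SUP_upper) auto
  moreover have "(\<Sum>n. ennreal (norm (\<mu> (P n)))) = (\<Sum>n\<in>{0..<card I}. ennreal (norm (\<mu> (P n))))"
    by (rule suminf_finite) (auto simp: P_def vector_measure_empty[OF v])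
  moreover have "\<dots> = (\<Sum>n\<in>{0..<card I}. ennreal (norm (\<mu> (A (e n)))))"
    by (rule sum.cong) (auto simp: P_def)
  moreover have "\<dots> = (\<Sum>i\<in>I. ennreal (norm (\<mu> (A i))))"
    by (rule sum.reindex_bij_betw[OF e])
  ultimately show ?thesis by simp
qed

lemma integral_simple_function_range:
  fixes g :: "'b \<Rightarrow> real"
  assumes "finite_measure M" "simple_function M s"
  shows "integral\<^sup>L M (\<lambda>x. g (s x)) = (\<Sum>y\<in>s ` space M. g y * measure M (s -` {y} \<inter> space M))"
proof -
  interpret finite_measure M by fact
  have fin: "finite (s ` space M)" and m: "\<And>y. s -` {y} \<inter> space M \<in> sets M"
    using assms(2) by (auto simp: simple_functionD)
  have "integral\<^sup>L M (\<lambda>x. g (s x)) =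
      integral\<^sup>L M (\<lambda>x. \<Sum>y\<in>s ` space M. g y * indicator (s -` {y} \<inter> space M) x)"
  proof (rule Bochner_Integration.integral_cong)
    fix x assume x: "x \<in> space M"
    have "(\<Sum>y\<in>s ` space M. g y * indicator (s -` {y} \<inter> space M) x) = (\<Sum>y\<in>s ` space M. if y = s x then g y else 0)"
      by (rule sum.cong) (use x in \<open>auto simp: indicator_def\<close>)
    then show "g (s x) = (\<Sum>y\<in>s ` space M. g y * indicator (s -` {y} \<inter> space M) x)"
      using fin x by simp
  qed simp
  also have "\<dots> = (\<Sum>y\<in>s ` space M. g y * measure M (s -` {y} \<inter> space M))"
    using m by (subst Bochner_Integration.integral_sum)
      (auto intro!: integrable_mult_right integrable_real_indicator simp: emeasure_eq_measure Int_absorb2)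
  finally show ?thesis .
qed

lemma inner_matrix: "A \<bullet> B = (\<Sum>i\<in>UNIV. \<Sum>k\<in>UNIV. A $ i $ k * B $ i $ k)" for A B :: "real^'d^'m"
  by (simp add: inner_vec_def)

lemma bounded_linear_entry: "bounded_linear (\<lambda>A :: real^'d^'m. A $ i $ k)"
  using bounded_linear_compose[OF bounded_linear_vec_nth bounded_linear_vec_nth] .

lemma vector_measure_entry:
  fixes \<mu> :: "'a set \<Rightarrow> real^'d^'m"
  assumes "vector_measure M \<mu>"
  shows "vector_measure M (\<lambda>A. \<mu> A $ i $ k)"
  by (rule vector_measure_bounded_linear[OF assms bounded_linear_entry])

lemma borel_measurable_entry:
  fixes f :: "'a \<Rightarrow> real^'d^'m"
  shows "f \<in> borel_measurable M \<Longrightarrow> (\<lambda>x. f x $ i $ k) \<in> borel_measurable M"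
  by (rule measurable_compose[OF _ borel_measurable_continuous_onI[OF linear_continuous_on[OF bounded_linear_entry]]])

text \<open>If s takes the value y on \<open>A y\<close>, the pairing is the finite sum of the inner
  products of y and \<mu> (A y). By Cauchy-Schwarz each is at most the norm of \<mu> (A y), and the
  sets \<open>A y\<close> partition the space.\<close>

lemma signed_integral_simple_le_variation:
  fixes \<mu> :: "'a set \<Rightarrow> real^'d^'m"
  assumes v: "vector_measure M \<mu>" and s: "simple_function M s" "\<And>x. x \<in> space M \<Longrightarrow> norm (s x) \<le> 1"
  shows "ennreal (\<Sum>i\<in>UNIV. \<Sum>k\<in>UNIV. signed_integral M (\<lambda>A. \<mu> A $ i $ k) (\<lambda>x. s x $ i $ k))
         \<le> variation M \<mu> (space M)"
proof -
  define I where "I = s ` space M"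
  define A where "A y = s -` {y} \<inter> space M" for y
  have fin: "finite I" and m: "\<And>y. A y \<in> sets M"
    using s(1) by (auto simp: simple_functionD I_def A_def)
  have sig: "signed_integral M (\<lambda>A. \<mu> A $ i $ k) (\<lambda>x. s x $ i $ k) = (\<Sum>y\<in>I. y $ i $ k * \<mu> (A y) $ i $ k)" for i k
  proof -
    note vik = vector_measure_entry[OF v, of i k]
    have 1: "simple_function (positive_part M \<nu>) s" for \<nu>
      using s(1) by (simp add: simple_function_def)
    show ?thesis
      unfolding signed_integral_def jordan_decomposition[OF vik m] right_diff_distrib sum_subtractf
      using integral_simple_function_range[OF finite_positive_part[OF vik] 1, of "\<lambda>y. y $ i $ k"]
        integral_simple_function_range[OF finite_positive_part[OF vector_measure_uminus[OF vik]] 1, of "\<lambda>y. y $ i $ k"]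
      by (simp add: I_def A_def)
  qed
  have "(\<Sum>i\<in>UNIV. \<Sum>k\<in>UNIV. signed_integral M (\<lambda>A. \<mu> A $ i $ k) (\<lambda>x. s x $ i $ k)) =
      (\<Sum>i\<in>UNIV. \<Sum>y\<in>I. \<Sum>k\<in>UNIV. y $ i $ k * \<mu> (A y) $ i $ k)"
    unfolding sig by (intro sum.cong refl sum.swap)
  also have "\<dots> = (\<Sum>y\<in>I. y \<bullet> \<mu> (A y))"
    unfolding inner_matrix by (rule sum.swap)
  also have "\<dots> \<le> (\<Sum>y\<in>I. norm (\<mu> (A y)))"
  proof (rule sum_mono)
    fix y assume "y \<in> I"
    then have "norm y \<le> 1" using s(2) by (auto simp: I_def)
    then show "y \<bullet> \<mu> (A y) \<le> norm (\<mu> (A y))"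
      using norm_cauchy_schwarz[of y "\<mu> (A y)"] mult_right_mono[of "norm y" 1 "norm (\<mu> (A y))"] by simp
  qed
  finally have "ennreal (\<Sum>i\<in>UNIV. \<Sum>k\<in>UNIV. signed_integral M (\<lambda>A. \<mu> A $ i $ k) (\<lambda>x. s x $ i $ k)) \<le>
      ennreal (\<Sum>y\<in>I. norm (\<mu> (A y)))" by (rule ennreal_leI)
  also have "\<dots> = (\<Sum>y\<in>I. ennreal (norm (\<mu> (A y))))" by simp
  also have "\<dots> \<le> variation M \<mu> (space M)"
    by (rule variation_ge_sum[OF v fin m]) (auto simp: disjoint_family_on_def A_def I_def)
  finally show ?thesis .
qed

lemma signed_integral_le_variation:
  fixes \<mu> :: "'a set \<Rightarrow> real^'d^'m"
  assumes v: "vector_measure M \<mu>" and \<Phi>: "\<Phi> \<in> borel_measurable M" "\<And>x. x \<in> space M \<Longrightarrow> norm (\<Phi> x) \<le> 1"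
  shows "ennreal (\<Sum>i\<in>UNIV. \<Sum>k\<in>UNIV. signed_integral M (\<lambda>A. \<mu> A $ i $ k) (\<lambda>x. \<Phi> x $ i $ k))
         \<le> variation M \<mu> (space M)"
proof -
  obtain s where s: "\<And>n. simple_function M (s n)" "\<And>x. x \<in> space M \<Longrightarrow> (\<lambda>n. s n x) \<longlonglongrightarrow> \<Phi> x"
    using borel_measurable_implies_sequence_metric[OF \<Phi>(1), of 0] by blast
  \<comment> \<open>The approximating simple fields may leave the unit ball. Dividing by max 1 of
    the norm brings them back and keeps the limit, since |\<Phi>| \<le> 1.\<close>
  define t where "t n x = (1 / max 1 (norm (s n x))) *\<^sub>R s n x" for n x
  have t: "simple_function M (t n)" for n
    using simple_function_compose[OF s(1), of "\<lambda>v. (1 / max 1 (norm v)) *\<^sub>R v"]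
    by (simp add: t_def[abs_def] o_def)
  have nt: "norm (t n x) \<le> 1" for n x
    by (auto simp: t_def max_def)
  have lim: "(\<lambda>n. t n x) \<longlonglongrightarrow> \<Phi> x" if "x \<in> space M" for x
  proof -
    have "(\<lambda>n. t n x) \<longlonglongrightarrow> (1 / max 1 (norm (\<Phi> x))) *\<^sub>R \<Phi> x"
      unfolding t_def by (intro tendsto_intros s(2) that) auto
    then show ?thesis using \<Phi>(2)[OF that] by (simp add: max_absorb1)
  qed
  have bd: "\<bar>t n x $ i $ k\<bar> \<le> 1" for n x i k
    using Finite_Cartesian_Product.norm_nth_le[of "t n x $ i" k]
      Finite_Cartesian_Product.norm_nth_le[of "t n x" i] nt[of n x] by simp
  have conv: "(\<lambda>n. signed_integral M (\<lambda>A. \<mu> A $ i $ k) (\<lambda>x. t n x $ i $ k)) \<longlonglongrightarrow>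
      signed_integral M (\<lambda>A. \<mu> A $ i $ k) (\<lambda>x. \<Phi> x $ i $ k)" for i k
  proof -
    have *: "(\<lambda>n. integral\<^sup>L (positive_part M \<nu>) (\<lambda>x. t n x $ i $ k)) \<longlonglongrightarrow> integral\<^sup>L (positive_part M \<nu>) (\<lambda>x. \<Phi> x $ i $ k)"
      if "vector_measure M \<nu>" for \<nu> :: "'a set \<Rightarrow> real"
    proof (rule integral_dominated_convergence[where w = "\<lambda>_. 1"])
      interpret finite_measure "positive_part M \<nu>" by (rule finite_positive_part[OF that])
      show "integrable (positive_part M \<nu>) (\<lambda>_. 1::real)" by simp
      show "(\<lambda>x. \<Phi> x $ i $ k) \<in> borel_measurable (positive_part M \<nu>)"
        using borel_measurable_entry[OF \<Phi>(1)] by (simp add: measurable_cong_sets[OF sets_positive_part refl])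
      show "(\<lambda>x. t n x $ i $ k) \<in> borel_measurable (positive_part M \<nu>)" for n
        using borel_measurable_entry[OF borel_measurable_simple_function[OF t]]
        by (simp add: measurable_cong_sets[OF sets_positive_part refl])
      show "AE x in positive_part M \<nu>. (\<lambda>n. t n x $ i $ k) \<longlonglongrightarrow> \<Phi> x $ i $ k"
        using lim by (auto intro!: AE_I2 tendsto_vec_nth)
    qed (use bd in auto)
    show ?thesis
      unfolding signed_integral_def
      by (intro tendsto_diff * vector_measure_uminus vector_measure_entry v)
  qed
  show ?thesis
  proof (rule LIMSEQ_le_const2)
    show "(\<lambda>n. ennreal (\<Sum>i\<in>UNIV. \<Sum>k\<in>UNIV. signed_integral M (\<lambda>A. \<mu> A $ i $ k) (\<lambda>x. t n x $ i $ k))) \<longlonglongrightarrow>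
      ennreal (\<Sum>i\<in>UNIV. \<Sum>k\<in>UNIV. signed_integral M (\<lambda>A. \<mu> A $ i $ k) (\<lambda>x. \<Phi> x $ i $ k))"
      by (intro tendsto_ennrealI tendsto_sum conv)
  qed (use signed_integral_simple_le_variation[OF v t nt] in blast)
qed

subsection \<open>Lebesgue decomposition\<close>

lemma borel_lebesgue_split:
  fixes p :: "'a::euclidean_space measure"
  assumes fin: "finite_measure p" and sets: "sets p = sets borel"
  obtains N f where "N \<in> null_sets lborel" "f \<in> borel_measurable borel" "integrable lborel f"
    "\<And>A. A \<in> sets borel \<Longrightarrow> measure p (A - N) = (LINT x:A|lborel. f x)"
proof -
  interpret finite_measure p by fact
  \<comment> \<open>A null set of maximal \<open>p\<close>-measure carries the singular part.\<close>
  let ?S = "measure p ` null_sets lborel"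
  have bdd: "bdd_above ?S" using bounded_measure by (auto intro!: bdd_aboveI)
  have ne: "?S \<noteq> {}" by blast
  have "\<exists>N\<in>null_sets lborel. Sup ?S - 1 / real (Suc n) < measure p N" for n
    using less_cSup_iff[OF ne bdd, of "Sup ?S - 1 / real (Suc n)"] by auto
  then obtain N where N: "\<And>n. N n \<in> null_sets lborel" "\<And>n. Sup ?S - 1 / real (Suc n) < measure p (N n)"
    by metis
  define Z where "Z = (\<Union>n. N n)"
  have Z: "Z \<in> null_sets lborel" unfolding Z_def using N(1) by (rule null_sets_UN)
  have Zb: "Z \<in> sets p" using Z by (auto simp: sets null_sets_def)
  have sup: "Sup ?S \<le> measure p Z"
  proof (rule field_le_epsilon)
    fix e :: real assume "e > 0"
    then obtain n where "1 / real (Suc n) < e" using nat_approx_posE by blast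
    moreover have "measure p (N n) \<le> measure p Z"
      using Zb by (intro finite_measure_mono) (auto simp: Z_def)
    ultimately show "Sup ?S \<le> measure p Z + e" using N(2)[of n] by linarith
  qed
  \<comment> \<open>A null set with mass outside Z could be joined to Z and would exceed the
    supremum. Hence the rest of p is absolutely continuous and has a Radon-Nikodym density.\<close>
  have null: "measure p (A - Z) = 0" if "A \<in> null_sets lborel" for A
  proof -
    have A: "A \<in> sets p" using that by (auto simp: sets null_sets_def)
    have "measure p (Z \<union> (A - Z)) = measure p Z + measure p (A - Z)"
      using A Zb by (intro finite_measure_Union) auto
    moreover have "measure p (Z \<union> (A - Z)) \<le> Sup ?S"
      using that Z by (intro cSup_upper[OF _ bdd]) (auto intro!: imageI)
    ultimately show ?thesis using sup measure_nonneg[of p "A - Z"] by linarith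
  qed
  define q where "q = density p (indicator (- Z))"
  have Zc: "- Z \<in> sets p" using Zb by (metis sets sets.compl_sets Compl_eq_Diff_UNIV space_borel sets_eq_imp_space_eq)
  have q: "emeasure q A = emeasure p (A - Z)" if "A \<in> sets borel" for A
  proof -
    have "emeasure q A = (\<integral>\<^sup>+x. indicator (-Z) x * indicator A x \<partial>p)"
      unfolding q_def using Zc that by (intro emeasure_density borel_measurable_indicator) (auto simp: sets)
    also have "\<dots> = (\<integral>\<^sup>+x. indicator (A - Z) x \<partial>p)"
      by (intro nn_integral_cong) (auto simp: indicator_def)
    finally show ?thesis using that Zb by (simp add: sets)
  qed
  have sq: "sets q = sets lborel" by (simp add: q_def sets)
  have fq: "finite_measure q"
    by (rule finite_measureI) (use q[of UNIV] in \<open>simp add: sets_eq_imp_space_eq[OF sq] emeasure_eq_measure\<close>)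
  have ac: "absolutely_continuous lborel q"
    unfolding absolutely_continuous_def
  proof
    fix A :: "'a set" assume A: "A \<in> null_sets lborel"
    then have "A \<in> sets borel" by auto
    then show "A \<in> null_sets q"
      using q[of A] null[OF A] sq by (auto simp: null_sets_def emeasure_eq_measure)
  qed
  obtain D where D: "D \<in> borel_measurable lborel" "AE x in lborel. RN_deriv lborel q x = ennreal (D x)" "\<And>x. 0 \<le> D x"
    using sigma_finite_measure.real_RN_deriv[OF lborel.sigma_finite_measure_axioms fq ac sq] by metis
  have dens: "q = density lborel D"
    using sigma_finite_measure.density_RN_deriv[OF lborel.sigma_finite_measure_axioms ac sq] density_cong[OF _ _ D(2)] D(1) by (metis borel_measurable_RN_deriv measurable_compose measurable_ennreal)
  have em: "emeasure q A = (\<integral>\<^sup>+x. ennreal (indicator A x * D x) \<partial>lborel)" if "A \<in> sets borel" for A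
  proof -
    have "emeasure q A = (\<integral>\<^sup>+x. ennreal (D x) * indicator A x \<partial>lborel)"
      unfolding dens using D(1) that by (intro emeasure_density) auto
    also have "\<dots> = (\<integral>\<^sup>+x. ennreal (indicator A x * D x) \<partial>lborel)"
      by (intro nn_integral_cong) (auto simp: indicator_def)
    finally show ?thesis .
  qed
  have int: "integrable lborel D"
    using em[of UNIV] D finite_measure.emeasure_finite[OF fq, of UNIV]
    by (intro integrableI_nonneg) (auto simp: top.not_eq_extremum)
  show ?thesis
  proof (rule that[OF Z _ int])
    show "D \<in> borel_measurable borel" using D(1) by simp
    show "measure p (A - Z) = (LINT x:A|lborel. D x)" if A: "A \<in> sets borel" for A
    proof -
      have "ennreal (measure p (A - Z)) = (\<integral>\<^sup>+x. ennreal (indicator A x * D x) \<partial>lborel)"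
        using em[OF A] q[OF A] by (simp add: emeasure_eq_measure)
      also have "\<dots> = ennreal (LINT x:A|lborel. D x)"
        unfolding set_lebesgue_integral_def real_scaleR_def
        using D(3) A integrable_mult_indicator[OF _ int, of A] by (intro nn_integral_eq_integral) auto
      finally show ?thesis
        using D(3) by (subst (asm) ennreal_inj) (auto simp: set_lebesgue_integral_def intro!: Bochner_Integration.integral_nonneg)
    qed
  qed
qed

text \<open>The positive and negative parts have different exceptional sets, and both are removed.
  Each part is absolutely continuous off its own set, so removing the other one does not change
  it.\<close>

lemma signed_lebesgue_split:
  fixes \<mu> :: "'a::euclidean_space set \<Rightarrow> real"
  assumes v: "vector_measure (borel_on \<Omega>) \<mu>" and \<Omega>: "\<Omega> \<in> sets borel"
  obtains N f where "N \<in> null_sets lborel" "f \<in> borel_measurable borel" "integrable lborel f"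
    "\<And>A. A \<in> sets borel \<Longrightarrow> A \<subseteq> \<Omega> \<Longrightarrow> \<mu> (A - N) = (LINT x:A|lborel. f x)"
proof -
  let ?P = "borel_positive_part \<Omega> \<mu>" and ?Q = "borel_positive_part \<Omega> (\<lambda>A. - \<mu> A)"
  obtain N1 f1 where 1: "N1 \<in> null_sets lborel" "f1 \<in> borel_measurable borel" "integrable lborel f1"
    "\<And>A. A \<in> sets borel \<Longrightarrow> measure ?P (A - N1) = (LINT x:A|lborel. f1 x)"
    using borel_lebesgue_split[OF finite_borel_positive_part[OF v] sets_borel_positive_part] by metis
  obtain N2 f2 where 2: "N2 \<in> null_sets lborel" "f2 \<in> borel_measurable borel" "integrable lborel f2"
    "\<And>A. A \<in> sets borel \<Longrightarrow> measure ?Q (A - N2) = (LINT x:A|lborel. f2 x)"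
    using borel_lebesgue_split[OF finite_borel_positive_part[OF vector_measure_uminus[OF v]] sets_borel_positive_part] by metis
  have diff: "(LINT x:A - N|lborel. f x) = (LINT x:A|lborel. f x)"
    if "N \<in> null_sets lborel" "f \<in> borel_measurable borel" "A \<in> sets borel" for N A and f :: "'a \<Rightarrow> real"
    unfolding set_lebesgue_integral_def
    by (rule integral_cong_AE) (use that AE_not_in[OF that(1)] in \<open>auto simp: indicator_def null_sets_def\<close>)
  have "\<mu> (A - (N1 \<union> N2)) = (LINT x:A|lborel. f1 x - f2 x)" if A: "A \<in> sets borel" "A \<subseteq> \<Omega>" for A
  proof -
    have N: "N1 \<in> sets borel" "N2 \<in> sets borel" using 1(1) 2(1) by auto
    have "A - (N1 \<union> N2) = (A - N2) - N1" by auto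
    then have P: "measure ?P (A - (N1 \<union> N2)) = (LINT x:A|lborel. f1 x)"
      using A N 1 2 by (simp add: diff)
    have "A - (N1 \<union> N2) = (A - N1) - N2" by auto
    then have Q: "measure ?Q (A - (N1 \<union> N2)) = (LINT x:A|lborel. f2 x)"
      using A N 1 2 by (simp add: diff)
    have "\<mu> (A - (N1 \<union> N2)) = (LINT x:A|lborel. f1 x) - (LINT x:A|lborel. f2 x)"
      unfolding P[symmetric] Q[symmetric] using A N by (intro borel_jordan_decomposition[OF v \<Omega>]) auto
    also have "\<dots> = (LINT x:A|lborel. f1 x - f2 x)"
      unfolding set_lebesgue_integral_def scaleR_diff_right
      by (rule Bochner_Integration.integral_diff[symmetric])
        (use integrable_mult_indicator[OF _ 1(3), of A] integrable_mult_indicator[OF _ 2(3), of A] A in auto)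
    finally show ?thesis .
  qed
  then show ?thesis
    using 1 2 by (intro that[of "N1 \<union> N2" "\<lambda>x. f1 x - f2 x"]) auto
qed

lemma matrix_eq_sum_axis: "A = (\<Sum>i\<in>UNIV. \<Sum>k\<in>UNIV. A $ i $ k *\<^sub>R axis i (axis k 1))" for A :: "real^'d^'m"
proof -
  have ax: "(axis i (axis k 1) :: real^'d^'m) $ j $ l = (if i = j then if k = l then 1 else 0 else 0)" for i k j l
    by (auto simp: axis_def)
  have "(\<Sum>i\<in>UNIV. \<Sum>k\<in>UNIV. A $ i $ k *\<^sub>R axis i (axis k 1)) $ j $ l = A $ j $ l" for j l
  proof -
    have "(\<Sum>i\<in>UNIV. \<Sum>k\<in>UNIV. A $ i $ k *\<^sub>R axis i (axis k (1::real)) :: real^'d^'m) $ j $ l =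
        (\<Sum>i\<in>UNIV. \<Sum>k\<in>UNIV. A $ i $ k * (axis i (axis k 1) :: real^'d^'m) $ j $ l)"
      by (simp only: sum_component vector_scaleR_component real_scaleR_def)
    also have "\<dots> = (\<Sum>i\<in>UNIV. \<Sum>k\<in>UNIV. if i = j then if k = l then A $ i $ k else 0 else 0)"
      unfolding ax by (intro sum.cong) auto
    also have "\<dots> = (\<Sum>i\<in>UNIV. if i = j then \<Sum>k\<in>UNIV. if k = l then A $ i $ k else 0 else 0)"
      by (intro sum.cong) auto
    finally show ?thesis by simp
  qed
  then show ?thesis by (simp only: vec_eq_iff simp_thms)
qed

lemma integrable_matrixI:
  fixes f :: "'a \<Rightarrow> real^'d^'m"
  assumes "\<And>i k. integrable M (\<lambda>x. f x $ i $ k)"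
  shows "integrable M f"
proof -
  have "integrable M (\<lambda>x. \<Sum>i\<in>UNIV. \<Sum>k\<in>UNIV. f x $ i $ k *\<^sub>R (axis i (axis k 1) :: real^'d^'m))"
    using assms by (intro Bochner_Integration.integrable_sum integrable_scaleR_left) auto
  moreover have "f = (\<lambda>x. \<Sum>i\<in>UNIV. \<Sum>k\<in>UNIV. f x $ i $ k *\<^sub>R axis i (axis k 1))"
    by (rule ext) (rule matrix_eq_sum_axis)
  ultimately show ?thesis by (rule ssubst[of f _ "integrable M", rotated])
qed

lemma set_integral_entry:
  fixes f :: "'a \<Rightarrow> real^'d^'m"
  assumes "set_integrable M A f"
  shows "(LINT x:A|M. f x) $ i $ k = (LINT x:A|M. f x $ i $ k)"
  using integral_bounded_linear[OF bounded_linear_entry assms[unfolded set_integrable_def], of i k]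
  by (simp add: set_lebesgue_integral_def)

text \<open>Nothing is known about the choice \<open>ac_density\<close> until a decomposition
  exists. Each matrix entry has its own null set; their union Z carries the singular part, which is
  \<mu> restricted to Z.\<close>

lemma lebesgue_decomposition_exists:
  fixes \<mu> :: "'a::euclidean_space set \<Rightarrow> real^'d^'m"
  assumes v: "vector_measure (borel_on \<Omega>) \<mu>" and \<Omega>: "\<Omega> \<in> sets borel"
  shows "\<exists>f \<nu>. lebesgue_decomposition \<Omega> \<mu> f \<nu>"
proof -
  have "\<exists>N f. N \<in> null_sets lborel \<and> f \<in> borel_measurable borel \<and> integrable lborel f \<and>
      (\<forall>A. A \<in> sets borel \<longrightarrow> A \<subseteq> \<Omega> \<longrightarrow> \<mu> (A - N) $ i $ k = (LINT x:A|lborel. f x))" for i k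
    by (rule signed_lebesgue_split[OF vector_measure_entry[OF v, of i k] \<Omega>]) blast
  then obtain N f where N: "\<And>i k. N i k \<in> null_sets lborel"
    and f: "\<And>i k. f i k \<in> borel_measurable borel" "\<And>i k. integrable lborel (f i k)"
    and eq: "\<And>i k A. A \<in> sets borel \<Longrightarrow> A \<subseteq> \<Omega> \<Longrightarrow> \<mu> (A - N i k) $ i $ k = (LINT x:A|lborel. f i k x)"
    by metis
  define Z where "Z = (\<Union>i. \<Union>k. N i k) \<inter> \<Omega>"
  have Z0: "Z \<in> null_sets lborel"
    unfolding Z_def using N \<Omega> by (intro null_set_Int2 null_sets_UN') auto
  have Z: "Z \<in> sets borel" "Z \<subseteq> \<Omega>" using Z0 by (auto simp: Z_def)
  define F where "F x = (\<chi> i k. f i k x)" for x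
  have F: "integrable lborel F"
    by (rule integrable_matrixI) (simp add: F_def f)
  have FA: "set_integrable lborel A F" if "A \<in> sets borel" for A
    unfolding set_integrable_def using F that by (intro integrable_mult_indicator) auto
  \<comment> \<open>The definitions integrate against \<open>lebesgue\<close>, the densities come
    from \<open>lborel\<close>; for the Borel function F the two integrals agree.\<close>
  have leb: "set_integrable lebesgue A F \<and> (LINT x:A|lebesgue. F x) = (LINT x:A|lborel. F x)" if "A \<in> sets borel" for A
  proof -
    have m: "(\<lambda>x. indicat_real A x *\<^sub>R F x) \<in> borel_measurable lborel"
      using FA[OF that] by (auto simp: set_integrable_def)
    show ?thesis
      using FA[OF that] integrable_completion[OF m] integral_completion[OF m]
      by (auto simp: set_integrable_def set_lebesgue_integral_def)
  qed
  define \<nu> where "\<nu> A = \<mu> (A \<inter> Z)" for A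
  have "vector_measure (borel_on \<Omega>) \<nu>"
    unfolding vector_measure_def
  proof (intro allI impI)
    fix A :: "nat \<Rightarrow> 'a set" assume A: "range A \<subseteq> sets (borel_on \<Omega>)" "disjoint_family A"
    have "A m \<inter> A n = {}" if "m \<noteq> n" for m n
      using A(2) that by (auto simp: disjoint_family_on_def)
    then have disj: "disjoint_family (\<lambda>n. A n \<inter> Z)" unfolding disjoint_family_on_def by blast
    have "(\<lambda>n. \<mu> (A n \<inter> Z)) sums \<mu> (\<Union>n. A n \<inter> Z)"
    proof (rule vector_measure_sums[OF v _ disj])
      have "A n \<in> sets borel" for n using A(1) by (auto simp: sets_borel_on[OF \<Omega>])
      then show "range (\<lambda>n. A n \<inter> Z) \<subseteq> sets (borel_on \<Omega>)"
        using Z by (auto simp: sets_borel_on[OF \<Omega>])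
    qed
    then show "(\<lambda>n. \<nu> (A n)) sums \<nu> (\<Union>n. A n)" by (simp add: \<nu>_def)
  qed
  moreover have "variation (borel_on \<Omega>) \<nu> (\<Omega> - Z) = 0"
  proof -
    have "(\<Sum>n. ennreal (norm (\<nu> (P n)))) \<le> 0" if "(\<Union>n. P n) = \<Omega> - Z" for P :: "nat \<Rightarrow> 'a set"
    proof -
      have "P n \<inter> Z = {}" for n using that by auto
      then show "(\<Sum>n. ennreal (norm (\<nu> (P n)))) \<le> 0" by (simp add: \<nu>_def vector_measure_empty[OF v])
    qed
    then have "variation (borel_on \<Omega>) \<nu> (\<Omega> - Z) \<le> 0"
      unfolding variation_def by (intro SUP_least) blast
    then show ?thesis by simp
  qed
  moreover have "\<mu> A = (LINT x:A|lebesgue. F x) + \<nu> A" if "A \<in> sets (borel_on \<Omega>)" for A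
  proof -
    have A: "A \<in> sets borel" "A \<subseteq> \<Omega>" using that by (auto simp: sets_borel_on[OF \<Omega>])
    have "\<mu> A = \<mu> (A - Z) + \<mu> (A \<inter> Z)"
      using vector_measure_Un[OF v, of "A - Z" "A \<inter> Z"] A Z by (auto simp: sets_borel_on[OF \<Omega>] Un_Diff_Int)
    moreover have "\<mu> (A - Z) = (LINT x:A|lborel. F x)"
    proof -
      have "\<mu> (A - Z) $ i $ k = (LINT x:A|lborel. F x) $ i $ k" for i k
      proof -
        have "A - Z = (A - Z) - N i k" using A by (auto simp: Z_def)
        then have "\<mu> (A - Z) $ i $ k = (LINT x:A - Z|lborel. f i k x)"
          using eq[of "A - Z" i k] A Z by auto
        also have "\<dots> = (LINT x:A|lborel. f i k x)"
          unfolding set_lebesgue_integral_def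
          by (rule integral_cong_AE) (use A Z f AE_not_in[OF Z0] in \<open>auto simp: indicator_def\<close>)
        finally show ?thesis using set_integral_entry[OF FA[OF A(1)]] by (simp add: F_def)
      qed
      then show ?thesis by (simp add: vec_eq_iff)
    qed
    ultimately show ?thesis using leb[OF A(1)] by (simp add: \<nu>_def)
  qed
  moreover have "Z \<in> null_sets lebesgue" using Z0 null_sets_completion_iff[of Z lborel] by blast
  ultimately show ?thesis
    unfolding lebesgue_decomposition_def using leb[OF \<Omega>] Z by (auto simp: sets_borel_on[OF \<Omega>])
qed

subsection \<open>Determination of measures by test functions\<close>

lemma measure_sums_vector_measure:
  assumes "finite_measure P" "sets P = sets M"
  shows "vector_measure M (measure P)"
  using finite_measure.finite_measure_UNION[OF assms(1)] assms(2) by (simp add: vector_measure_def)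

lemma vector_measure_diff:
  "vector_measure M \<mu> \<Longrightarrow> vector_measure M \<nu> \<Longrightarrow> vector_measure M (\<lambda>A. \<mu> A - \<nu> A)"
  unfolding vector_measure_def by (intro allI impI sums_diff) auto

text \<open>The Dynkin argument is run inside one box because there the value on the whole space is known.\<close>

lemma vector_measure_zero_in_box:
  fixes \<gamma> :: "'a::euclidean_space set \<Rightarrow> real"
  assumes v: "vector_measure borel \<gamma>" and S: "cbox a b \<subseteq> S"
    and zero: "\<And>c d. cbox c d \<subseteq> S \<Longrightarrow> \<gamma> (box c d) = 0"
    and A: "A \<in> sets borel" "A \<subseteq> box a b"
  shows "\<gamma> A = 0"
proof -
  let ?G = "(\<inter>) (box a b) ` range (\<lambda>(c, d). box c d)"
  have G_eq: "?G = {box a b \<inter> box c d | c d. True}" by auto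
  have G: "\<exists>c d. X = box c d" if X: "X \<in> ?G" for X
    using X unfolding G_eq box_Int_box by blast
  have ss: "sigma_sets (box a b) ?G = {X \<in> sets borel. X \<subseteq> box a b}"
  proof -
    have b: "sets borel = sigma_sets UNIV (range (\<lambda>(c, d). box c d :: 'a set))"
      unfolding borel_eq_box by (rule sets_measure_of) simp
    have "sigma_sets (box a b) ?G = (\<inter>) (box a b) ` sets borel"
      unfolding b by (rule sigma_sets_Int[symmetric]) (auto simp flip: b)
    also have "\<dots> = {X \<in> sets borel. X \<subseteq> box a b}" by (auto intro!: image_eqI)
    finally show ?thesis .
  qed
  have "Int_stable ?G"
  proof (rule Int_stableI)
    fix X Y assume "X \<in> ?G" "Y \<in> ?G"
    then obtain c d c' d' where "X = box a b \<inter> box c d" "Y = box a b \<inter> box c' d'"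
      unfolding G_eq by blast
    then have "X \<inter> Y = box a b \<inter> (box c d \<inter> box c' d')" by auto
    then show "X \<inter> Y \<in> ?G" unfolding G_eq box_Int_box[of c d] by blast
  qed
  moreover have "?G \<subseteq> Pow (box a b)" by auto
  moreover have "A \<in> sigma_sets (box a b) ?G" using ss A by auto
  ultimately show ?thesis
  proof (induction rule: sigma_sets_induct_disjoint)
    case (basic X)
    obtain c d where X: "X = box c d" using G basic by blast
    show ?case
    proof (cases "X = {}")
      case True then show ?thesis using vector_measure_empty[OF v] by simp
    next
      case False
      \<comment> \<open>The closure of a nonempty open box is the closed box with the same corners,
        so the hypothesis applies. An empty open box can have a nonempty degenerate closed box
        reaching outside S, hence the case split.\<close>
      have "closure X \<subseteq> cbox a b"
        using basic box_subset_cbox[of a b] by (intro closure_minimal closed_cbox) auto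
      then show ?thesis using False S by (auto simp: X closure_box intro!: zero)
    qed
  next
    case empty
    show ?case by (rule vector_measure_empty[OF v])
  next
    case (compl X)
    have "\<gamma> (box a b - X) = \<gamma> (box a b) - \<gamma> X"
      using compl(1) by (intro vector_measure_Diff[OF v]) (auto simp: ss)
    then show ?case using compl zero[OF S] by simp
  next
    case (union X)
    have "(\<lambda>n. \<gamma> (X n)) sums \<gamma> (\<Union>n. X n)"
      using union by (intro vector_measure_sums[OF v]) (auto simp: ss)
    then show ?case using union.IH sums_unique2[OF _ sums_zero] by simp
  qed
qed

text \<open>By Lindelof countably many open boxes with closure in S cover S. Their disjointed
  intersections with A lie in single boxes, where the local result applies, and countable additivity
  sums them up.\<close>

lemma vector_measure_zero_open:
  fixes \<gamma> :: "'a::euclidean_space set \<Rightarrow> real"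
  assumes v: "vector_measure borel \<gamma>" and S: "open S"
    and zero: "\<And>c d. cbox c d \<subseteq> S \<Longrightarrow> \<gamma> (box c d) = 0"
    and A: "A \<in> sets borel" "A \<subseteq> S"
  shows "\<gamma> A = 0"
proof (cases "A = {}")
  case True then show ?thesis by (simp add: vector_measure_empty[OF v])
next
  case False
  define F where "F = {box a b | a b. cbox a b \<subseteq> S}"
  have opF: "open X" if "X \<in> F" for X using that by (auto simp: F_def open_box)
  obtain F' where F': "F' \<subseteq> F" "countable F'" "\<Union>F' = \<Union>F"
    by (rule Lindelof[OF opF])
  have cover: "A \<subseteq> \<Union>F'"
  proof
    fix x assume "x \<in> A"
    with A have xS: "x \<in> S" by auto
    obtain a b where "cbox a b \<subseteq> S" "x \<in> box a b"
      by (rule open_contains_cbox[OF S xS])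
    then show "x \<in> \<Union>F'" unfolding F'(3) F_def by blast
  qed
  with False have ne: "F' \<noteq> {}" by auto
  define D where "D n = A \<inter> from_nat_into F' n" for n
  have box: "\<exists>a b. from_nat_into F' n = box a b \<and> cbox a b \<subseteq> S" for n
    using from_nat_into[OF ne, of n] F'(1) by (auto simp: F_def)
  have Db: "D n \<in> sets borel" for n using box[of n] A(1) by (auto simp: D_def)
  have "(\<Union>n. from_nat_into F' n) = \<Union>F'" using range_from_nat_into[OF ne F'(2)] by simp
  then have "(\<Union>n. D n) = A" using cover by (auto simp: D_def)
  moreover have dis: "disjointed D n \<in> sets borel" for n
    using Db sets.range_disjointed_sets[of D borel] by (auto simp: image_subset_iff)
  then have "(\<lambda>n. \<gamma> (disjointed D n)) sums \<gamma> (\<Union>n. disjointed D n)"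
    by (intro vector_measure_sums[OF v]) (auto simp: disjoint_family_disjointed)
  moreover have "\<gamma> (disjointed D n) = 0" for n
  proof -
    obtain a b where ab: "from_nat_into F' n = box a b" "cbox a b \<subseteq> S" using box by blast
    have "disjointed D n \<subseteq> box a b" using disjointed_subset[of D n] ab by (auto simp: D_def)
    then show ?thesis using vector_measure_zero_in_box[OF v ab(2) zero dis] by blast
  qed
  ultimately show ?thesis
    using sums_unique2[OF _ sums_zero] by (simp add: UN_disjointed_eq)
qed

lemma integral_box_cutoff_tendsto:
  assumes "finite_measure P" "sets P = sets borel"
  shows "(\<lambda>n. integral\<^sup>L P (box_cutoff n a b)) \<longlonglongrightarrow> measure P (box a b)"
proof -
  interpret finite_measure P by fact
  have "(\<lambda>n. integral\<^sup>L P (box_cutoff n a b)) \<longlonglongrightarrow> integral\<^sup>L P (indicator (box a b))"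
  proof (rule integral_dominated_convergence[where w = "\<lambda>_. 1"])
    show "integrable P (\<lambda>_. 1::real)" by simp
    show "box_cutoff n a b \<in> borel_measurable P" for n
      using borel_measurable_continuous_onI[of "box_cutoff n a b"] Ck_on_box_cutoff[of 0 n a b]
      by (simp add: measurable_cong_sets[OF assms(2) refl])
    show "indicat_real (box a b) \<in> borel_measurable P"
      by (intro borel_measurable_indicator) (simp add: assms(2))
  qed (auto intro!: AE_I2 box_cutoff_tendsto simp: box_cutoff_bounds)
  then show ?thesis by (simp add: assms(2))
qed

text \<open>Box cutoffs are admissible test functions, so in the limit the two sides agree on every
  open box with closure in S. Signed measures are written as differences of finite positive ones, so
  that all integrals are ordinary.\<close>

lemma signed_measures_agree:
  fixes P1 P2 Q1 Q2 :: "'a::euclidean_space measure"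
  assumes P1: "finite_measure P1" "sets P1 = sets borel" and Q1: "finite_measure Q1" "sets Q1 = sets borel"
    and P2: "finite_measure P2" "sets P2 = sets borel" and Q2: "finite_measure Q2" "sets Q2 = sets borel"
    and S: "open S"
    and test: "\<And>\<phi> :: 'a \<Rightarrow> real. smooth_compact_support S \<phi> \<Longrightarrow> (\<And>x. x \<notin> S \<Longrightarrow> \<phi> x = 0) \<Longrightarrow>
      integral\<^sup>L P1 \<phi> - integral\<^sup>L Q1 \<phi> = integral\<^sup>L P2 \<phi> - integral\<^sup>L Q2 \<phi>"
    and A: "A \<in> sets borel" "A \<subseteq> S"
  shows "measure P1 A - measure Q1 A = measure P2 A - measure Q2 A"
proof -
  define \<gamma> where "\<gamma> A = (measure P1 A - measure Q1 A) - (measure P2 A - measure Q2 A)" for A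
  have v: "vector_measure borel \<gamma>"
    unfolding \<gamma>_def by (intro vector_measure_diff measure_sums_vector_measure assms)
  have "\<gamma> A = 0"
  proof (rule vector_measure_zero_open[OF v S _ A])
    fix c d :: 'a assume cd: "cbox c d \<subseteq> S"
    let ?I = "\<lambda>P n. integral\<^sup>L P (box_cutoff n c d)"
    have "(\<lambda>n. (?I P1 n - ?I Q1 n) - (?I P2 n - ?I Q2 n)) \<longlonglongrightarrow> \<gamma> (box c d)"
      unfolding \<gamma>_def by (intro tendsto_diff integral_box_cutoff_tendsto assms)
    moreover have "?I P1 n - ?I Q1 n = ?I P2 n - ?I Q2 n" for n
    proof (rule test[OF smooth_compact_support_box_cutoff[OF S cd]])
      show "box_cutoff n c d x = 0" if "x \<notin> S" for x
        using that cd box_subset_cbox[of c d] by (intro box_cutoff_outside) auto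
    qed
    ultimately show "\<gamma> (box c d) = 0" by (simp add: LIMSEQ_const_iff)
  qed
  then show ?thesis by (simp add: \<gamma>_def)
qed

section \<open>Signed densities and test functions on the whole space\<close>

lemma finite_measure_density_pos:
  fixes g :: "'a::euclidean_space \<Rightarrow> real"
  assumes "integrable lborel g"
  shows "finite_measure (density lborel (\<lambda>x. ennreal (max 0 (g x))))"
proof (rule finite_measureI)
  have "integrable lborel (\<lambda>x. max 0 (g x))" using assms by auto
  then have "(\<integral>\<^sup>+x. ennreal (max 0 (g x)) \<partial>lborel) \<noteq> \<infinity>"
    by (simp add: integrable_iff_bounded top.not_eq_extremum)
  then show "emeasure (density lborel (\<lambda>x. ennreal (max 0 (g x)))) (space (density lborel (\<lambda>x. ennreal (max 0 (g x))))) \<noteq> \<infinity>"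
    using assms by (simp add: emeasure_density)
qed

text \<open>The signed measure with density g enters as the difference of its two parts, the form in
  which measures are compared above.\<close>

lemma integral_density_signed:
  fixes g \<phi> :: "'a::euclidean_space \<Rightarrow> real"
  assumes g: "integrable lborel g" and \<phi>: "\<phi> \<in> borel_measurable borel" "\<And>x. \<bar>\<phi> x\<bar> \<le> C"
  shows "integral\<^sup>L (density lborel (\<lambda>x. ennreal (max 0 (g x)))) \<phi> -
    integral\<^sup>L (density lborel (\<lambda>x. ennreal (max 0 (- g x)))) \<phi> = (LINT x|lborel. g x * \<phi> x)"
proof -
  have [measurable]: "g \<in> borel_measurable borel" using g by auto
  have int: "integrable lborel (\<lambda>x. max 0 (f x) * \<phi> x)" if f: "integrable lborel f" for f
  proof (rule Bochner_Integration.integrable_bound)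
    show "integrable lborel (\<lambda>x. C * f x)" using f by auto
    show "(\<lambda>x. max 0 (f x) * \<phi> x) \<in> borel_measurable lborel" using f \<phi>(1) by auto
    have C: "C \<ge> 0" using \<phi>(2)[of 0] by linarith
    have "\<bar>max 0 (f x)\<bar> * \<bar>\<phi> x\<bar> \<le> \<bar>f x\<bar> * C" for x
      by (intro mult_mono \<phi>) auto
    then show "AE x in lborel. norm (max 0 (f x) * \<phi> x) \<le> norm (C * f x)"
      using C by (intro AE_I2) (simp add: abs_mult mult.commute)
  qed
  have "(LINT x|lborel. max 0 (g x) * \<phi> x) - (LINT x|lborel. max 0 (- g x) * \<phi> x) =
      (LINT x|lborel. max 0 (g x) * \<phi> x - max 0 (- g x) * \<phi> x)"
    using int[OF g] int[of "\<lambda>x. - g x"] g by (intro Bochner_Integration.integral_diff[symmetric]) auto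
  also have "\<dots> = (LINT x|lborel. g x * \<phi> x)"
    by (intro Bochner_Integration.integral_cong) (auto simp: max_def algebra_simps)
  finally show ?thesis
    using \<phi>(1) by (subst (1 2) integral_density) auto
qed

lemma measure_density_signed:
  fixes g :: "'a::euclidean_space \<Rightarrow> real"
  assumes g: "integrable lborel g" and A: "A \<in> sets borel"
  shows "measure (density lborel (\<lambda>x. ennreal (max 0 (g x)))) A -
    measure (density lborel (\<lambda>x. ennreal (max 0 (- g x)))) A = (LINT x:A|lborel. g x)"
  using integral_density_signed[OF g, of "indicator A" 1] A
  by (simp add: set_lebesgue_integral_def mult.commute)

text \<open>All facts about a test function that is 0 off S are bundled so that one compact set K
  and one bound C serve at once. The bounds come from continuity on K and vanishing off K.\<close>

lemma smooth_zero_outside: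
  fixes \<phi> :: "'a::euclidean_space \<Rightarrow> real"
  assumes S: "open S" and \<phi>: "smooth_compact_support S \<phi>" "\<And>x. x \<notin> S \<Longrightarrow> \<phi> x = 0"
  shows "\<exists>K C. compact K \<and> K \<subseteq> S \<and> (\<forall>x. x \<notin> K \<longrightarrow> \<phi> x = 0) \<and> (\<forall>k. Ck_on k UNIV \<phi>) \<and>
    continuous_on UNIV (\<lambda>x. frechet_derivative \<phi> (at x) e) \<and>
    (\<forall>x. (\<phi> has_derivative frechet_derivative \<phi> (at x)) (at x)) \<and>
    (\<forall>x. \<bar>frechet_derivative \<phi> (at x) e\<bar> \<le> C) \<and> (\<forall>x. \<bar>\<phi> x\<bar> \<le> C)"
proof -
  obtain K where K: "compact K" "K \<subseteq> S" "\<And>x. x \<in> S - K \<Longrightarrow> \<phi> x = 0"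
    using smooth_compact_supportE[OF S \<phi>(1)] by metis
  have z: "\<phi> x = 0" if "x \<notin> K" for x using K(3) \<phi>(2) that by blast
  have "(\<lambda>x. if x \<in> S then \<phi> x else 0) = \<phi>" using \<phi>(2) by auto
  then have C: "Ck_on k UNIV \<phi>" for k using smooth_compact_support_extend[OF S \<phi>(1), of k] by simp
  have d: "\<phi> differentiable_on UNIV" and c: "continuous_on UNIV (\<lambda>x. frechet_derivative \<phi> (at x) e)"
    using C[of 1] by auto
  have c0: "continuous_on UNIV \<phi>" using C[of 0] by simp
  have o: "open (- K)" using K(1) compact_imp_closed by auto
  have dz: "frechet_derivative \<phi> (at x) e = 0" if "x \<notin> K" for x
    using frechet_derivative_cong_open[OF o, of x \<phi> "\<lambda>_. 0"] that z by (simp add: frechet_derivative_const)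
  obtain C1 where C1: "\<And>x. x \<in> K \<Longrightarrow> \<bar>frechet_derivative \<phi> (at x) e\<bar> \<le> C1"
    using compact_imp_bounded[OF compact_continuous_image[OF continuous_on_subset[OF c] K(1)]]
    by (auto simp: bounded_iff)
  obtain C2 where C2: "\<And>x. x \<in> K \<Longrightarrow> \<bar>\<phi> x\<bar> \<le> C2"
    using compact_imp_bounded[OF compact_continuous_image[OF continuous_on_subset[OF c0] K(1)]]
    by (auto simp: bounded_iff)
  show ?thesis
  proof (intro exI[of _ K] exI[of _ "max 0 (max C1 C2)"] conjI allI impI)
    show "\<bar>frechet_derivative \<phi> (at x) e\<bar> \<le> max 0 (max C1 C2)" for x
      using C1[of x] dz[of x] by (cases "x \<in> K") auto
    show "\<bar>\<phi> x\<bar> \<le> max 0 (max C1 C2)" for x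
      using C2[of x] z[of x] by (cases "x \<in> K") auto
    show "(\<phi> has_derivative frechet_derivative \<phi> (at x)) (at x)" for x
      by (rule has_derivative_frechet[OF d]) auto
  qed (fact K z C c)+
qed

lemma frechet_derivative_translate:
  assumes "(\<phi> has_derivative D) (at (x + c))"
  shows "frechet_derivative (\<lambda>y. \<phi> (y + c)) (at x) = D"
proof (rule frechet_derivative_eqI)
  have "((\<lambda>x. x + c) has_derivative (\<lambda>x. x)) (at x)" by (auto intro!: derivative_eq_intros)
  from diff_chain_at[OF this, of \<phi> D] assms show "((\<lambda>y. \<phi> (y + c)) has_derivative D) (at x)"
    by (simp add: o_def)
qed

subsection \<open>Translates of functions of bounded variation\<close>

text \<open>Lebesgue measure on [0, h] is kept on the whole line as a finite measure, so that its
  product with a finite measure is finite and Fubini applies without side conditions on s.\<close>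

definition lborel_Icc :: "real \<Rightarrow> real measure" where
  "lborel_Icc h = density lborel (\<lambda>s. ennreal (indicator {0..h} s))"

lemma sets_lborel_Icc [simp, measurable_cong]: "sets (lborel_Icc h) = sets borel"
  and space_lborel_Icc [simp]: "space (lborel_Icc h) = UNIV"
  by (simp_all add: lborel_Icc_def)

lemma finite_lborel_Icc: "finite_measure (lborel_Icc h)"
proof (rule finite_measureI)
  have "emeasure (lborel_Icc h) UNIV = (\<integral>\<^sup>+s. indicator {0..h} s \<partial>lborel)"
    unfolding lborel_Icc_def
    by (subst emeasure_density) (simp_all add: ennreal_indicator)
  also have "\<dots> < \<infinity>" by (cases "0 \<le> h") auto
  finally show "emeasure (lborel_Icc h) (space (lborel_Icc h)) \<noteq> \<infinity>" by simp
qed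

lemma integral_lborel_Icc:
  fixes f :: "real \<Rightarrow> real"
  assumes "f \<in> borel_measurable borel"
  shows "integral\<^sup>L (lborel_Icc h) f = (LINT s:{0..h}|lborel. f s)"
  unfolding lborel_Icc_def set_lebesgue_integral_def
  by (rule integral_density) (use assms in auto)

lemma integral_lborel_Icc_cong:
  assumes "f \<in> borel_measurable borel" "g \<in> borel_measurable borel" "\<And>s. 0 \<le> s \<Longrightarrow> s \<le> h \<Longrightarrow> f s = g s"
  shows "integral\<^sup>L (lborel_Icc h) f = integral\<^sup>L (lborel_Icc h) (g :: real \<Rightarrow> real)"
  unfolding integral_lborel_Icc[OF assms(1)] integral_lborel_Icc[OF assms(2)] set_lebesgue_integral_def
  by (intro Bochner_Integration.integral_cong) (auto simp: indicator_def assms(3))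

text \<open>\<open>smear h e P\<close> maps \<open>A\<close> to \<open>\<integral>\<^sub>0\<^sup>h P (A + s e) ds\<close>.\<close>

definition smear :: "real \<Rightarrow> 'a::euclidean_space \<Rightarrow> 'a measure \<Rightarrow> 'a measure" where
  "smear h e P = distr (lborel_Icc h \<Otimes>\<^sub>M P) borel (\<lambda>(s, y). y - s *\<^sub>R e)"

lemma sets_smear [simp]: "sets (smear h e P) = sets borel"
  by (simp add: smear_def)

context
  fixes P :: "'a::euclidean_space measure" and h :: real and e :: 'a
  assumes P: "finite_measure P" "sets P = sets borel"
begin

lemma measurable_shift: "(\<lambda>(s, y). y - s *\<^sub>R e) \<in> measurable (lborel_Icc h \<Otimes>\<^sub>M P) borel"
proof -
  have [measurable_cong]: "sets P = sets borel" by (rule P)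
  show ?thesis by measurable
qed

lemma finite_smear: "finite_measure (smear h e P)"
proof -
  interpret P: finite_measure P by (rule P)
  interpret R: finite_measure "lborel_Icc h" by (rule finite_lborel_Icc)
  interpret PR: pair_sigma_finite "lborel_Icc h" P ..
  have "finite_measure (lborel_Icc h \<Otimes>\<^sub>M P)"
    by (rule finite_measure_pair_measure) (fact finite_lborel_Icc P)+
  then show ?thesis
    unfolding smear_def by (rule finite_measure.finite_measure_distr[OF _ measurable_shift])
qed

lemma integral_smear:
  fixes \<phi> :: "'a \<Rightarrow> real"
  assumes \<phi>: "\<phi> \<in> borel_measurable borel" "\<And>x. \<bar>\<phi> x\<bar> \<le> C"
  shows "integral\<^sup>L (smear h e P) \<phi> = (LINT s|lborel_Icc h. LINT y|P. \<phi> (y - s *\<^sub>R e))"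
    and "integrable (lborel_Icc h) (\<lambda>s. LINT y|P. \<phi> (y - s *\<^sub>R e))"
proof -
  interpret P: finite_measure P by (rule P)
  interpret R: finite_measure "lborel_Icc h" by (rule finite_lborel_Icc)
  interpret PR: pair_sigma_finite "lborel_Icc h" P ..
  interpret RP: finite_measure "lborel_Icc h \<Otimes>\<^sub>M P"
    by (rule finite_measure_pair_measure) (fact finite_lborel_Icc P)+
  have m: "(\<lambda>(s, y). \<phi> (y - s *\<^sub>R e)) \<in> borel_measurable (lborel_Icc h \<Otimes>\<^sub>M P)"
    using measurable_compose[OF measurable_shift \<phi>(1)] by (simp add: case_prod_beta')
  have int: "integrable (lborel_Icc h \<Otimes>\<^sub>M P) (\<lambda>(s, y). \<phi> (y - s *\<^sub>R e))"
    by (rule RP.integrable_const_bound[of _ C]) (use \<phi>(2) m in auto)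
  show "integral\<^sup>L (smear h e P) \<phi> = (LINT s|lborel_Icc h. LINT y|P. \<phi> (y - s *\<^sub>R e))"
    unfolding smear_def integral_distr[OF measurable_shift \<phi>(1)] using PR.integral_fst[OF int]
    by (simp add: case_prod_beta')
  show "integrable (lborel_Icc h) (\<lambda>s. LINT y|P. \<phi> (y - s *\<^sub>R e))"
    by (rule PR.integrable_fst[OF int])
qed

text \<open>The set under the integral is the translate A + s e.\<close>

lemma measure_smear:
  assumes A: "A \<in> sets borel"
  shows "measure (smear h e P) A = (LINT s|lborel_Icc h. measure P {y. y - s *\<^sub>R e \<in> A})"
    and "integrable (lborel_Icc h) (\<lambda>s. measure P {y. y - s *\<^sub>R e \<in> A})"
proof -
  have B: "{y. y - s *\<^sub>R e \<in> A} \<in> sets P" for s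
  proof -
    have "(\<lambda>y. y - s *\<^sub>R e) -` A \<inter> space borel \<in> sets borel"
      by (rule measurable_sets[OF _ A]) simp
    then show ?thesis by (simp add: P vimage_def)
  qed
  have sp: "space P = UNIV" using sets_eq_imp_space_eq[OF P(2)] by simp
  have *: "(LINT y|P. indicat_real A (y - s *\<^sub>R e)) = measure P {y. y - s *\<^sub>R e \<in> A}" for s
  proof -
    have "(LINT y|P. indicat_real A (y - s *\<^sub>R e)) = (LINT y|P. indicator {y. y - s *\<^sub>R e \<in> A} y)"
      by (intro Bochner_Integration.integral_cong) (auto simp: indicator_def)
    then show ?thesis by (simp add: sp)
  qed
  have i: "indicat_real A \<in> borel_measurable borel" using A by simp
  have b: "\<bar>indicat_real A x\<bar> \<le> 1" for x by (simp add: indicator_def)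
  have "integral\<^sup>L (smear h e P) (indicator A) = measure (smear h e P) A"
    using A sets_eq_imp_space_eq[OF sets_smear, of h e P] by simp
  then show "measure (smear h e P) A = (LINT s|lborel_Icc h. measure P {y. y - s *\<^sub>R e \<in> A})"
    using integral_smear(1)[OF i b] by (simp add: *)
  show "integrable (lborel_Icc h) (\<lambda>s. measure P {y. y - s *\<^sub>R e \<in> A})"
    using integral_smear(2)[OF i b] by (simp add: *)
qed

end

lemma integral_directional_derivative:
  assumes "h \<ge> 0" "\<And>x. (\<phi> has_derivative frechet_derivative \<phi> (at x)) (at x)"
    and c: "continuous_on UNIV (\<lambda>x. frechet_derivative \<phi> (at x) e)"
  shows "(LINT s:{0..h}|lborel. frechet_derivative \<phi> (at (y - s *\<^sub>R e)) e) = \<phi> y - (\<phi> (y - h *\<^sub>R e) :: real)"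
proof -
  have "(LINT s:{0..h}|lborel. frechet_derivative \<phi> (at (y - s *\<^sub>R e)) e) =
      - \<phi> (y - h *\<^sub>R e) - (- \<phi> (y - 0 *\<^sub>R e))"
    unfolding set_lebesgue_integral_def
  proof (rule integral_FTC_Icc[OF assms(1)])
    show "((\<lambda>s. - \<phi> (y - s *\<^sub>R e)) has_vector_derivative frechet_derivative \<phi> (at (y - s *\<^sub>R e)) e) (at s within {0..h})" for s
    proof -
      have "((\<lambda>s. y - s *\<^sub>R e) has_vector_derivative (- e)) (at s within {0..h})"
        by (auto intro!: derivative_eq_intros simp: has_vector_derivative_def)
      from vector_derivative_diff_chain_within[OF this has_derivative_at_withinI[OF assms(2)]]
      have "(\<phi> \<circ> (\<lambda>s. y - s *\<^sub>R e) has_vector_derivative frechet_derivative \<phi> (at (y - s *\<^sub>R e)) (- e)) (at s within {0..h})" .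
      moreover have "frechet_derivative \<phi> (at (y - s *\<^sub>R e)) (- e) = - frechet_derivative \<phi> (at (y - s *\<^sub>R e)) e"
        using has_derivative_linear[OF assms(2)] linear_neg by blast
      ultimately show ?thesis
        using has_vector_derivative_minus[of "\<phi> \<circ> (\<lambda>s. y - s *\<^sub>R e)"] by (fastforce simp: o_def)
    qed
    show "continuous_on {0..h} (\<lambda>s. frechet_derivative \<phi> (at (y - s *\<^sub>R e)) e)"
      by (rule continuous_on_compose2[OF c]) (auto intro!: continuous_intros)
  qed
  then show ?thesis by simp
qed

lemma integral_shift:
  fixes f :: "'a::euclidean_space \<Rightarrow> real"
  assumes "f \<in> borel_measurable borel"
  shows "(LINT x|lborel. f (x + c)) = (LINT x|lborel. f x)"
    and "integrable lborel (\<lambda>x. f (x + c)) \<longleftrightarrow> integrable lborel f"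
  using integral_distr[of "(+) c" lborel borel f] integrable_distr_eq[of "(+) c" lborel borel f] assms
  by (simp_all add: lborel_distr_plus add.commute)

lemma smooth_translate:
  fixes \<phi> :: "'a::euclidean_space \<Rightarrow> real"
  assumes \<Omega>: "open \<Omega>" and C: "\<And>k. Ck_on k UNIV \<phi>" and K: "compact K" "\<And>x. x \<notin> K \<Longrightarrow> \<phi> x = 0"
    and sub: "\<And>x. x \<in> K \<Longrightarrow> x + c \<in> \<Omega>"
  shows "smooth_compact_support \<Omega> (\<lambda>y. \<phi> (y - c))"
proof (rule smooth_compact_supportI[of _ _ "(\<lambda>x. x + c) ` K"])
  have "Ck_on k UNIV (\<lambda>y. \<phi> (y - c))" for k
    using Ck_on_translate[OF open_UNIV C, of k "- c"] by simp
  then show "Ck_on k \<Omega> (\<lambda>y. \<phi> (y - c))" for k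
    using Ck_on_subset[OF open_UNIV \<Omega>] by blast
  show "compact ((\<lambda>x. x + c) ` K)"
    by (intro compact_continuous_image K continuous_intros)
  show "\<phi> (x - c) = 0" if "x \<in> \<Omega> - (\<lambda>x. x + c) ` K" for x
  proof (rule K(2))
    show "x - c \<notin> K"
    proof
      assume "x - c \<in> K"
      then have "(x - c) + c \<in> (\<lambda>x. x + c) ` K" by (rule imageI)
      with that show False by simp
    qed
  qed
qed (use \<Omega> sub in auto)

text \<open>Test with \<phi>(y - s e) and integrate over s from 0 to h. On the side of \<mu> this
  gives \<phi> integrated against the smeared measure. On the side of w0 the fundamental theorem
  turns the derivative into \<phi>(y) - \<phi>(y - h e), and a change of variables moves the shift
  onto w0. Agreement on test functions then yields agreement on A.\<close>

lemma translation_identity: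
  fixes w0 :: "'a::euclidean_space \<Rightarrow> real"
  assumes \<Omega>: "open \<Omega>" "convex \<Omega>" and w0: "integrable lborel w0"
    and v: "vector_measure (borel_on \<Omega>) \<mu>" and h: "h \<ge> 0"
    and deriv: "\<And>\<phi>. smooth_compact_support \<Omega> \<phi> \<Longrightarrow>
      (LINT x|lborel. w0 x * frechet_derivative \<phi> (at x) e) = - signed_integral (borel_on \<Omega>) \<mu> \<phi>"
    and A: "A \<in> sets borel" "\<And>x. x \<in> A \<Longrightarrow> x \<in> \<Omega>" "\<And>x. x \<in> A \<Longrightarrow> x + h *\<^sub>R e \<in> \<Omega>"
  shows "(LINT x:A|lborel. w0 (x + h *\<^sub>R e) - w0 x) =
     (LINT s|lborel_Icc h. measure (borel_positive_part \<Omega> \<mu>) {y. y - s *\<^sub>R e \<in> A} -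
        measure (borel_positive_part \<Omega> (\<lambda>A. - \<mu> A)) {y. y - s *\<^sub>R e \<in> A})"
proof -
  define P where "P = borel_positive_part \<Omega> \<mu>"
  define Q where "Q = borel_positive_part \<Omega> (\<lambda>A. - \<mu> A)"
  have P: "finite_measure P" "sets P = sets borel" and Q: "finite_measure Q" "sets Q = sets borel"
    using finite_borel_positive_part[OF v] finite_borel_positive_part[OF vector_measure_uminus[OF v]]
    by (auto simp: P_def Q_def)
  define g where "g x = w0 (x + h *\<^sub>R e) - w0 x" for x
  have w0h: "integrable lborel (\<lambda>x. w0 (x + h *\<^sub>R e))" using w0 by (simp add: integral_shift)
  have g: "integrable lborel g" unfolding g_def by (intro Bochner_Integration.integrable_diff w0h w0)
  have [measurable]: "w0 \<in> borel_measurable borel" using w0 by auto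
  \<comment> \<open>The points whose end point under the shift stays in \<Omega>. By convexity the
    whole segment does, so every translate of a test function on S is one on \<Omega>.\<close>
  define S where "S = \<Omega> \<inter> {x. x + h *\<^sub>R e \<in> \<Omega>}"
  have S: "open S"
  proof -
    have "open ((\<lambda>x. x + h *\<^sub>R e) -` \<Omega>)" by (intro open_vimage \<Omega> continuous_intros)
    then show ?thesis using \<Omega>(1) by (auto simp: S_def vimage_def)
  qed
  have S_seg: "x + s *\<^sub>R e \<in> \<Omega>" if "x \<in> S" "0 \<le> s" "s \<le> h" for x s
  proof (cases "h = 0")
    case True then show ?thesis using that by (auto simp: S_def)
  next
    case False
    have "(1 - s / h) *\<^sub>R x + (s / h) *\<^sub>R (x + h *\<^sub>R e) \<in> \<Omega>"
      using that h False by (intro convexD[OF \<Omega>(2)]) (auto simp: S_def)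
    moreover have "(1 - s / h) *\<^sub>R x + (s / h) *\<^sub>R (x + h *\<^sub>R e) = x + s *\<^sub>R e"
      using False by (simp add: algebra_simps)
    ultimately show ?thesis by simp
  qed
  interpret R: finite_measure "lborel_Icc h" by (rule finite_lborel_Icc)
  interpret RL: pair_sigma_finite "lborel_Icc h" lborel ..
  have "measure (smear h e P) A - measure (smear h e Q) A =
      measure (density lborel (\<lambda>x. ennreal (max 0 (g x)))) A - measure (density lborel (\<lambda>x. ennreal (max 0 (- g x)))) A"
  proof (rule signed_measures_agree[where S = S])
    show "finite_measure (density lborel (\<lambda>x. ennreal (max 0 (- g x))))"
      using finite_measure_density_pos[of "\<lambda>x. - g x"] g by simp
    show "A \<subseteq> S" using A by (auto simp: S_def)
    fix \<phi> :: "'a \<Rightarrow> real" assume \<phi>: "smooth_compact_support S \<phi>" "\<And>x. x \<notin> S \<Longrightarrow> \<phi> x = 0"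
    define D where "D x = frechet_derivative \<phi> (at x) e" for x
    obtain K C where K: "compact K" "K \<subseteq> S" "\<And>x. x \<notin> K \<Longrightarrow> \<phi> x = 0" and Ck: "\<And>k. Ck_on k UNIV \<phi>"
      and cD': "continuous_on UNIV (\<lambda>x. frechet_derivative \<phi> (at x) e)"
      and der: "\<And>x. (\<phi> has_derivative frechet_derivative \<phi> (at x)) (at x)"
      and D_le': "\<And>x. \<bar>frechet_derivative \<phi> (at x) e\<bar> \<le> C" and \<phi>_le: "\<And>x. \<bar>\<phi> x\<bar> \<le> C"
      using smooth_zero_outside[OF S \<phi>, of e] by blast
    have cD: "continuous_on UNIV D" and D_le: "\<And>x. \<bar>D x\<bar> \<le> C"
      using cD' D_le' by (auto simp: D_def[abs_def])
    have m\<phi>: "\<phi> \<in> borel_measurable borel"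
      using Ck[of 0] by (auto intro: borel_measurable_continuous_onI)
    have mD[measurable]: "D \<in> borel_measurable borel" using cD by (rule borel_measurable_continuous_onI)
    \<comment> \<open>For a fixed s this is the definition of the distributional derivative, applied
      to the translated test function.\<close>
    have step: "(LINT y|P. \<phi> (y - s *\<^sub>R e)) - (LINT y|Q. \<phi> (y - s *\<^sub>R e)) =
        - (LINT y|lborel. w0 y * D (y - s *\<^sub>R e))" if s: "0 \<le> s" "s \<le> h" for s
    proof -
      have m: "(\<lambda>y. \<phi> (y - s *\<^sub>R e)) \<in> borel_measurable borel"
        by (rule measurable_compose[OF _ m\<phi>]) simp
      have "smooth_compact_support \<Omega> (\<lambda>y. \<phi> (y - s *\<^sub>R e))"
        by (rule smooth_translate[OF \<Omega>(1) Ck K(1,3)]) (use S_seg s K(2) in auto)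
      from deriv[OF this] have "signed_integral (borel_on \<Omega>) \<mu> (\<lambda>y. \<phi> (y - s *\<^sub>R e)) =
          - (LINT y|lborel. w0 y * frechet_derivative (\<lambda>y. \<phi> (y - s *\<^sub>R e)) (at y) e)" by simp
      moreover have "frechet_derivative (\<lambda>y. \<phi> (y - s *\<^sub>R e)) (at y) = frechet_derivative \<phi> (at (y - s *\<^sub>R e))" for y
        using frechet_derivative_translate[of \<phi> _ y "- (s *\<^sub>R e)"] der by simp
      ultimately show ?thesis
        using signed_integral_eq[OF m, of \<Omega> "\<lambda>y. \<phi> (y - s *\<^sub>R e)" \<mu>] by (simp add: P_def Q_def D_def)
    qed
    let ?F = "\<lambda>s y. w0 y * D (y - s *\<^sub>R e)"
    have mF: "case_prod ?F \<in> borel_measurable (lborel_Icc h \<Otimes>\<^sub>M lborel)"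
      by (simp add: case_prod_beta') measurable
    have F_le: "norm (?F s y) \<le> norm (C * w0 y)" for s y
    proof -
      have "C \<ge> 0" using D_le[of 0] by linarith
      then show ?thesis using mult_left_mono[OF D_le[of "y - s *\<^sub>R e"], of "\<bar>w0 y\<bar>"] by (simp add: abs_mult mult.commute)
    qed
    have intF: "integrable lborel (?F s)" for s
      by (rule Bochner_Integration.integrable_bound[of _ "\<lambda>y. C * w0 y"]) (use w0 F_le in auto)
    \<comment> \<open>The integrand is dominated by C |w0 y| uniformly in s, and [0, h] has finite
      length; this justifies exchanging the integrals.\<close>
    have F: "integrable (lborel_Icc h \<Otimes>\<^sub>M lborel) (case_prod ?F)"
    proof (rule RL.Fubini_integrable[OF mF])
      show "AE s in lborel_Icc h. integrable lborel (\<lambda>y. case_prod ?F (s, y))" using intF by simp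
      have "(LINT y|lborel. norm (?F s y)) \<le> (LINT y|lborel. norm (C * w0 y))" for s
        using intF w0 F_le by (intro integral_mono integrable_norm) auto
      then show "integrable (lborel_Icc h) (\<lambda>s. LINT y|lborel. norm (case_prod ?F (s, y)))"
        using mF by (intro R.integrable_const_bound[of _ "LINT y|lborel. norm (C * w0 y)"] AE_I2)
          (auto intro!: lborel.borel_measurable_lebesgue_integral simp: case_prod_beta')
    qed
    have mI: "(\<lambda>s. LINT y|lborel. ?F s y) \<in> borel_measurable borel"
      using RL.integrable_fst[OF F] by (simp add: borel_measurable_integrable measurable_cong_sets[OF sets_lborel_Icc refl, symmetric])
    have mPQ: "(\<lambda>s. LINT y|X. \<phi> (y - s *\<^sub>R e)) \<in> borel_measurable borel" if "finite_measure X" "sets X = sets borel" for X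
      using borel_measurable_integrable[OF integral_smear(2)[OF that m\<phi> \<phi>_le]]
      by (simp add: measurable_cong_sets[OF sets_lborel_Icc refl])
    have inner: "(LINT s|lborel_Icc h. ?F s y) = w0 y * (\<phi> y - \<phi> (y - h *\<^sub>R e))" for y
    proof -
      have "(LINT s|lborel_Icc h. ?F s y) = w0 y * (LINT s|lborel_Icc h. D (y - s *\<^sub>R e))" by simp
      also have "(LINT s|lborel_Icc h. D (y - s *\<^sub>R e)) = \<phi> y - \<phi> (y - h *\<^sub>R e)"
        unfolding integral_lborel_Icc[OF measurable_compose[OF _ mD], of "\<lambda>s. y - s *\<^sub>R e", simplified]
        unfolding D_def by (rule integral_directional_derivative[OF h der cD'])
      finally show ?thesis .
    qed
    have "integral\<^sup>L (smear h e P) \<phi> - integral\<^sup>L (smear h e Q) \<phi> =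
        (LINT s|lborel_Icc h. (LINT y|P. \<phi> (y - s *\<^sub>R e)) - (LINT y|Q. \<phi> (y - s *\<^sub>R e)))"
      using integral_smear[OF P m\<phi> \<phi>_le, of h e] integral_smear[OF Q m\<phi> \<phi>_le, of h e] by simp
    also have "\<dots> = (LINT s|lborel_Icc h. - (LINT y|lborel. ?F s y))"
      using mPQ[OF P] mPQ[OF Q] mI step by (intro integral_lborel_Icc_cong) auto
    also have "\<dots> = - (LINT y|lborel. LINT s|lborel_Icc h. ?F s y)"
      using RL.Fubini_integral[OF F] by simp
    also have "\<dots> = - (LINT y|lborel. w0 y * (\<phi> y - \<phi> (y - h *\<^sub>R e)))"
      unfolding inner ..
    also have "\<dots> = (LINT x|lborel. g x * \<phi> x)"
    proof -
      have b: "integrable lborel (\<lambda>x. f x * \<psi> x)"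
        if "integrable lborel f" "\<psi> \<in> borel_measurable borel" "\<And>x. \<bar>\<psi> x\<bar> \<le> C" for f \<psi> :: "'a \<Rightarrow> real"
      proof (rule Bochner_Integration.integrable_bound[of _ "\<lambda>y. C * f y"])
        have "C \<ge> 0" using D_le[of 0] by linarith
        then show "AE x in lborel. norm (f x * \<psi> x) \<le> norm (C * f x)"
          using mult_left_mono[OF that(3), of "\<bar>f x\<bar>" x for x] by (intro AE_I2) (simp add: abs_mult mult.commute)
      qed (use that in auto)
      have m: "(\<lambda>y. \<phi> (y - h *\<^sub>R e)) \<in> borel_measurable borel"
        by (rule measurable_compose[OF _ m\<phi>]) simp
      have "(LINT x|lborel. g x * \<phi> x) = (LINT x|lborel. w0 (x + h *\<^sub>R e) * \<phi> x) - (LINT x|lborel. w0 x * \<phi> x)"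
        unfolding g_def left_diff_distrib
        by (intro Bochner_Integration.integral_diff b w0 w0h m\<phi> \<phi>_le)
      also have "(LINT x|lborel. w0 (x + h *\<^sub>R e) * \<phi> x) = (LINT y|lborel. w0 y * \<phi> (y - h *\<^sub>R e))"
        using integral_shift(1)[OF borel_measurable_times[OF _ m], of w0 "h *\<^sub>R e"] by simp
      also have "\<dots> - (LINT x|lborel. w0 x * \<phi> x) = - (LINT y|lborel. w0 y * (\<phi> y - \<phi> (y - h *\<^sub>R e)))"
        unfolding right_diff_distrib
        by (subst Bochner_Integration.integral_diff) (auto intro!: b w0 m m\<phi> \<phi>_le)
      finally show ?thesis by simp
    qed
    also have "\<dots> = integral\<^sup>L (density lborel (\<lambda>x. ennreal (max 0 (g x)))) \<phi> -
        integral\<^sup>L (density lborel (\<lambda>x. ennreal (max 0 (- g x)))) \<phi>"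
      by (rule integral_density_signed[OF g m\<phi> \<phi>_le, symmetric])
    finally show "integral\<^sup>L (smear h e P) \<phi> - integral\<^sup>L (smear h e Q) \<phi> =
        integral\<^sup>L (density lborel (\<lambda>x. ennreal (max 0 (g x)))) \<phi> -
        integral\<^sup>L (density lborel (\<lambda>x. ennreal (max 0 (- g x)))) \<phi>" .
  qed (use finite_smear[OF P] finite_smear[OF Q] finite_measure_density_pos[OF g] S A in auto)
  then show ?thesis
    unfolding measure_density_signed[OF g A(1)] measure_smear(1)[OF P A(1)] measure_smear(1)[OF Q A(1)]
    using measure_smear(2)[OF P A(1), of h e] measure_smear(2)[OF Q A(1), of h e]
    by (simp add: g_def[abs_def] P_def Q_def)
qed

subsection \<open>The absolutely continuous part on level sets\<close>

text \<open>K and K - v have equal finite measure, so K minus (K - v) and (K - v) minus K have equal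
  measure too. The second set lies in U - K, which is small.\<close>

lemma measure_compact_shift_diff:
  fixes K U :: "'a::euclidean_space set"
  assumes K: "compact K" and U: "open U" "K \<subseteq> U" "emeasure lborel (U - K) < ennreal \<delta>"
    and shift: "\<And>y. y + v \<in> K \<Longrightarrow> y \<in> U"
  shows "measure lborel {y \<in> K. y + v \<notin> K} < \<delta>" and "{y \<in> K. y + v \<notin> K} \<in> sets borel"
proof -
  let ?T = "{y. y + v \<in> K}"
  have Kf: "emeasure lborel K < \<infinity>" using K emeasure_compact_finite by auto
  have Kb: "K \<in> sets borel" using K by (simp add: borel_compact)
  have Tb: "?T \<in> sets borel"
  proof -
    have "(\<lambda>y. y + v) -` K \<inter> space borel \<in> sets borel"
      by (rule measurable_sets[of _ borel borel]) (use Kb in auto)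
    then show ?thesis by (simp add: vimage_def)
  qed
  have eq: "{y \<in> K. y + v \<notin> K} = K - ?T" by auto
  then show "{y \<in> K. y + v \<notin> K} \<in> sets borel" using Kb Tb by auto
  have emT: "emeasure lborel ?T = emeasure lborel K"
  proof -
    have "emeasure lborel K = emeasure (distr lborel borel ((+) v)) K" by (simp add: lborel_distr_plus)
    also have "\<dots> = emeasure lborel ?T"
      using Kb by (subst emeasure_distr) (auto simp: vimage_def add.commute)
    finally show ?thesis by simp
  qed
  have "emeasure lborel (K \<inter> ?T) + emeasure lborel (K - ?T) = emeasure lborel K"
    using Kb Tb by (subst plus_emeasure) (auto intro!: arg_cong[where f = "emeasure lborel"])
  moreover have "emeasure lborel (K \<inter> ?T) + emeasure lborel (?T - K) = emeasure lborel ?T"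
    using Kb Tb by (subst plus_emeasure) (auto intro!: arg_cong[where f = "emeasure lborel"])
  moreover have "emeasure lborel (K \<inter> ?T) \<noteq> \<infinity>"
    using Kf emeasure_mono[of "K \<inter> ?T" K lborel] Kb by (auto simp: top.not_eq_extremum)
  ultimately have "emeasure lborel (K - ?T) = emeasure lborel (?T - K)"
    unfolding emT by (metis ennreal_add_left_cancel)
  also have "\<dots> \<le> emeasure lborel (U - K)"
    using U Kb shift by (intro emeasure_mono) auto
  also have "\<dots> < ennreal \<delta>" by (rule U)
  finally have lt: "emeasure lborel (K - ?T) < ennreal \<delta>" .
  then have "emeasure lborel (K - ?T) = ennreal (measure lborel (K - ?T))"
    by (intro emeasure_eq_ennreal_measure) (auto simp: less_top[symmetric])
  with lt show "measure lborel {y \<in> K. y + v \<notin> K} < \<delta>"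
    unfolding eq by (simp add: ennreal_less_iff)
qed

lemma integral_lborel_Icc_ge:
  assumes "integrable (lborel_Icc h) F" "h \<ge> 0" "\<And>s. 0 \<le> s \<Longrightarrow> s \<le> h \<Longrightarrow> c \<le> F s"
  shows "c * h \<le> integral\<^sup>L (lborel_Icc h) F"
proof -
  interpret finite_measure "lborel_Icc h" by (rule finite_lborel_Icc)
  have "integral\<^sup>L (lborel_Icc h) (\<lambda>_. c) = (LINT s:{0..h}|lborel. c)"
    by (rule integral_lborel_Icc) simp
  also have "\<dots> = c * h"
    unfolding set_lebesgue_integral_def using assms(2) by simp
  finally have eq: "integral\<^sup>L (lborel_Icc h) (\<lambda>_. c) = c * h" .
  have "AE s in lborel_Icc h. c \<le> F s"
    unfolding lborel_Icc_def using assms(3)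
    by (subst AE_density) (auto intro!: AE_I2 simp: indicator_def split: if_splits)
  then show ?thesis
    unfolding eq[symmetric] using assms(1) by (intro integral_mono_AE) auto
qed

text \<open>The measure with density max 0 f is finite and does not vanish on E. Inner regularity
  gives a compact subset of positive measure, on which f is its own positive part.\<close>

lemma compact_subset_positive_integral:
  fixes f :: "'a::euclidean_space \<Rightarrow> real"
  assumes f: "integrable lborel f" and E: "E \<in> sets borel" "\<And>x. x \<in> E \<Longrightarrow> f x > 0" "emeasure lborel E \<noteq> 0"
  shows "\<exists>K. compact K \<and> K \<subseteq> E \<and> (LINT x:K|lborel. f x) > 0"
proof -
  let ?m = "density lborel (\<lambda>x. ennreal (max 0 (f x)))"
  interpret finite_measure ?m by (rule finite_measure_density_pos[OF f])
  have [measurable]: "f \<in> borel_measurable borel" using f by auto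
  have "emeasure ?m E \<noteq> 0"
  proof
    assume "emeasure ?m E = 0"
    then have "E \<in> null_sets ?m" using E by auto
    then have "AE x in lborel. x \<in> E \<longrightarrow> ennreal (max 0 (f x)) = 0"
      using E by (subst (asm) null_sets_density_iff) auto
    then have "AE x in lborel. x \<notin> E"
    proof eventually_elim
      case (elim x)
      then show ?case using E(2)[of x] by (auto simp: max_def)
    qed
    then show False using E AE_iff_null_sets[of E lborel] by auto
  qed
  moreover have "emeasure ?m E = (SUP K \<in> {K. K \<subseteq> E \<and> compact K}. emeasure ?m K)"
    by (rule inner_regular) (use E emeasure_finite in auto)
  ultimately obtain K where K: "K \<subseteq> E" "compact K" "emeasure ?m K \<noteq> 0"
    by (metis (no_types, lifting) SUP_least bot_ennreal le_zero_eq mem_Collect_eq)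
  have Kb: "K \<in> sets borel" using K by (simp add: borel_compact)
  have "measure ?m K = (LINT x:K|lborel. max 0 (f x))"
  proof -
    have "measure (density lborel (\<lambda>x. ennreal (max 0 (max 0 (f x))))) K -
      measure (density lborel (\<lambda>x. ennreal (max 0 (- max 0 (f x))))) K = (LINT x:K|lborel. max 0 (f x))"
      by (rule measure_density_signed) (use f Kb in auto)
    moreover have "(\<lambda>x. ennreal (max 0 (- max 0 (f x)))) = (\<lambda>x. 0)" by (auto simp: max_def fun_eq_iff)
    moreover have "measure (density lborel (\<lambda>x::'a. 0)) K = 0"
      using Kb by (simp add: measure_def emeasure_density)
    ultimately show ?thesis by simp
  qed
  also have "\<dots> = (LINT x:K|lborel. f x)"
    unfolding set_lebesgue_integral_def using E(2) K(1)
    by (intro Bochner_Integration.integral_cong) (force simp: indicator_def max_def)+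
  finally have "(LINT x:K|lborel. f x) = measure ?m K" by simp
  moreover have "measure ?m K > 0" using K(3) by (simp add: emeasure_eq_measure zero_less_measure_iff)
  ultimately show ?thesis using K by auto
qed

lemma density_nonpos_where_constant:
  fixes w0 f :: "'a::euclidean_space \<Rightarrow> real"
  assumes \<Omega>: "open \<Omega>" "convex \<Omega>" and w0: "integrable lborel w0" and e: "norm e = 1"
    and v: "vector_measure (borel_on \<Omega>) \<mu>"
    and deriv: "\<And>\<phi>. smooth_compact_support \<Omega> \<phi> \<Longrightarrow>
      (LINT x|lborel. w0 x * frechet_derivative \<phi> (at x) e) = - signed_integral (borel_on \<Omega>) \<mu> \<phi>"
    and N: "N \<in> null_sets lborel" and f: "integrable lborel f"
    and ac: "\<And>A. A \<in> sets borel \<Longrightarrow> A \<subseteq> \<Omega> - N \<Longrightarrow> \<mu> A = (LINT x:A|lborel. f x)"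
    and S: "S \<in> sets borel" "S \<subseteq> \<Omega>" "AE x in lborel. x \<in> S \<longrightarrow> w0 x = c"
  shows "AE x in lborel. x \<in> S \<longrightarrow> f x \<le> 0"
proof (rule ccontr)
  assume contra: "\<not> (AE x in lborel. x \<in> S \<longrightarrow> f x \<le> 0)"
  have [measurable]: "f \<in> borel_measurable borel" "w0 \<in> borel_measurable borel" using f w0 by auto
  have Nb: "N \<in> sets borel" using N by auto
  \<comment> \<open>Truncating at n makes f bounded on K, so that the loss of mass on K - B s is
    controlled by Lebesgue measure. Removing N makes \<mu> equal to the integral of f there.\<close>
  define E where "E n = {x \<in> S - N. 0 < f x \<and> f x \<le> real n}" for n
  have Eb: "E n \<in> sets borel" for n
  proof -
    have "{x. 0 < f x \<and> f x \<le> real n} \<in> sets borel" by measurable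
    moreover have "E n = (S - N) \<inter> {x. 0 < f x \<and> f x \<le> real n}" by (auto simp: E_def)
    ultimately show ?thesis using S(1) Nb by auto
  qed
  have "\<exists>n. emeasure lborel (E n) \<noteq> 0"
  proof (rule ccontr)
    assume "\<not> ?thesis"
    then have "(\<Union>n. E n) \<in> null_sets lborel" using Eb by (intro null_sets_UN) auto
    then have "AE x in lborel. x \<notin> (\<Union>n. E n)" by (rule AE_not_in)
    moreover have "AE x in lborel. x \<notin> N" using N by (rule AE_not_in)
    ultimately have "AE x in lborel. x \<in> S \<longrightarrow> f x \<le> 0"
    proof eventually_elim
      case (elim x)
      obtain n where "f x \<le> real n" using real_arch_simple by blast
      with elim have "x \<in> E n" if "x \<in> S" "0 < f x" using that by (auto simp: E_def)
      with elim(1) show ?case by (meson UN_I UNIV_I not_le)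
    qed
    with contra show False by simp
  qed
  then obtain n where n: "emeasure lborel (E n) \<noteq> 0" by auto
  obtain K where K: "compact K" "K \<subseteq> E n" and I: "(LINT x:K|lborel. f x) > 0"
    using compact_subset_positive_integral[OF f Eb _ n] by (auto simp: E_def)
  define I where "I = (LINT x:K|lborel. f x)"
  have Kb: "K \<in> sets borel" using K by (simp add: borel_compact)
  have K\<Omega>: "K \<subseteq> \<Omega> - N" and KS: "K \<subseteq> S" and Kf: "\<And>x. x \<in> K \<Longrightarrow> 0 < f x \<and> f x \<le> real n"
    using K(2) S(2) by (auto simp: E_def)
  \<comment> \<open>Two sets of measure below \<delta> are lost, each with density at most n; the
    constant 8 makes this loss at most I / 4. The summand 1 avoids division by zero when n =
    0.\<close>
  define \<delta> where "\<delta> = I / (8 * (real n + 1))"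
  have \<delta>: "\<delta> > 0" using I by (simp add: \<delta>_def I_def)
  have n\<delta>: "2 * \<delta> * real n \<le> I / 4"
    using I by (simp add: \<delta>_def I_def field_simps)
  define P where "P = borel_positive_part \<Omega> \<mu>"
  define Q where "Q = borel_positive_part \<Omega> (\<lambda>A. - \<mu> A)"
  have P: "finite_measure P" "sets P = sets borel" and Q: "finite_measure Q" "sets Q = sets borel"
    using finite_borel_positive_part[OF v] finite_borel_positive_part[OF vector_measure_uminus[OF v]]
    by (auto simp: P_def Q_def)
  interpret Q: finite_measure Q by (rule Q)
  have PQ: "measure P A - measure Q A = \<mu> A" if "A \<in> sets borel" "A \<subseteq> \<Omega>" for A
    using borel_jordan_decomposition[OF v _ that] \<Omega>(1) by (simp add: P_def Q_def)
  \<comment> \<open>Two neighbourhoods of K are needed: \<open>O1\<close> keeps translates of K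
    close to K in Lebesgue measure, \<open>O2\<close> bounds the negative part of \<mu> near
    K.\<close>
  obtain O1 where O1: "open O1" "K \<subseteq> O1" "emeasure lborel (O1 - K) < ennreal \<delta>"
    using outer_regular_lborel[OF Kb \<delta>] by metis
  obtain O2 where O2: "open O2" "K \<subseteq> O2" "measure Q O2 < measure Q K + I / 4"
  proof -
    have "(INF U \<in> {U. K \<subseteq> U \<and> open U}. emeasure Q U) = emeasure Q K"
      by (rule outer_regular[symmetric]) (use Q Kb Q.emeasure_finite in auto)
    also have "\<dots> < ennreal (measure Q K + I / 4)"
      using I by (simp add: Q.emeasure_eq_measure ennreal_less_iff I_def del: ennreal_plus)
    finally obtain U where "K \<subseteq> U" "open U" "emeasure Q U < ennreal (measure Q K + I / 4)"
      unfolding INF_less_iff by auto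
    then show ?thesis
      using that by (auto simp: Q.emeasure_eq_measure ennreal_less_iff simp del: ennreal_plus)
  qed
  define U where "U = O1 \<inter> O2 \<inter> \<Omega>"
  have U: "open U" "K \<subseteq> U" using O1 O2 \<Omega> K\<Omega> by (auto simp: U_def)
  obtain r where r: "r > 0" "(\<Union>x\<in>K. ball x r) \<subseteq> U"
    using compact_subset_open_imp_ball_epsilon_subset[OF K(1) U] by metis
  define h where "h = r / 2"
  have h: "h > 0" "h < r" using r by (auto simp: h_def)
  have near: "x + t *\<^sub>R e \<in> U" if "x \<in> K" "\<bar>t\<bar> \<le> h" for x t
  proof -
    have "x + t *\<^sub>R e \<in> ball x r" using that h e by (simp add: dist_norm)
    then show ?thesis using r(2) that by blast
  qed
  have small: "measure lborel {y \<in> K. y + t *\<^sub>R e \<notin> K} < \<delta>" and smallb: "{y \<in> K. y + t *\<^sub>R e \<notin> K} \<in> sets borel"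
    if t: "\<bar>t\<bar> \<le> h" for t
  proof -
    have "y \<in> O1" if "y + t *\<^sub>R e \<in> K" for y
      using near[OF that, of "- t"] t by (auto simp: U_def)
    from measure_compact_shift_diff[OF K(1) O1 this]
    show "measure lborel {y \<in> K. y + t *\<^sub>R e \<notin> K} < \<delta>" "{y \<in> K. y + t *\<^sub>R e \<notin> K} \<in> sets borel" by auto
  qed
  define A where "A = {x \<in> K. x + h *\<^sub>R e \<in> K}"
  have Ab: "A \<in> sets borel"
  proof -
    have "A = K - {y \<in> K. y + h *\<^sub>R e \<notin> K}" by (auto simp: A_def)
    then show ?thesis using Kb smallb[of h] h by auto
  qed
  \<comment> \<open>\<open>B s\<close> is A + s e, the intersection of K + s e and K - (h - s) e.
    For s between 0 and h both shifts have length at most h, so little of K is missing from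
    it.\<close>
  define B where "B s = {y. y - s *\<^sub>R e \<in> A}" for s
  have Bb: "B s \<in> sets borel" for s
  proof -
    have "(\<lambda>y. y - s *\<^sub>R e) -` A \<inter> space borel \<in> sets borel"
      by (rule measurable_sets[of _ borel borel]) (use Ab in auto)
    then show ?thesis by (simp add: vimage_def B_def)
  qed
  have key: "I / 2 \<le> measure P (B s) - measure Q (B s)" if s: "0 \<le> s" "s \<le> h" for s
  proof -
    have BU: "B s \<subseteq> U"
    proof
      fix y assume "y \<in> B s"
      then show "y \<in> U" using near[of "y - s *\<^sub>R e" s] s by (auto simp: B_def A_def)
    qed
    \<comment> \<open>\<open>\<mu> (B s) = \<mu> K - \<mu> (K - B s) + \<mu> (B s - K)\<close>, where \<open>\<mu> (K - B s) \<le> I / 4\<close> and \<open>\<mu> (B s - K) \<ge> - I / 4\<close>.\<close>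
    define X where "X = {y \<in> K. y + (- s) *\<^sub>R e \<notin> K} \<union> {y \<in> K. y + (h - s) *\<^sub>R e \<notin> K}"
    have KB: "K - B s \<subseteq> X" by (auto simp: B_def A_def X_def algebra_simps)
    have b: "{y \<in> K. y + (- s) *\<^sub>R e \<notin> K} \<in> sets borel" "{y \<in> K. y + (h - s) *\<^sub>R e \<notin> K} \<in> sets borel"
      by (rule smallb; use s in simp)+
    have Xb: "X \<in> sets borel" unfolding X_def by (rule sets.Un[OF b])
    have KX: "X \<subseteq> K" by (auto simp: X_def)
    have fK: "emeasure lborel K < \<infinity>" using K emeasure_compact_finite by auto
    have fm: "Y \<in> fmeasurable lborel" if "Y \<in> sets borel" "Y \<subseteq> K" for Y
      using fmeasurableI2[of K lborel Y] that fK Kb by (auto simp: fmeasurable_def)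
    have "measure lborel X \<le> measure lborel {y \<in> K. y + (- s) *\<^sub>R e \<notin> K} + measure lborel {y \<in> K. y + (h - s) *\<^sub>R e \<notin> K}"
      unfolding X_def by (rule measure_Un_le; simp only: sets_lborel b)
    also have "\<dots> \<le> 2 * \<delta>" using small[of "- s"] small[of "h - s"] s by simp
    finally have mX: "measure lborel X \<le> 2 * \<delta>" .
    have mKB: "measure lborel (K - B s) \<le> 2 * \<delta>"
      using measure_mono_fmeasurable[OF KB _ fm[OF Xb KX]] Kb Bb mX by auto
    have "\<mu> (K - B s) = (LINT x:K - B s|lborel. f x)"
      using K\<Omega> Kb Bb by (intro ac) auto
    also have "\<dots> \<le> (LINT x:K - B s|lborel. real n)"
      unfolding set_lebesgue_integral_def
    proof (rule integral_mono)
      show "integrable lborel (\<lambda>x. indicator (K - B s) x *\<^sub>R f x)"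
        using f Kb Bb by (intro integrable_mult_indicator) auto
      show "integrable lborel (\<lambda>x. indicator (K - B s) x *\<^sub>R real n)"
        using fm[of "K - B s"] Kb Bb by (auto simp: fmeasurable_def)
    qed (use Kf in \<open>auto simp: indicator_def\<close>)
    also have "\<dots> = real n * measure lborel (K - B s)"
      unfolding set_lebesgue_integral_def using Kb Bb by simp
    also have "\<dots> \<le> I / 4"
      using mult_left_mono[OF mKB, of "real n"] n\<delta> by (simp add: algebra_simps)
    finally have 1: "\<mu> (K - B s) \<le> I / 4" .
    \<comment> \<open>Off K the measure need not be given by f, since this set may meet N. Extra
      positive mass can only help, and the negative mass is bounded by the choice of
      \<open>O2\<close>.\<close>
    have "measure Q (B s - K) \<le> measure Q (O2 - K)"
      using BU O2(1) Kb Q(2) by (intro Q.finite_measure_mono) (auto simp: U_def)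
    also have "\<dots> = measure Q O2 - measure Q K"
      using O2 Kb Q(2) by (intro Q.finite_measure_Diff) auto
    finally have 2: "measure Q (B s - K) \<le> I / 4" using O2(3) by simp
    have "measure P (B s - K) - measure Q (B s - K) = \<mu> (B s - K)"
      using BU by (intro PQ sets.Diff Bb Kb) (auto simp: U_def)
    then have 3: "- measure Q (B s - K) \<le> \<mu> (B s - K)"
      using measure_nonneg[of P "B s - K"] by linarith
    have \<Omega>b: "\<Omega> \<in> sets borel" using \<Omega> by simp
    have sub: "B s \<subseteq> \<Omega>" using BU by (auto simp: U_def)
    have "\<mu> ((B s \<inter> K) \<union> (B s - K)) = \<mu> (B s \<inter> K) + \<mu> (B s - K)"
      using Bb[of s] Kb sub by (intro vector_measure_Un[OF v]) (auto simp: sets_borel_on[OF \<Omega>b])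
    moreover have "\<mu> ((B s \<inter> K) \<union> (K - B s)) = \<mu> (B s \<inter> K) + \<mu> (K - B s)"
      using Bb[of s] Kb sub K\<Omega> by (intro vector_measure_Un[OF v]) (auto simp: sets_borel_on[OF \<Omega>b])
    moreover have "(B s \<inter> K) \<union> (B s - K) = B s" "(B s \<inter> K) \<union> (K - B s) = K" by auto
    ultimately have 4: "\<mu> (B s) = \<mu> (B s \<inter> K) + \<mu> (B s - K)" "\<mu> K = \<mu> (B s \<inter> K) + \<mu> (K - B s)"
      by simp_all
    have 5: "\<mu> K = I" using K\<Omega> Kb by (simp add: ac I_def)
    have "\<mu> (B s) = measure P (B s) - measure Q (B s)" using PQ[OF Bb sub] by simp
    then show ?thesis using 1 2 3 4 5 by linarith
  qed
  have "(LINT x:A|lborel. w0 (x + h *\<^sub>R e) - w0 x) = 0"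
  proof -
    \<comment> \<open>Lebesgue measure is translation invariant, so the exceptional null set may be
      shifted by h e. On A both x and x + h e lie in S, where w0 = c.\<close>
    have "AE x in distr lborel borel ((+) (h *\<^sub>R e)). x \<in> S \<longrightarrow> w0 x = c"
      unfolding lborel_distr_plus by (rule S(3))
    then have "AE x in lborel. h *\<^sub>R e + x \<in> S \<longrightarrow> w0 (h *\<^sub>R e + x) = c"
      using S(1) by (subst (asm) AE_distr_iff) auto
    with S(3) have "AE x in lborel. indicator A x *\<^sub>R (w0 (x + h *\<^sub>R e) - w0 x) = 0"
    proof eventually_elim
      case (elim x)
      then show ?case using KS by (auto simp: A_def indicator_def add.commute)
    qed
    then show ?thesis
      unfolding set_lebesgue_integral_def by (rule integral_eq_zero_AE)
  qed
  moreover have "(LINT x:A|lborel. w0 (x + h *\<^sub>R e) - w0 x) =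
      (LINT s|lborel_Icc h. measure P (B s) - measure Q (B s))"
    unfolding P_def Q_def B_def
    by (rule translation_identity[OF \<Omega> w0 v _ deriv Ab]) (use h K\<Omega> in \<open>auto simp: A_def\<close>)
  moreover have "I / 2 * h \<le> (LINT s|lborel_Icc h. measure P (B s) - measure Q (B s))"
    unfolding B_def
    by (rule integral_lborel_Icc_ge)
      (use h key measure_smear(2)[OF P Ab, of h e] measure_smear(2)[OF Q Ab, of h e] in \<open>auto simp: B_def\<close>)
  moreover have "I / 2 * h > 0" using I h by (simp add: I_def)
  ultimately show False by linarith
qed

lemma density_zero_where_constant:
  fixes w0 f :: "'a::euclidean_space \<Rightarrow> real"
  assumes \<Omega>: "open \<Omega>" "convex \<Omega>" and w0: "integrable lborel w0" and e: "norm e = 1"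
    and v: "vector_measure (borel_on \<Omega>) \<mu>"
    and deriv: "\<And>\<phi>. smooth_compact_support \<Omega> \<phi> \<Longrightarrow>
      (LINT x|lborel. w0 x * frechet_derivative \<phi> (at x) e) = - signed_integral (borel_on \<Omega>) \<mu> \<phi>"
    and N: "N \<in> null_sets lborel" and f: "integrable lborel f"
    and ac: "\<And>A. A \<in> sets borel \<Longrightarrow> A \<subseteq> \<Omega> - N \<Longrightarrow> \<mu> A = (LINT x:A|lborel. f x)"
    and S: "S \<in> sets borel" "S \<subseteq> \<Omega>" "AE x in lborel. x \<in> S \<longrightarrow> w0 x = c"
  shows "AE x in lborel. x \<in> S \<longrightarrow> f x = 0"
proof -
  have "AE x in lborel. x \<in> S \<longrightarrow> f x \<le> 0"
    by (rule density_nonpos_where_constant[OF \<Omega> w0 e v deriv N f ac S])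
  moreover have "AE x in lborel. x \<in> S \<longrightarrow> - f x \<le> 0"
  proof (rule density_nonpos_where_constant[OF \<Omega> _ e vector_measure_uminus[OF v] _ N _ _ S(1,2)])
    show "(LINT x|lborel. - w0 x * frechet_derivative \<phi> (at x) e) =
        - signed_integral (borel_on \<Omega>) (\<lambda>A. - \<mu> A) \<phi>" if "smooth_compact_support \<Omega> \<phi>" for \<phi>
      using deriv[OF that] by (simp add: signed_integral_def)
    show "- \<mu> A = (LINT x:A|lborel. - f x)" if "A \<in> sets borel" "A \<subseteq> \<Omega> - N" for A
      using ac[OF that] by (simp add: set_lebesgue_integral_def)
    show "AE x in lborel. x \<in> S \<longrightarrow> - w0 x = - c" using S(3) by auto
  qed (use w0 f in auto)
  ultimately show ?thesis by eventually_elim auto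
qed

subsection \<open>Integration by parts\<close>

text \<open>Vanishing of g is required only where f vanishes on a whole neighbourhood. This local
  form covers derivatives, for which vanishing at the point would not suffice.\<close>

lemma smooth_compact_support_map:
  assumes S: "open S" and f: "smooth_compact_support S f"
    and g: "\<And>k. Ck_on k S g" "\<And>x K. \<lbrakk>open K; x \<in> K; x \<in> S; \<And>y. y \<in> K \<inter> S \<Longrightarrow> f y = 0\<rbrakk> \<Longrightarrow> g x = 0"
  shows "smooth_compact_support S g"
proof -
  obtain K where K: "compact K" "K \<subseteq> S" "\<And>x. x \<in> S - K \<Longrightarrow> f x = 0"
    using smooth_compact_supportE[OF S f] by metis
  show ?thesis
  proof (rule smooth_compact_supportI[OF S g(1) K(1,2)])
    show "g x = 0" if "x \<in> S - K" for x
      by (rule g(2)[of "- K"]) (use that K in \<open>auto simp: compact_imp_closed\<close>)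
  qed
qed

lemma Ck_on_frechet_derivative:
  "(\<And>n. Ck_on n S f) \<Longrightarrow> Ck_on k S (\<lambda>x. frechet_derivative f (at x) v)"
  by (drule meta_spec[of _ "Suc k"]) simp

lemma smooth_compact_supportD: "smooth_compact_support S f \<Longrightarrow> Ck_on k S f"
  by (simp add: smooth_compact_support_def)

lemma smooth_compact_support_frechet_derivative:
  assumes S: "open S" and f: "smooth_compact_support S f"
  shows "smooth_compact_support S (\<lambda>x. frechet_derivative f (at x) v)"
proof (rule smooth_compact_support_map[OF S f])
  show "Ck_on k S (\<lambda>x. frechet_derivative f (at x) v)" for k
    by (rule Ck_on_frechet_derivative) (rule smooth_compact_supportD[OF f])
  show "frechet_derivative f (at x) v = 0"
    if "open K" "x \<in> K" "x \<in> S" "\<And>y. y \<in> K \<inter> S \<Longrightarrow> f y = 0" for x K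
    using frechet_derivative_cong_open[of "K \<inter> S" x f "\<lambda>_. 0"] that S
    by (simp add: open_Int frechet_derivative_const)
qed

lemma smooth_compact_support_bounded_linear:
  assumes S: "open S" and f: "smooth_compact_support S f" and L: "bounded_linear L"
  shows "smooth_compact_support S (\<lambda>x. L (f x))"
proof (rule smooth_compact_support_map[OF S f])
  show "Ck_on k S (\<lambda>x. L (f x))" for k
    by (rule Ck_on_bounded_linear[OF S L smooth_compact_supportD[OF f]])
  show "L (f x) = 0" if "x \<in> K" "x \<in> S" "\<And>y. y \<in> K \<inter> S \<Longrightarrow> f y = 0" for x K
    using that linear_0[OF bounded_linear.linear[OF L]] by simp
qed

lemma smooth_compact_support_mult:
  fixes f g :: "'a::euclidean_space \<Rightarrow> real"
  assumes S: "open S" and f: "smooth_compact_support S f" and g: "\<And>k. Ck_on k S g"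
  shows "smooth_compact_support S (\<lambda>x. f x * g x)"
proof (rule smooth_compact_support_map[OF S f])
  show "Ck_on k S (\<lambda>x. f x * g x)" for k
    by (rule Ck_on_mult[OF S smooth_compact_supportD[OF f] g])
  show "f x * g x = 0" if "x \<in> K" "x \<in> S" "\<And>y. y \<in> K \<inter> S \<Longrightarrow> f y = 0" for x K
    using that by simp
qed

lemma smooth_compact_support_extend_zero:
  fixes f :: "'a::euclidean_space \<Rightarrow> 'b::real_normed_vector"
  assumes S: "open S" and f: "smooth_compact_support S f"
  shows "smooth_compact_support S (\<lambda>x. if x \<in> S then f x else 0)"
proof (rule smooth_compact_support_map[OF S f])
  show "Ck_on k S (\<lambda>x. if x \<in> S then f x else 0)" for k
    by (rule Ck_on_cong_imp[OF S _ smooth_compact_supportD[OF f]]) auto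
  show "(if x \<in> S then f x else 0) = 0" if "x \<in> K" "x \<in> S" "\<And>y. y \<in> K \<inter> S \<Longrightarrow> f y = 0" for x K
    using that by simp
qed

lemma smooth_compact_support_integrable:
  fixes f :: "'a::euclidean_space \<Rightarrow> real"
  assumes S: "open S" and f: "smooth_compact_support S f" "\<And>x. x \<notin> S \<Longrightarrow> f x = 0"
  shows "integrable lborel f" and "f \<in> borel_measurable borel" and "\<exists>C. \<forall>x. \<bar>f x\<bar> \<le> C"
proof -
  obtain K C where K: "compact K" "K \<subseteq> S" "\<forall>x. x \<notin> K \<longrightarrow> f x = 0" "\<forall>k. Ck_on k UNIV f"
    and C: "\<forall>x. \<bar>f x\<bar> \<le> C" using smooth_zero_outside[OF S f, of 0] by blast
  have c: "continuous_on UNIV f" using K(4)[rule_format, of 0] by simp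
  then show "f \<in> borel_measurable borel" by (rule borel_measurable_continuous_onI)
  have "integrable lborel (\<lambda>x. indicator K x *\<^sub>R f x)"
    using borel_integrable_compact[OF K(1) continuous_on_subset[OF c]] by auto
  moreover have "(\<lambda>x. indicator K x *\<^sub>R f x) = f"
    using K(3) by (auto simp: fun_eq_iff indicator_def)
  ultimately show "integrable lborel f" by simp
  show "\<exists>C. \<forall>x. \<bar>f x\<bar> \<le> C" using C by blast
qed

text \<open>The integral of f(y) - f(y - e) is 0 by translation invariance. By the fundamental
  theorem and Fubini it is also the average over s in [0, 1] of the integrals of the shifted
  derivative, all equal to the one in question.\<close>

lemma integral_frechet_derivative_eq_0:
  fixes f :: "'a::euclidean_space \<Rightarrow> real"
  assumes S: "open S" and f: "smooth_compact_support S f" "\<And>x. x \<notin> S \<Longrightarrow> f x = 0"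
  shows "(LINT x|lborel. frechet_derivative f (at x) e) = 0"
proof -
  define D where "D x = frechet_derivative f (at x) e" for x
  obtain K C where K: "compact K" "\<forall>x. x \<notin> K \<longrightarrow> f x = 0" "\<forall>k. Ck_on k UNIV f"
    and cD': "continuous_on UNIV (\<lambda>x. frechet_derivative f (at x) e)"
    and der: "\<forall>x. (f has_derivative frechet_derivative f (at x)) (at x)"
    using smooth_zero_outside[OF S f, of e] by blast
  have fU: "smooth_compact_support UNIV f"
    by (rule smooth_compact_supportI[of _ _ K]) (use K in auto)
  have D: "integrable lborel D" and [measurable]: "D \<in> borel_measurable borel"
    unfolding D_def
    using smooth_compact_support_integrable(1,2)[OF open_UNIV smooth_compact_support_frechet_derivative[OF open_UNIV fU], of e]
    by auto
  have f_int: "integrable lborel f" and fm[measurable]: "f \<in> borel_measurable borel"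
    using smooth_compact_support_integrable[OF S f] by auto
  interpret R: finite_measure "lborel_Icc 1" by (rule finite_lborel_Icc)
  interpret RL: pair_sigma_finite "lborel_Icc 1" lborel ..
  let ?F = "\<lambda>s y. D (y - s *\<^sub>R e)"
  have shift: "(LINT y|lborel. g (y - s *\<^sub>R e)) = (LINT y|lborel. g y)"
    "integrable lborel (\<lambda>y. g (y - s *\<^sub>R e)) \<longleftrightarrow> integrable lborel g"
    if "g \<in> borel_measurable borel" for g :: "'a \<Rightarrow> real" and s
    using integral_shift[OF that, of "- (s *\<^sub>R e)"] by simp_all
  have mF: "case_prod ?F \<in> borel_measurable (lborel_Icc 1 \<Otimes>\<^sub>M lborel)"
    by (simp add: case_prod_beta') measurable
  have F: "integrable (lborel_Icc 1 \<Otimes>\<^sub>M lborel) (case_prod ?F)"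
  proof (rule RL.Fubini_integrable[OF mF])
    show "AE s in lborel_Icc 1. integrable lborel (\<lambda>y. case_prod ?F (s, y))"
      using D shift(2) by simp
    show "integrable (lborel_Icc 1) (\<lambda>s. LINT y|lborel. norm (case_prod ?F (s, y)))"
      using shift(1)[of "\<lambda>y. norm (D y)"] by simp
  qed
  have "(LINT y|lborel. f y - f (y - 1 *\<^sub>R e)) = (LINT y|lborel. LINT s|lborel_Icc 1. ?F s y)"
  proof (rule Bochner_Integration.integral_cong)
    show "f y - f (y - 1 *\<^sub>R e) = (LINT s|lborel_Icc 1. ?F s y)" for y
    proof -
      have "(\<lambda>s. ?F s y) \<in> borel_measurable borel" by measurable
      from integral_lborel_Icc[OF this, of 1] show ?thesis
        using integral_directional_derivative[of 1 f e y] der cD' by (simp add: D_def)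
    qed
  qed simp
  also have "\<dots> = (LINT s|lborel_Icc 1. LINT y|lborel. ?F s y)"
    by (rule RL.Fubini_integral[OF F])
  also have "\<dots> = (LINT s|lborel_Icc 1. LINT y|lborel. D y)"
    using shift(1)[of D] by simp
  also have "\<dots> = (LINT s:{0..1::real}|lborel. LINT y|lborel. D y)"
    by (rule integral_lborel_Icc[OF borel_measurable_const])
  also have "\<dots> = (LINT y|lborel. D y)"
    unfolding set_lebesgue_integral_def by simp
  finally have "(LINT y|lborel. D y) = (LINT y|lborel. f y - f (y - 1 *\<^sub>R e))" by simp
  also have "\<dots> = 0"
    using f_int shift[OF fm, of 1] by simp
  finally show ?thesis by (simp add: D_def)
qed

text \<open>The functions in the definitions are arbitrary off A. Agreement on A with a Borel
  function suffices to leave the completed measure.\<close>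

lemma set_integral_lebesgue_eq:
  fixes f g :: "'a::euclidean_space \<Rightarrow> 'b::{banach, second_countable_topology}"
  assumes A: "A \<in> sets borel" and g: "g \<in> borel_measurable borel" and eq: "\<And>x. x \<in> A \<Longrightarrow> f x = g x"
  shows "(LINT x:A|lebesgue. f x) = (LINT x:A|lborel. g x)"
    and "set_integrable lebesgue A f \<longleftrightarrow> set_integrable lborel A g"
proof -
  have e: "(\<lambda>x. indicat_real A x *\<^sub>R f x) = (\<lambda>x. indicat_real A x *\<^sub>R g x)"
    using eq by (auto simp: fun_eq_iff indicator_def)
  have m: "(\<lambda>x. indicat_real A x *\<^sub>R g x) \<in> borel_measurable lborel" using A g by simp
  show "(LINT x:A|lebesgue. f x) = (LINT x:A|lborel. g x)"
    unfolding set_lebesgue_integral_def e by (rule integral_completion[OF m])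
  show "set_integrable lebesgue A f \<longleftrightarrow> set_integrable lborel A g"
    unfolding set_integrable_def e by (rule integrable_completion[OF m])
qed

lemma set_integral_zero_outside:
  fixes g :: "'a::euclidean_space \<Rightarrow> 'b::{banach, second_countable_topology}"
  assumes "\<And>x. x \<notin> A \<Longrightarrow> g x = 0"
  shows "(LINT x:A|M. g x) = (LINT x|M. g x)"
  unfolding set_lebesgue_integral_def using assms
  by (intro Bochner_Integration.integral_cong) (auto simp: indicator_def)

text \<open>After extension by zero, the product f g is a test function on the whole space, and the
  integral of its derivative vanishes.\<close>

lemma integration_by_parts:
  fixes f g :: "'a::euclidean_space \<Rightarrow> real"
  assumes S: "open S" and f: "smooth_compact_support S f" and g: "smooth_compact_support S g"
  shows "(LINT x:S|lebesgue. f x * frechet_derivative g (at x) e) =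
    - (LINT x:S|lebesgue. frechet_derivative f (at x) e * g x)"
proof -
  define f0 where "f0 x = (if x \<in> S then f x else 0)" for x
  define g0 where "g0 x = (if x \<in> S then g x else 0)" for x
  have f0: "smooth_compact_support S f0" "\<And>x. x \<notin> S \<Longrightarrow> f0 x = 0"
    and g0: "smooth_compact_support S g0" "\<And>x. x \<notin> S \<Longrightarrow> g0 x = 0"
    using smooth_compact_support_extend_zero[OF S f] smooth_compact_support_extend_zero[OF S g]
    by (simp_all add: f0_def[abs_def] g0_def[abs_def])
  obtain Kf Cf where Kf: "compact Kf" "\<forall>x. x \<notin> Kf \<longrightarrow> f0 x = 0" "\<forall>k. Ck_on k UNIV f0"
    and fd: "\<forall>x. (f0 has_derivative frechet_derivative f0 (at x)) (at x)"
    using smooth_zero_outside[OF S f0, of e] by blast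
  obtain Kg Cg where Kg: "compact Kg" "\<forall>x. x \<notin> Kg \<longrightarrow> g0 x = 0" "\<forall>k. Ck_on k UNIV g0"
    and gd: "\<forall>x. (g0 has_derivative frechet_derivative g0 (at x)) (at x)"
    using smooth_zero_outside[OF S g0, of e] by blast
  have fU: "smooth_compact_support UNIV f0"
    by (rule smooth_compact_supportI[of _ _ Kf]) (use Kf in auto)
  have gU: "smooth_compact_support UNIV g0"
    by (rule smooth_compact_supportI[of _ _ Kg]) (use Kg in auto)
  define Df where "Df x = frechet_derivative f0 (at x) e" for x
  define Dg where "Dg x = frechet_derivative g0 (at x) e" for x
  note DfU = smooth_compact_support_frechet_derivative[OF open_UNIV fU, of e, folded Df_def]
  note DgU = smooth_compact_support_frechet_derivative[OF open_UNIV gU, of e, folded Dg_def]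
  have 1: "integrable lborel (\<lambda>x. f0 x * Dg x)" "(\<lambda>x. f0 x * Dg x) \<in> borel_measurable borel"
    and 2: "integrable lborel (\<lambda>x. Df x * g0 x)" "(\<lambda>x. Df x * g0 x) \<in> borel_measurable borel"
    using smooth_compact_support_integrable[OF open_UNIV smooth_compact_support_mult[OF open_UNIV fU smooth_compact_supportD[OF DgU]]]
      smooth_compact_support_integrable[OF open_UNIV smooth_compact_support_mult[OF open_UNIV DfU smooth_compact_supportD[OF gU]]]
    by auto
  have fg: "smooth_compact_support UNIV (\<lambda>x. f0 x * g0 x)"
    by (rule smooth_compact_support_mult[OF open_UNIV fU smooth_compact_supportD[OF gU]])
  have "frechet_derivative (\<lambda>x. f0 x * g0 x) (at x) e = f0 x * Dg x + Df x * g0 x" for x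
    using frechet_derivative_eqI[OF has_derivative_mult[OF fd[rule_format, of x] gd[rule_format, of x]]]
    by (simp add: Df_def Dg_def)
  then have "(LINT x|lborel. f0 x * Dg x + Df x * g0 x) = 0"
    using integral_frechet_derivative_eq_0[OF open_UNIV fg, of e] by simp
  then have "(LINT x|lborel. f0 x * Dg x) = - (LINT x|lborel. Df x * g0 x)"
    using 1 2 by simp
  moreover have Df: "frechet_derivative f (at x) e = Df x" and Dg: "frechet_derivative g (at x) e = Dg x" if "x \<in> S" for x
    unfolding Df_def Dg_def
    using frechet_derivative_cong_open[OF S that, of f f0] frechet_derivative_cong_open[OF S that, of g g0]
    by (auto simp: f0_def g0_def)
  moreover have "(LINT x:S|lebesgue. f x * frechet_derivative g (at x) e) = (LINT x|lborel. f0 x * Dg x)"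
  proof -
    have "(LINT x:S|lebesgue. f x * frechet_derivative g (at x) e) = (LINT x:S|lborel. f0 x * Dg x)"
      by (rule set_integral_lebesgue_eq) (use S 1 Dg in \<open>auto simp: f0_def\<close>)
    then show ?thesis by (subst (asm) set_integral_zero_outside) (auto simp: f0_def)
  qed
  moreover have "(LINT x:S|lebesgue. frechet_derivative f (at x) e * g x) = (LINT x|lborel. Df x * g0 x)"
  proof -
    have "(LINT x:S|lebesgue. frechet_derivative f (at x) e * g x) = (LINT x:S|lborel. Df x * g0 x)"
      by (rule set_integral_lebesgue_eq) (use S 2 Df in \<open>auto simp: g0_def\<close>)
    then show ?thesis by (subst (asm) set_integral_zero_outside) (auto simp: g0_def)
  qed
  ultimately show ?thesis by simp
qed

subsection \<open>Area of piecewise constant functions\<close>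

lemma variation_cong:
  assumes "\<And>B. B \<in> sets M \<Longrightarrow> \<mu> B = \<mu>' B"
  shows "variation M \<mu> A = variation M \<mu>' A"
  unfolding variation_def
proof (rule SUP_cong)
  fix P :: "nat \<Rightarrow> 'a set" assume "P \<in> {P. range P \<subseteq> sets M \<and> disjoint_family P \<and> (\<Union>n. P n) = A}"
  then have "\<mu> (P n) = \<mu>' (P n)" for n using assms by auto
  then show "(\<Sum>n. ennreal (norm (\<mu> (P n)))) = (\<Sum>n. ennreal (norm (\<mu>' (P n))))" by simp
qed simp

lemma vector_measure_cong_imp:
  assumes "vector_measure M \<mu>" "\<And>B. B \<in> sets M \<Longrightarrow> \<mu> B = \<mu>' B"
  shows "vector_measure M \<mu>'"
  unfolding vector_measure_def
proof (intro allI impI)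
  fix A :: "nat \<Rightarrow> 'a set" assume A: "range A \<subseteq> sets M" "disjoint_family A"
  have "(\<lambda>n. \<mu> (A n)) sums \<mu> (\<Union>n. A n)" by (rule vector_measure_sums[OF assms(1) A])
  moreover have "\<mu> (A n) = \<mu>' (A n)" "\<mu> (\<Union>n. A n) = \<mu>' (\<Union>n. A n)" for n
    using A(1) by (intro assms(2) sets.countable_UN; auto)+
  ultimately show "(\<lambda>n. \<mu>' (A n)) sums \<mu>' (\<Union>n. A n)" by simp
qed

text \<open>A and X - A, indexed by the booleans, form a finite partition of X.\<close>

lemma variation_zero_imp:
  assumes v: "vector_measure M \<nu>" and "variation M \<nu> X = 0" "X \<in> sets M" "A \<in> sets M" "A \<subseteq> X"
  shows "\<nu> A = 0"
proof -
  have "(\<Sum>b\<in>UNIV. ennreal (norm (\<nu> (if b then A else X - A)))) \<le> variation M \<nu> X"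
    by (rule variation_ge_sum[OF v]) (use assms in \<open>auto simp: disjoint_family_on_def\<close>)
  then show ?thesis using assms(2) by (simp add: UNIV_bool)
qed

text \<open>The translation argument lives in \<open>lborel\<close>, while BV functions and
  densities are only Lebesgue measurable. Changing them on a null set makes them Borel and zero off
  \<Omega>.\<close>

lemma set_integrable_borel_version:
  fixes f :: "'a::euclidean_space \<Rightarrow> real"
  assumes f: "set_integrable lebesgue \<Omega> f" and \<Omega>: "\<Omega> \<in> sets borel"
  shows "\<exists>g. integrable lborel g \<and> (\<forall>x. x \<notin> \<Omega> \<longrightarrow> g x = 0) \<and> (AE x in lborel. x \<in> \<Omega> \<longrightarrow> f x = g x)"
proof -
  let ?F = "\<lambda>x. indicat_real \<Omega> x * f x"
  have F: "integrable lebesgue ?F" using f by (simp add: set_integrable_def)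
  obtain g where g: "g \<in> borel_measurable lborel" "AE x in lborel. ?F x = g x"
    using completion_ex_borel_measurable_real[OF borel_measurable_integrable[OF F]] by blast
  let ?G = "\<lambda>x. indicat_real \<Omega> x * g x"
  have Gm: "?G \<in> borel_measurable lborel" using g \<Omega> by simp
  have AE: "AE x in lborel. ?F x = ?G x" using g(2) by eventually_elim (auto simp: indicator_def)
  have "integrable lebesgue ?G"
    by (rule integrable_cong_AE_imp[OF F]) (use AE_completion[OF AE] measurable_completion[OF Gm] in \<open>auto elim: AE_mp\<close>)
  then have "integrable lborel ?G" using integrable_completion[OF Gm] by simp
  moreover have "AE x in lborel. x \<in> \<Omega> \<longrightarrow> f x = ?G x"
    using AE by eventually_elim auto
  ultimately show ?thesis by (intro exI[of _ ?G]) auto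
qed

lemma set_integral_borel_version:
  fixes f g d :: "'a::euclidean_space \<Rightarrow> real"
  assumes f: "set_integrable lebesgue \<Omega> f" and \<Omega>: "\<Omega> \<in> sets borel" and g: "integrable lborel g"
    and AE: "AE x in lborel. x \<in> \<Omega> \<longrightarrow> f x = g x" and A: "A \<in> sets borel" "A \<subseteq> \<Omega>"
    and d: "d \<in> borel_measurable borel"
  shows "(LINT x:A|lebesgue. f x * d x) = (LINT x:A|lborel. g x * d x)"
proof -
  have m: "(\<lambda>x. indicat_real A x *\<^sub>R (g x * d x)) \<in> borel_measurable lborel" using g A d by simp
  have dl: "d \<in> borel_measurable lebesgue" using measurable_completion[of d lborel borel] d by simp
  have "set_integrable lebesgue A f" using set_integrable_subset[OF f] A by simp
  then have "(\<lambda>x. (indicat_real A x *\<^sub>R f x) * d x) \<in> borel_measurable lebesgue"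
    using dl by (intro borel_measurable_times) (auto simp: set_integrable_def)
  then have "(LINT x:A|lebesgue. f x * d x) = (LINT x:A|lebesgue. g x * d x)"
    unfolding set_lebesgue_integral_def
  proof (intro integral_cong_AE)
    show "AE x in lebesgue. indicat_real A x *\<^sub>R (f x * d x) = indicat_real A x *\<^sub>R (g x * d x)"
      using AE_completion[OF AE] by eventually_elim (use A in \<open>auto simp: indicator_def\<close>)
  qed (use measurable_completion[OF m] in \<open>auto simp: mult.assoc\<close>)
  also have "\<dots> = (LINT x:A|lborel. g x * d x)"
    unfolding set_lebesgue_integral_def by (rule integral_completion[OF m])
  finally show ?thesis .
qed

lemma set_integrable_entry:
  fixes f :: "'a \<Rightarrow> real^'d^'m"
  assumes "set_integrable M A f"
  shows "set_integrable M A (\<lambda>x. f x $ i $ k)"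
  using integrable_bounded_linear[OF bounded_linear_entry assms[unfolded set_integrable_def], of i k]
  by (simp add: set_integrable_def)

text \<open>This brings the decomposition into the form used by the level-set argument: off one null
  set, each entry of \<mu> has a Borel integrable density.\<close>

lemma lebesgue_decomposition_entry:
  fixes \<mu> :: "'a::euclidean_space set \<Rightarrow> real^'d^'m"
  assumes dec: "lebesgue_decomposition \<Omega> \<mu> f \<nu>" and \<Omega>: "\<Omega> \<in> sets borel"
  shows "\<exists>N g. N \<in> null_sets lborel \<and> integrable lborel g \<and> (AE x in lborel. x \<in> \<Omega> \<longrightarrow> f x $ i $ k = g x) \<and>
    (\<forall>A \<in> sets borel. A \<subseteq> \<Omega> - N \<longrightarrow> \<mu> A $ i $ k = (LINT x:A|lborel. g x))"
proof -
  obtain N where f: "set_integrable lebesgue \<Omega> f" and v: "vector_measure (borel_on \<Omega>) \<nu>"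
    and N: "N \<in> sets (borel_on \<Omega>)" "N \<in> null_sets lebesgue" "variation (borel_on \<Omega>) \<nu> (\<Omega> - N) = 0"
    and eq: "\<And>A. A \<in> sets (borel_on \<Omega>) \<Longrightarrow> \<mu> A = (LINT x:A|lebesgue. f x) + \<nu> A"
    using dec unfolding lebesgue_decomposition_def by blast
  have Nb: "N \<in> sets borel" "N \<subseteq> \<Omega>" using N(1) by (auto simp: sets_borel_on[OF \<Omega>])
  have Nn: "N \<in> null_sets lborel" using N(2) Nb null_sets_completion_iff[of N lborel] by auto
  note fik = set_integrable_entry[OF f, of i k]
  obtain g where g: "integrable lborel g" "AE x in lborel. x \<in> \<Omega> \<longrightarrow> f x $ i $ k = g x"
    using set_integrable_borel_version[OF fik \<Omega>] by blast
  have "\<mu> A $ i $ k = (LINT x:A|lborel. g x)" if A: "A \<in> sets borel" "A \<subseteq> \<Omega> - N" for A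
  proof -
    have "\<nu> A = 0"
      by (rule variation_zero_imp[OF v N(3)]) (use A Nb \<Omega> in \<open>auto simp: sets_borel_on[OF \<Omega>]\<close>)
    moreover have "A \<in> sets (borel_on \<Omega>)" using A by (auto simp: sets_borel_on[OF \<Omega>])
    ultimately have "\<mu> A $ i $ k = (LINT x:A|lebesgue. f x) $ i $ k" using eq by simp
    also have "\<dots> = (LINT x:A|lebesgue. f x $ i $ k)"
      using A by (intro set_integral_entry set_integrable_subset[OF f]) auto
    also have "\<dots> = (LINT x:A|lborel. g x)"
      using set_integral_borel_version[OF fik \<Omega> g A(1), of "\<lambda>_. 1"] A(2) by auto
    finally show ?thesis .
  qed
  then show ?thesis using Nn g by blast
qed

text \<open>Existence makes the choice a genuine density. The singular part that goes with it is
  then forced on Borel subsets of \<Omega>, where it equals the definition by subtraction.\<close>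

lemma ac_density_decomposition:
  fixes \<mu> :: "'a::euclidean_space set \<Rightarrow> real^'d^'m"
  assumes v: "vector_measure (borel_on \<Omega>) \<mu>" and \<Omega>: "\<Omega> \<in> sets borel"
  shows "lebesgue_decomposition \<Omega> \<mu> (ac_density \<Omega> \<mu>) (singular_part \<Omega> \<mu>)"
proof -
  have "\<exists>\<nu>. lebesgue_decomposition \<Omega> \<mu> (ac_density \<Omega> \<mu>) \<nu>"
    unfolding ac_density_def
    by (rule someI_ex[of "\<lambda>f. \<exists>\<nu>. lebesgue_decomposition \<Omega> \<mu> f \<nu>"]) (rule lebesgue_decomposition_exists[OF assms])
  then obtain \<nu> where \<nu>: "lebesgue_decomposition \<Omega> \<mu> (ac_density \<Omega> \<mu>) \<nu>" ..
  have eq: "\<nu> A = singular_part \<Omega> \<mu> A" if "A \<in> sets (borel_on \<Omega>)" for A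
    using \<nu> that by (simp add: lebesgue_decomposition_def singular_part_def)
  then have "vector_measure (borel_on \<Omega>) (singular_part \<Omega> \<mu>)"
    using \<nu> vector_measure_cong_imp[of "borel_on \<Omega>" \<nu>] by (simp add: lebesgue_decomposition_def)
  then show ?thesis
    using \<nu> variation_cong[of "borel_on \<Omega>" \<nu> "singular_part \<Omega> \<mu>", OF eq]
    by (simp add: lebesgue_decomposition_def singular_part_def)
qed

text \<open>The chosen density may be replaced by any integrable h equal to it almost everywhere, in
  the area term and in the singular part alike. The agreement is asked entry by entry because
  densities are identified that way.\<close>

lemma area_measure_eq:
  fixes \<mu> :: "'a::euclidean_space set \<Rightarrow> real^'d^'m"
  assumes v: "vector_measure (borel_on \<Omega>) \<mu>" and \<Omega>: "\<Omega> \<in> sets borel"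
    and h: "set_integrable lebesgue \<Omega> h" "\<And>i k. AE x in lborel. x \<in> \<Omega> \<longrightarrow> ac_density \<Omega> \<mu> x $ i $ k = h x $ i $ k"
  shows "area_measure \<Omega> \<mu> \<Omega> = (\<integral>\<^sup>+x\<in>\<Omega>. ennreal (sqrt (1 + (norm (h x))\<^sup>2)) \<partial>lebesgue) +
    variation (borel_on \<Omega>) (\<lambda>A. \<mu> A - (LINT x:A|lebesgue. h x)) \<Omega>"
proof -
  have ac: "set_integrable lebesgue \<Omega> (ac_density \<Omega> \<mu>)"
    using ac_density_decomposition[OF v \<Omega>] by (simp add: lebesgue_decomposition_def)
  have "AE x in lborel. \<forall>i k. x \<in> \<Omega> \<longrightarrow> ac_density \<Omega> \<mu> x $ i $ k = h x $ i $ k"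
    unfolding AE_all_countable using h(2) by blast
  then have "AE x in lborel. x \<in> \<Omega> \<longrightarrow> ac_density \<Omega> \<mu> x = h x"
    by eventually_elim (simp add: vec_eq_iff)
  then have AE: "AE x in lebesgue. x \<in> \<Omega> \<longrightarrow> ac_density \<Omega> \<mu> x = h x" by (rule AE_completion)
  have "singular_part \<Omega> \<mu> A = \<mu> A - (LINT x:A|lebesgue. h x)" if "A \<in> sets (borel_on \<Omega>)" for A
  proof -
    have A: "A \<in> sets borel" "A \<subseteq> \<Omega>" using that by (auto simp: sets_borel_on[OF \<Omega>])
    have "(LINT x:A|lebesgue. ac_density \<Omega> \<mu> x) = (LINT x:A|lebesgue. h x)"
      unfolding set_lebesgue_integral_def
    proof (rule integral_cong_AE)
      show "AE x in lebesgue. indicat_real A x *\<^sub>R ac_density \<Omega> \<mu> x = indicat_real A x *\<^sub>R h x"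
        using AE by eventually_elim (use A in \<open>auto simp: indicator_def\<close>)
    qed (use set_integrable_subset[OF ac, of A] set_integrable_subset[OF h(1), of A] A in \<open>auto simp: set_integrable_def\<close>)
    then show ?thesis by (simp add: singular_part_def)
  qed
  then have "variation (borel_on \<Omega>) (singular_part \<Omega> \<mu>) \<Omega> =
      variation (borel_on \<Omega>) (\<lambda>A. \<mu> A - (LINT x:A|lebesgue. h x)) \<Omega>" by (rule variation_cong)
  moreover have "(\<integral>\<^sup>+x\<in>\<Omega>. ennreal (sqrt (1 + (norm (ac_density \<Omega> \<mu> x))\<^sup>2)) \<partial>lebesgue) =
      (\<integral>\<^sup>+x\<in>\<Omega>. ennreal (sqrt (1 + (norm (h x))\<^sup>2)) \<partial>lebesgue)"
    by (rule nn_integral_cong_AE) (use AE in \<open>eventually_elim, auto simp: indicator_def\<close>)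
  ultimately show ?thesis by (simp add: area_measure_def)
qed

lemma distributional_derivative_D_measure:
  "u \<in> BV \<Omega> \<Longrightarrow> distributional_derivative \<Omega> u (D_measure \<Omega> u)"
  unfolding D_measure_def BV_def by (rule someI_ex[of "distributional_derivative \<Omega> u"]) auto

text \<open>Every entry of the density vanishes almost everywhere on each of the countably many
  pieces, hence on \<Omega>. The area integrand is then 1 and the singular part is the whole
  derivative.\<close>

lemma area_measure_piecewise_constant:
  fixes U :: "real^'d \<Rightarrow> real^'m"
  assumes \<Omega>: "open \<Omega>" "convex \<Omega>" and U: "U \<in> BV \<Omega>" "piecewise_constant \<Omega> U"
  shows "area_measure \<Omega> (D_measure \<Omega> U) \<Omega> = emeasure lebesgue \<Omega> + variation (borel_on \<Omega>) (D_measure \<Omega> U) \<Omega>"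
proof -
  define \<mu> where "\<mu> = D_measure \<Omega> U"
  have \<Omega>b: "\<Omega> \<in> sets borel" using \<Omega> by simp
  have Ui: "set_integrable lebesgue \<Omega> (\<lambda>x. U x $ i)" for i
    using U(1) integrable_bounded_linear[OF bounded_linear_vec_nth, of lebesgue "\<lambda>x. indicat_real \<Omega> x *\<^sub>R U x" i]
    by (simp add: BV_def set_integrable_def)
  have v: "vector_measure (borel_on \<Omega>) \<mu>"
    and der: "\<And>\<phi> i k. smooth_compact_support \<Omega> \<phi> \<Longrightarrow>
      (LINT x:\<Omega>|lebesgue. U x $ i * frechet_derivative \<phi> (at x) (axis k 1)) =
        - signed_integral (borel_on \<Omega>) (\<lambda>A. \<mu> A $ i $ k) \<phi>"
    using distributional_derivative_D_measure[OF U(1)] unfolding distributional_derivative_def \<mu>_def by blast+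
  obtain P where P: "\<And>n. P n \<in> sets borel" "\<And>n. P n \<subseteq> \<Omega>" "\<Omega> - (\<Union>n::nat. P n) \<in> null_sets lebesgue"
    "\<And>n. \<exists>c. AE x in lebesgue. x \<in> P n \<longrightarrow> U x = c"
    using U(2) unfolding piecewise_constant_def by blast
  have "AE x in lborel. x \<in> \<Omega> \<longrightarrow> ac_density \<Omega> \<mu> x $ i $ k = (0::real^'d^'m) $ i $ k" for i k
  proof -
    obtain N g where N: "N \<in> null_sets lborel" and g: "integrable lborel g"
      and ac: "AE x in lborel. x \<in> \<Omega> \<longrightarrow> ac_density \<Omega> \<mu> x $ i $ k = g x"
      and \<mu>g: "\<And>A. A \<in> sets borel \<Longrightarrow> A \<subseteq> \<Omega> - N \<Longrightarrow> \<mu> A $ i $ k = (LINT x:A|lborel. g x)"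
      using lebesgue_decomposition_entry[OF ac_density_decomposition[OF v \<Omega>b] \<Omega>b, of i k] by blast
    \<comment> \<open>Since w vanishes off \<Omega>, integrals over the whole space equal those over
      \<Omega>, whatever a test function does outside.\<close>
    obtain w where w: "integrable lborel w" "\<And>x. x \<notin> \<Omega> \<Longrightarrow> w x = 0" "AE x in lborel. x \<in> \<Omega> \<longrightarrow> U x $ i = w x"
      using set_integrable_borel_version[OF Ui[of i] \<Omega>b] by blast
    have wder: "(LINT x|lborel. w x * frechet_derivative \<phi> (at x) (axis k 1)) =
        - signed_integral (borel_on \<Omega>) (\<lambda>A. \<mu> A $ i $ k) \<phi>" if \<phi>: "smooth_compact_support \<Omega> \<phi>" for \<phi>
    proof -
      \<comment> \<open>Off \<Omega> the test function is arbitrary and its derivative need not be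
        measurable; cutting it off there gives a Borel function.\<close>
      define d where "d x = (if x \<in> \<Omega> then frechet_derivative \<phi> (at x) (axis k 1) else 0)" for x
      have "smooth_compact_support \<Omega> d"
        unfolding d_def[abs_def]
        by (rule smooth_compact_support_extend_zero[OF \<Omega>(1) smooth_compact_support_frechet_derivative[OF \<Omega>(1) \<phi>]])
      then have d: "d \<in> borel_measurable borel"
        by (rule smooth_compact_support_integrable(2)[OF \<Omega>(1)]) (simp add: d_def)
      have "(LINT x|lborel. w x * frechet_derivative \<phi> (at x) (axis k 1)) = (LINT x:\<Omega>|lborel. w x * d x)"
        unfolding set_lebesgue_integral_def
        by (intro Bochner_Integration.integral_cong) (auto simp: d_def w(2))
      also have "\<dots> = (LINT x:\<Omega>|lebesgue. U x $ i * d x)"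
        by (rule set_integral_borel_version[OF Ui \<Omega>b w(1,3) \<Omega>b order_refl d, symmetric])
      also have "\<dots> = (LINT x:\<Omega>|lebesgue. U x $ i * frechet_derivative \<phi> (at x) (axis k 1))"
        unfolding set_lebesgue_integral_def
        by (intro Bochner_Integration.integral_cong) (auto simp: d_def indicator_def)
      finally show ?thesis using der[OF \<phi>] by simp
    qed
    have "AE x in lborel. x \<in> P n \<longrightarrow> g x = 0" for n
    proof -
      obtain c where "AE x in lebesgue. x \<in> P n \<longrightarrow> U x = c" using P(4) by blast
      then have "AE x in lborel. x \<in> P n \<longrightarrow> U x = c" by (simp add: AE_completion_iff)
      with w(3) have "AE x in lborel. x \<in> P n \<longrightarrow> w x = c $ i"
        by eventually_elim (use P(2) in auto)
      then show ?thesis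
        by (intro density_zero_where_constant[OF \<Omega> w(1) _ vector_measure_entry[OF v] wder N g \<mu>g P(1) P(2)])
          (auto simp: norm_axis_1)
    qed
    then have "AE x in lborel. \<forall>n. x \<in> P n \<longrightarrow> g x = 0" unfolding AE_all_countable by blast
    moreover have "AE x in lborel. x \<notin> \<Omega> - (\<Union>n. P n)"
      using AE_not_in[OF P(3)] by (simp only: AE_completion_iff)
    ultimately show ?thesis using ac by eventually_elim auto
  qed
  then have "area_measure \<Omega> \<mu> \<Omega> = (\<integral>\<^sup>+x\<in>\<Omega>. ennreal (sqrt (1 + (norm (0::real^'d^'m))\<^sup>2)) \<partial>lebesgue) +
      variation (borel_on \<Omega>) (\<lambda>A. \<mu> A - (LINT x:A|lebesgue. 0)) \<Omega>"
    by (intro area_measure_eq[OF v \<Omega>b]) (simp_all add: set_integrable_def)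
  then show ?thesis
    using \<Omega>b by (simp add: \<mu>_def set_lebesgue_integral_def)
qed

subsection \<open>Area of smooth functions\<close>

definition gradient_matrix :: "(real^'d \<Rightarrow> real^'m) \<Rightarrow> real^'d \<Rightarrow> real^'d^'m" where
  "gradient_matrix u x = (\<chi> i k. frechet_derivative u (at x) (axis k 1) $ i)"

lemma smooth_gradient_entry:
  assumes "open \<Omega>" "smooth_compact_support \<Omega> u"
  shows "smooth_compact_support \<Omega> (\<lambda>x. gradient_matrix u x $ i $ k)"
  using smooth_compact_support_bounded_linear[OF assms(1)
      smooth_compact_support_frechet_derivative[OF assms, of "axis k 1"] bounded_linear_vec_nth, of i]
  by (simp add: gradient_matrix_def)

lemma gradient_matrix_entry:
  assumes "open \<Omega>" "smooth_compact_support \<Omega> u" "x \<in> \<Omega>"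
  shows "gradient_matrix u x $ i $ k = frechet_derivative (\<lambda>x. u x $ i) (at x) (axis k 1)"
proof -
  have "u differentiable_on \<Omega>" using smooth_compact_supportD[OF assms(2), of 1] by simp
  then have "(u has_derivative frechet_derivative u (at x)) (at x)"
    by (rule has_derivative_frechet[OF _ assms(1,3)])
  then have "((\<lambda>x. u x $ i) has_derivative (\<lambda>v. frechet_derivative u (at x) v $ i)) (at x)"
    by (rule bounded_linear.has_derivative[OF bounded_linear_vec_nth])
  then show ?thesis by (simp add: frechet_derivative_eqI gradient_matrix_def)
qed

text \<open>The values of u off \<Omega> are arbitrary. Extending the gradient rather than u by zero
  gives a function that is continuous on the whole space and integrable.\<close>

definition gradient_ext :: "(real^'d) set \<Rightarrow> (real^'d \<Rightarrow> real^'m) \<Rightarrow> real^'d \<Rightarrow> real^'d^'m" where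
  "gradient_ext \<Omega> u x = (if x \<in> \<Omega> then gradient_matrix u x else 0)"

context
  fixes \<Omega> :: "(real^'d) set" and u :: "real^'d \<Rightarrow> real^'m"
  assumes \<Omega>: "open \<Omega>" and u: "smooth_compact_support \<Omega> u"
begin

lemma smooth_gradient_ext: "smooth_compact_support \<Omega> (\<lambda>x. gradient_ext \<Omega> u x $ i $ k)"
proof -
  have "(\<lambda>x. gradient_ext \<Omega> u x $ i $ k) = (\<lambda>x. if x \<in> \<Omega> then gradient_matrix u x $ i $ k else 0)"
    by (auto simp: gradient_ext_def)
  then show ?thesis
    using smooth_compact_support_extend_zero[OF \<Omega> smooth_gradient_entry[OF \<Omega> u]] by simp
qed

lemma gradient_ext_outside: "x \<notin> \<Omega> \<Longrightarrow> gradient_ext \<Omega> u x = 0"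
  by (simp add: gradient_ext_def)

lemma integrable_gradient_entry: "integrable lborel (\<lambda>x. gradient_ext \<Omega> u x $ i $ k)"
  by (rule smooth_compact_support_integrable(1)[OF \<Omega> smooth_gradient_ext]) (simp add: gradient_ext_outside)

lemma integrable_gradient_ext: "integrable lborel (gradient_ext \<Omega> u)"
  by (rule integrable_matrixI[OF integrable_gradient_entry])

lemma continuous_gradient_ext: "continuous_on UNIV (gradient_ext \<Omega> u)"
proof -
  have "continuous_on UNIV (\<lambda>x. gradient_ext \<Omega> u x $ i $ k)" for i k
  proof -
    have "(\<lambda>x. if x \<in> \<Omega> then gradient_ext \<Omega> u x $ i $ k else 0) = (\<lambda>x. gradient_ext \<Omega> u x $ i $ k)"
      by (auto simp: gradient_ext_outside)
    then show ?thesis using smooth_compact_support_extend[OF \<Omega> smooth_gradient_ext, of 0 i k] by simp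
  qed
  then have "continuous_on UNIV (\<lambda>x. \<chi> i. \<chi> k. gradient_ext \<Omega> u x $ i $ k)"
    by (intro continuous_on_vec_lambda)
  then show ?thesis by simp
qed

text \<open>Integration by parts shows that the distributional derivative and the classical gradient
  agree on test functions, so they are the same measure entry by entry.\<close>

lemma D_measure_smooth:
  assumes "u \<in> BV \<Omega>" and A: "A \<in> sets borel" "A \<subseteq> \<Omega>"
  shows "D_measure \<Omega> u A = (LINT x:A|lebesgue. gradient_ext \<Omega> u x)"
proof -
  have \<Omega>b: "\<Omega> \<in> sets borel" using \<Omega> by simp
  define \<mu> where "\<mu> = D_measure \<Omega> u"
  have v: "vector_measure (borel_on \<Omega>) \<mu>"
    and der: "\<And>\<phi> i k. smooth_compact_support \<Omega> \<phi> \<Longrightarrow>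
      (LINT x:\<Omega>|lebesgue. u x $ i * frechet_derivative \<phi> (at x) (axis k 1)) =
        - signed_integral (borel_on \<Omega>) (\<lambda>A. \<mu> A $ i $ k) \<phi>"
    using distributional_derivative_D_measure[OF assms(1)] unfolding distributional_derivative_def \<mu>_def by blast+
  have FA: "set_integrable lborel A (gradient_ext \<Omega> u)"
    unfolding set_integrable_def using integrable_gradient_ext A by (intro integrable_mult_indicator) auto
  have Gm: "gradient_ext \<Omega> u \<in> borel_measurable borel"
    using integrable_gradient_ext by (auto dest: borel_measurable_integrable)
  have "\<mu> A $ i $ k = (LINT x:A|lborel. gradient_ext \<Omega> u x $ i $ k)" for i k
  proof -
    let ?g = "\<lambda>x. gradient_ext \<Omega> u x $ i $ k"
    let ?P = "borel_positive_part \<Omega> (\<lambda>A. \<mu> A $ i $ k)" and ?Q = "borel_positive_part \<Omega> (\<lambda>A. - \<mu> A $ i $ k)"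
    note vik = vector_measure_entry[OF v, of i k]
    have fin: "finite_measure ?P" "finite_measure ?Q"
      using finite_borel_positive_part[OF vik] finite_borel_positive_part[OF vector_measure_uminus[OF vik]] by auto
    note g = integrable_gradient_entry[of i k]
    have "measure ?P A - measure ?Q A = measure (density lborel (\<lambda>x. ennreal (max 0 (?g x)))) A -
        measure (density lborel (\<lambda>x. ennreal (max 0 (- ?g x)))) A"
    proof (rule signed_measures_agree[OF fin(1) _ fin(2) _ _ _ _ _ \<Omega> _ A])
      show "finite_measure (density lborel (\<lambda>x. ennreal (max 0 (- ?g x))))"
        using finite_measure_density_pos[of "\<lambda>x. - ?g x"] g by simp
      show "finite_measure (density lborel (\<lambda>x. ennreal (max 0 (?g x))))"
        by (rule finite_measure_density_pos[OF g])
      fix \<phi> :: "real^'d \<Rightarrow> real" assume \<phi>: "smooth_compact_support \<Omega> \<phi>" "\<And>x. x \<notin> \<Omega> \<Longrightarrow> \<phi> x = 0"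
      obtain C where C: "\<And>x. \<bar>\<phi> x\<bar> \<le> C" using smooth_compact_support_integrable(3)[OF \<Omega> \<phi>] by blast
      have \<phi>m: "\<phi> \<in> borel_measurable borel" by (rule smooth_compact_support_integrable(2)[OF \<Omega> \<phi>])
      have ui: "smooth_compact_support \<Omega> (\<lambda>x. u x $ i)"
        by (rule smooth_compact_support_bounded_linear[OF \<Omega> u bounded_linear_vec_nth])
      have "integral\<^sup>L ?P \<phi> - integral\<^sup>L ?Q \<phi> = signed_integral (borel_on \<Omega>) (\<lambda>A. \<mu> A $ i $ k) \<phi>"
        by (rule signed_integral_eq[OF \<phi>m, symmetric]) simp
      also have "\<dots> = (LINT x:\<Omega>|lebesgue. frechet_derivative (\<lambda>x. u x $ i) (at x) (axis k 1) * \<phi> x)"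
        using der[OF \<phi>(1), of i k] integration_by_parts[OF \<Omega> ui \<phi>(1), of "axis k 1"] by simp
      also have "\<dots> = (LINT x:\<Omega>|lborel. ?g x * \<phi> x)"
      proof (rule set_integral_lebesgue_eq(1)[OF \<Omega>b])
        show "(\<lambda>x. ?g x * \<phi> x) \<in> borel_measurable borel" using g \<phi>m by auto
        show "frechet_derivative (\<lambda>x. u x $ i) (at x) (axis k 1) * \<phi> x = ?g x * \<phi> x" if "x \<in> \<Omega>" for x
          using gradient_matrix_entry[OF \<Omega> u that] that by (simp add: gradient_ext_def)
      qed
      also have "\<dots> = (LINT x|lborel. ?g x * \<phi> x)"
        by (rule set_integral_zero_outside) (simp add: \<phi>(2))
      also have "\<dots> = integral\<^sup>L (density lborel (\<lambda>x. ennreal (max 0 (?g x)))) \<phi> -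
          integral\<^sup>L (density lborel (\<lambda>x. ennreal (max 0 (- ?g x)))) \<phi>"
        by (rule integral_density_signed[OF g \<phi>m C, symmetric])
      finally show "integral\<^sup>L ?P \<phi> - integral\<^sup>L ?Q \<phi> = integral\<^sup>L (density lborel (\<lambda>x. ennreal (max 0 (?g x)))) \<phi> -
          integral\<^sup>L (density lborel (\<lambda>x. ennreal (max 0 (- ?g x)))) \<phi>" .
    qed auto
    then show ?thesis
      using borel_jordan_decomposition[OF vik \<Omega>b A] measure_density_signed[OF g A(1)] by simp
  qed
  then have "\<mu> A = (LINT x:A|lborel. gradient_ext \<Omega> u x)"
    by (simp add: vec_eq_iff set_integral_entry[OF FA])
  also have "\<dots> = (LINT x:A|lebesgue. gradient_ext \<Omega> u x)"
    by (rule set_integral_lebesgue_eq(1)[OF A(1) Gm, symmetric]) simp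
  finally show ?thesis by (simp add: \<mu>_def)
qed

lemma area_measure_smooth:
  assumes "u \<in> BV \<Omega>"
  shows "area_measure \<Omega> (D_measure \<Omega> u) \<Omega> =
    (\<integral>\<^sup>+x\<in>\<Omega>. ennreal (sqrt (1 + (norm (gradient_ext \<Omega> u x))\<^sup>2)) \<partial>lborel)"
proof -
  define \<mu> where "\<mu> = D_measure \<Omega> u"
  define G where "G = gradient_ext \<Omega> u"
  have \<Omega>b: "\<Omega> \<in> sets borel" using \<Omega> by simp
  have v: "vector_measure (borel_on \<Omega>) \<mu>"
    using distributional_derivative_D_measure[OF assms] by (simp add: distributional_derivative_def \<mu>_def)
  have G: "integrable lborel G" by (simp add: G_def integrable_gradient_ext)
  have Gm: "G \<in> borel_measurable borel" using G by (auto dest: borel_measurable_integrable)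
  have GA: "set_integrable lborel A G" if "A \<in> sets borel" for A
    unfolding set_integrable_def using G that by (intro integrable_mult_indicator) auto
  have GAl: "set_integrable lebesgue A G" if "A \<in> sets borel" for A
    using set_integral_lebesgue_eq(2)[OF that Gm, of G] GA[OF that] by simp
  have \<mu>G: "\<mu> A = (LINT x:A|lebesgue. G x)" if "A \<in> sets borel" "A \<subseteq> \<Omega>" for A
    using D_measure_smooth[OF assms that] by (simp add: \<mu>_def G_def)
  have "AE x in lborel. x \<in> \<Omega> \<longrightarrow> ac_density \<Omega> \<mu> x $ i $ k = G x $ i $ k" for i k
  proof -
    obtain N g where N: "N \<in> null_sets lborel" and g: "integrable lborel g"
      and ac: "AE x in lborel. x \<in> \<Omega> \<longrightarrow> ac_density \<Omega> \<mu> x $ i $ k = g x"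
      and \<mu>g: "\<And>A. A \<in> sets borel \<Longrightarrow> A \<subseteq> \<Omega> - N \<Longrightarrow> \<mu> A $ i $ k = (LINT x:A|lborel. g x)"
      using lebesgue_decomposition_entry[OF ac_density_decomposition[OF v \<Omega>b] \<Omega>b, of i k] by blast
    have Nb: "N \<in> sets borel" using N by auto
    \<comment> \<open>Both functions are cut off to \<Omega> - N, where they have the same integral
      over every Borel set; uniqueness of densities then applies on the whole space.\<close>
    let ?g = "\<lambda>x. indicat_real (\<Omega> - N) x *\<^sub>R g x" and ?G = "\<lambda>x. indicat_real (\<Omega> - N) x *\<^sub>R (G x $ i $ k)"
    have "AE x in lborel. ?g x = ?G x"
    proof (rule density_unique_real)
      show "integrable lborel ?g" using g \<Omega>b Nb by (intro integrable_mult_indicator) auto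
      have "integrable lborel (\<lambda>x. G x $ i $ k)" by (simp add: G_def integrable_gradient_entry)
      then show "integrable lborel ?G" using \<Omega>b Nb by (intro integrable_mult_indicator) auto
      fix A :: "(real^'d) set" assume "A \<in> sets lborel"
      then have A: "A \<inter> (\<Omega> - N) \<in> sets borel" "A \<inter> (\<Omega> - N) \<subseteq> \<Omega>" using \<Omega>b Nb by auto
      have "(LINT x:A|lborel. ?g x) = (LINT x:A \<inter> (\<Omega> - N)|lborel. g x)"
        unfolding set_lebesgue_integral_def by (intro Bochner_Integration.integral_cong) (auto simp: indicator_def)
      also have "\<dots> = \<mu> (A \<inter> (\<Omega> - N)) $ i $ k" using A by (intro \<mu>g[symmetric]) auto
      also have "\<dots> = (LINT x:A \<inter> (\<Omega> - N)|lebesgue. G x $ i $ k)"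
        using \<mu>G[OF A] set_integral_entry[OF GAl[OF A(1)]] by simp
      also have "\<dots> = (LINT x:A \<inter> (\<Omega> - N)|lborel. G x $ i $ k)"
        by (rule set_integral_lebesgue_eq(1)[OF A(1) borel_measurable_entry[OF Gm]]) simp
      also have "\<dots> = (LINT x:A|lborel. ?G x)"
        unfolding set_lebesgue_integral_def by (intro Bochner_Integration.integral_cong) (auto simp: indicator_def)
      finally show "(LINT x:A|lborel. ?g x) = (LINT x:A|lborel. ?G x)" .
    qed
    with ac AE_not_in[OF N] show ?thesis
      by eventually_elim auto
  qed
  then have "area_measure \<Omega> \<mu> \<Omega> = (\<integral>\<^sup>+x\<in>\<Omega>. ennreal (sqrt (1 + (norm (G x))\<^sup>2)) \<partial>lebesgue) +
      variation (borel_on \<Omega>) (\<lambda>A. \<mu> A - (LINT x:A|lebesgue. G x)) \<Omega>"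
    by (rule area_measure_eq[OF v \<Omega>b GAl[OF \<Omega>b]])
  also have "variation (borel_on \<Omega>) (\<lambda>A. \<mu> A - (LINT x:A|lebesgue. G x)) \<Omega> = variation (borel_on \<Omega>) (\<lambda>A. 0::real^'d^'m) \<Omega>"
    by (rule variation_cong) (use \<mu>G in \<open>auto simp: sets_borel_on[OF \<Omega>b]\<close>)
  also have "\<dots> = 0"
    unfolding variation_def by (intro antisym SUP_least) auto
  finally show ?thesis by (simp add: \<mu>_def G_def nn_integral_completion)
qed

end

text \<open>The test function is bounded by some C, so the integrals differ by at most C times the
  L^1 distance.\<close>

lemma set_integral_tested_convergence:
  fixes U :: "nat \<Rightarrow> real^'d \<Rightarrow> real^'m"
  assumes \<Omega>: "open \<Omega>" and U: "\<And>j. set_integrable lebesgue \<Omega> (U j)" and u: "set_integrable lebesgue \<Omega> u"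
    and conv: "(\<lambda>j. LINT x:\<Omega>|lebesgue. norm (U j x - u x)) \<longlonglongrightarrow> 0"
    and \<psi>: "smooth_compact_support \<Omega> (\<psi> :: real^'d \<Rightarrow> real)"
  shows "(\<lambda>j. LINT x:\<Omega>|lebesgue. U j x $ i * \<psi> x) \<longlonglongrightarrow> (LINT x:\<Omega>|lebesgue. u x $ i * \<psi> x)"
proof -
  define d where "d x = (if x \<in> \<Omega> then \<psi> x else 0)" for x
  have d: "smooth_compact_support \<Omega> d" "\<And>x. x \<notin> \<Omega> \<Longrightarrow> d x = 0"
    unfolding d_def[abs_def] by (auto intro: smooth_compact_support_extend_zero[OF \<Omega> \<psi>])
  obtain C where C: "\<And>x. \<bar>d x\<bar> \<le> C" using smooth_compact_support_integrable(3)[OF \<Omega> d] by blast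
  have dl: "d \<in> borel_measurable lebesgue"
    using measurable_completion[of d lborel borel] smooth_compact_support_integrable(2)[OF \<Omega> d] by simp
  have C0: "C \<ge> 0" using C[of 0] by linarith
  have \<psi>d: "(LINT x:\<Omega>|lebesgue. f x * \<psi> x) = (LINT x:\<Omega>|lebesgue. f x * d x)" for f :: "_ \<Rightarrow> real"
    unfolding set_lebesgue_integral_def
    by (intro Bochner_Integration.integral_cong) (auto simp: d_def indicator_def)
  have le: "\<bar>f x $ i * d x\<bar> \<le> C * norm (f x)" for f :: "real^'d \<Rightarrow> real^'m" and x
    using mult_mono[OF C[of x] Finite_Cartesian_Product.norm_nth_le[of "f x" i]] C0 by (simp add: abs_mult mult.commute)
  have int: "set_integrable lebesgue \<Omega> (\<lambda>x. f x $ i * d x)" if f: "set_integrable lebesgue \<Omega> f" for f :: "real^'d \<Rightarrow> real^'m"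
    unfolding set_integrable_def
  proof (rule Bochner_Integration.integrable_bound)
    show "integrable lebesgue (\<lambda>x. C * norm (indicat_real \<Omega> x *\<^sub>R f x))"
      using f unfolding set_integrable_def by (intro integrable_mult_right integrable_norm)
    have "(\<lambda>x. (indicat_real \<Omega> x *\<^sub>R f x) $ i) \<in> borel_measurable lebesgue"
      using integrable_bounded_linear[OF bounded_linear_vec_nth f[unfolded set_integrable_def]]
      by (rule borel_measurable_integrable)
    then have "(\<lambda>x. (indicat_real \<Omega> x *\<^sub>R f x) $ i * d x) \<in> borel_measurable lebesgue"
      using dl by (rule borel_measurable_times)
    then show "(\<lambda>x. indicat_real \<Omega> x *\<^sub>R (f x $ i * d x)) \<in> borel_measurable lebesgue"
      by (simp add: mult.assoc)
    show "AE x in lebesgue. norm (indicat_real \<Omega> x *\<^sub>R (f x $ i * d x)) \<le> norm (C * norm (indicat_real \<Omega> x *\<^sub>R f x))"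
      using le[of f] C0 by (intro AE_I2) (auto simp: indicator_def)
  qed
  have bound: "norm ((LINT x:\<Omega>|lebesgue. U j x $ i * \<psi> x) - (LINT x:\<Omega>|lebesgue. u x $ i * \<psi> x)) \<le>
      C * (LINT x:\<Omega>|lebesgue. norm (U j x - u x))" for j
  proof -
    have diff: "set_integrable lebesgue \<Omega> (\<lambda>x. U j x - u x)" by (rule set_integral_diff(1)[OF U u])
    have "(LINT x:\<Omega>|lebesgue. U j x $ i * \<psi> x) - (LINT x:\<Omega>|lebesgue. u x $ i * \<psi> x) =
        (LINT x:\<Omega>|lebesgue. U j x $ i * d x - u x $ i * d x)"
      unfolding \<psi>d by (rule set_integral_diff(2)[OF int[OF U] int[OF u], symmetric])
    also have "\<dots> = (LINT x:\<Omega>|lebesgue. (U j x - u x) $ i * d x)"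
      by (simp add: left_diff_distrib)
    also have "norm \<dots> \<le> (LINT x:\<Omega>|lebesgue. norm ((U j x - u x) $ i * d x))"
      by (rule set_integral_norm_bound[OF int[OF diff]])
    also have "\<dots> \<le> (LINT x:\<Omega>|lebesgue. C * norm (U j x - u x))"
    proof (rule set_integral_mono)
      show "set_integrable lebesgue \<Omega> (\<lambda>x. norm ((U j x - u x) $ i * d x))"
        by (rule set_integrable_norm[OF int[OF diff]])
      show "set_integrable lebesgue \<Omega> (\<lambda>x. C * norm (U j x - u x))"
        using set_integrable_norm[OF diff] by (intro set_integrable_mult_right) auto
      show "norm ((U j x - u x) $ i * d x) \<le> C * norm (U j x - u x)" for x
        using le[of "\<lambda>x. U j x - u x" x] by simp
    qed
    also have "\<dots> = C * (LINT x:\<Omega>|lebesgue. norm (U j x - u x))" by simp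
    finally show ?thesis .
  qed
  have "(\<lambda>j. C * (LINT x:\<Omega>|lebesgue. norm (U j x - u x))) \<longlonglongrightarrow> 0"
    using tendsto_mult_right_zero[OF conv] by simp
  then have "(\<lambda>j. (LINT x:\<Omega>|lebesgue. U j x $ i * \<psi> x) - (LINT x:\<Omega>|lebesgue. u x $ i * \<psi> x)) \<longlonglongrightarrow> 0"
    by (rule Lim_null_comparison[rotated]) (use bound in auto)
  then show ?thesis by (simp add: LIM_zero_iff)
qed

subsection \<open>Comparison of the areas\<close>

lemma set_integrable_ball_continuous:
  fixes h :: "'a::euclidean_space \<Rightarrow> real"
  assumes "continuous_on UNIV h"
  shows "set_integrable lborel (ball 0 1) h"
proof -
  have "set_integrable lborel (cball 0 1) h"
    unfolding set_integrable_def
    by (rule borel_integrable_compact[OF compact_cball continuous_on_subset[OF assms]]) auto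
  then show ?thesis by (rule set_integrable_subset) auto
qed

text \<open>On the convex ball a vanishing gradient makes u constant. The support of a nonzero
  constant is the closed ball, which is not contained in the open one: a unit coordinate vector is
  the witness.\<close>

lemma smooth_compact_support_gradient_zero:
  fixes u :: "real^'d \<Rightarrow> real^'m"
  assumes u: "smooth_compact_support (ball 0 1) u" and G: "\<And>x. x \<in> ball 0 1 \<Longrightarrow> gradient_matrix u x = 0"
    and x: "x \<in> ball 0 1"
  shows "u x = 0"
proof (rule ccontr)
  assume "u x \<noteq> 0"
  have d: "u differentiable_on ball 0 1" using smooth_compact_supportD[OF u, of 1] by simp
  have D: "(u has_derivative (\<lambda>v. 0)) (at y)" if y: "y \<in> ball 0 1" for y
  proof -
    let ?D = "frechet_derivative u (at y)"
    have der: "(u has_derivative ?D) (at y)" by (rule has_derivative_frechet[OF d open_ball y])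
    have "?D (axis k 1) = 0" for k
      using G[OF y] by (simp add: gradient_matrix_def vec_eq_iff)
    then have "?D b = 0" if "b \<in> Basis" for b
      using that by (auto simp: Basis_vec_def)
    then have "?D = (\<lambda>v. 0)"
      using linear_eq_stdbasis[OF has_derivative_linear[OF der] linear_zero] by simp
    then show ?thesis using der by simp
  qed
  then obtain c where c: "\<And>y. y \<in> ball 0 1 \<Longrightarrow> u y = c"
    using has_derivative_zero_constant[OF convex_ball, of 0 1 u] has_derivative_at_withinI by metis
  with x \<open>u x \<noteq> 0\<close> have "{x \<in> ball 0 1. u x \<noteq> 0} = ball 0 1" by auto
  then have "cball 0 1 \<subseteq> (ball 0 1 :: (real^'d) set)"
    using u by (simp add: smooth_compact_support_def)
  moreover have "axis k 1 \<in> cball 0 (1::real) - (ball 0 1 :: (real^'d) set)" for k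
    by (simp add: norm_axis_1)
  ultimately show False by blast
qed

theorem proposition4:
  fixes u :: "real^'d \<Rightarrow> real^'m"
  assumes "CARD('d) > 1"
    and "smooth_compact_support (ball 0 1) u"
    and "\<exists>x \<in> ball 0 1. u x \<noteq> 0"
  shows "\<not> (\<exists>U :: nat \<Rightarrow> real^'d \<Rightarrow> real^'m.
            (\<forall>j. U j \<in> BV (ball 0 1) \<and> piecewise_constant (ball 0 1) (U j)) \<and>
            area_strictly_converges (ball 0 1) U u)"
proof
  assume "\<exists>U :: nat \<Rightarrow> real^'d \<Rightarrow> real^'m.
            (\<forall>j. U j \<in> BV (ball 0 1) \<and> piecewise_constant (ball 0 1) (U j)) \<and>
            area_strictly_converges (ball 0 1) U u"
  then obtain U :: "nat \<Rightarrow> real^'d \<Rightarrow> real^'m" where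
    U: "\<And>j. U j \<in> BV (ball 0 1)" "\<And>j. piecewise_constant (ball 0 1) (U j)"
    and conv: "area_strictly_converges (ball 0 1) U u" by blast
  define \<Omega> :: "(real^'d) set" where "\<Omega> = ball 0 1"
  have \<Omega>: "open \<Omega>" "convex \<Omega>" "\<Omega> \<in> sets borel" by (auto simp: \<Omega>_def)
  note U = U[folded \<Omega>_def] and conv = conv[folded \<Omega>_def] and u = assms(2)[folded \<Omega>_def]
  have uBV: "u \<in> BV \<Omega>" and L1: "(\<lambda>j. LINT x:\<Omega>|lebesgue. norm (U j x - u x)) \<longlonglongrightarrow> 0"
    and area: "(\<lambda>j. area_measure \<Omega> (D_measure \<Omega> (U j)) \<Omega>) \<longlonglongrightarrow> area_measure \<Omega> (D_measure \<Omega> u) \<Omega>"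
    using conv by (auto simp: area_strictly_converges_def)
  define G where "G = gradient_ext \<Omega> u"
  define s where "s x = sqrt (1 + (norm (G x))\<^sup>2)" for x
  define \<Phi> where "\<Phi> x = (1 / s x) *\<^sub>R G x" for x
  have s1: "s x \<ge> 1" and s_sq: "s x * s x = 1 + (norm (G x))\<^sup>2" for x
    by (auto simp: s_def)
  have Gc: "continuous_on UNIV G" unfolding G_def by (rule continuous_gradient_ext[OF \<Omega>(1) u])
  have sc: "continuous_on UNIV s" unfolding s_def by (intro continuous_intros Gc)
  have s0: "s x \<noteq> 0" for x using s1[of x] by linarith
  have \<Phi>c: "continuous_on UNIV \<Phi>" unfolding \<Phi>_def by (intro continuous_intros Gc sc) (use s0 in auto)
  have \<Phi>1: "norm (\<Phi> x) \<le> 1" for x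
  proof -
    have "norm (G x) \<le> s x" unfolding s_def by (rule real_le_rsqrt) simp
    then show ?thesis using s1[of x] by (simp add: \<Phi>_def)
  qed
  have \<Phi>_smooth: "smooth_compact_support \<Omega> (\<lambda>x. \<Phi> x $ i $ k)" for i k
  proof -
    let ?n = "\<lambda>x. \<Sum>i\<in>UNIV. \<Sum>k\<in>UNIV. G x $ i $ k * G x $ i $ k"
    have n: "?n x = (norm (G x))\<^sup>2" for x by (simp add: power2_norm_eq_inner inner_matrix)
    note Gs = smooth_gradient_ext[OF \<Omega>(1) u, folded G_def]
    have "Ck_on l \<Omega> ?n" for l
      by (intro Ck_on_sum Ck_on_mult \<Omega>(1) smooth_compact_supportD[OF Gs])
    \<comment> \<open>The exponent -1/2 yields 1 / s as a smooth function of |G|^2, whose values lie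
      in the half line beyond -1 on which powers of 1 + t are smooth.\<close>
    then have "Ck_on l \<Omega> (\<lambda>x. (1 + ?n x) powr (- (1 / 2)))" for l
      by (rule Ck_on_compose_real[OF \<Omega>(1) open_greaterThan[of "-1"] _ _ Ck_on_powr, rotated])
        (auto simp: n intro: less_le_trans[of "-1" 0])
    then have "smooth_compact_support \<Omega> (\<lambda>x. G x $ i $ k * (1 + ?n x) powr (- (1 / 2)))"
      by (rule smooth_compact_support_mult[OF \<Omega>(1) Gs])
    moreover have "(1 + ?n x) powr (- (1 / 2)) = 1 / s x" for x
      unfolding n s_def powr_minus[of _ "1 / 2"] inverse_eq_divide by (subst powr_half_sqrt) auto
    ultimately have "smooth_compact_support \<Omega> (\<lambda>x. G x $ i $ k * (1 / s x))" by (simp only:)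
    then show ?thesis by (simp add: \<Phi>_def)
  qed
  let ?d = "\<lambda>i k x. frechet_derivative (\<lambda>x. \<Phi> x $ i $ k) (at x) (axis k 1)"
  \<comment> \<open>Minus the integral of w against the row-wise divergence of \<Phi>: the pairing
    of \<Phi> with the derivative, in the form that passes to L^1 limits.\<close>
  let ?I = "\<lambda>w. \<Sum>i\<in>UNIV. \<Sum>k\<in>UNIV. - (LINT x:\<Omega>|lebesgue. w x $ i * ?d i k x)"
  have fin: "emeasure lebesgue \<Omega> = ennreal (measure lebesgue \<Omega>)"
    unfolding \<Omega>_def by (rule emeasure_eq_ennreal_measure) (use emeasure_bounded_finite[OF bounded_ball, of "0::real^'d" 1] in \<open>simp add: less_top\<close>)
  have lower: "ennreal (measure lebesgue \<Omega> + ?I (U j)) \<le> area_measure \<Omega> (D_measure \<Omega> (U j)) \<Omega>" for j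
  proof -
    let ?\<mu> = "D_measure \<Omega> (U j)"
    have v: "vector_measure (borel_on \<Omega>) ?\<mu>"
      and der: "\<And>\<phi> i k. smooth_compact_support \<Omega> \<phi> \<Longrightarrow>
        (LINT x:\<Omega>|lebesgue. U j x $ i * frechet_derivative \<phi> (at x) (axis k 1)) =
          - signed_integral (borel_on \<Omega>) (\<lambda>A. ?\<mu> A $ i $ k) \<phi>"
      using distributional_derivative_D_measure[OF U(1)[of j]] unfolding distributional_derivative_def by blast+
    have \<Phi>m: "\<Phi> \<in> borel_measurable (borel_on \<Omega>)"
      by (rule borel_measurable_continuous_on_restrict[OF continuous_on_subset[OF \<Phi>c]]) simp
    have I: "?I (U j) = (\<Sum>i\<in>UNIV. \<Sum>k\<in>UNIV. signed_integral (borel_on \<Omega>) (\<lambda>A. ?\<mu> A $ i $ k) (\<lambda>x. \<Phi> x $ i $ k))"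
      using der[OF \<Phi>_smooth] by simp
    have "ennreal (?I (U j)) \<le> variation (borel_on \<Omega>) ?\<mu> \<Omega>"
      using signed_integral_le_variation[OF v \<Phi>m \<Phi>1] unfolding I by (simp add: space_restrict_space)
    \<comment> \<open>The number \<open>?I (U j)\<close> may be negative, and \<open>ennreal\<close>
      cuts it off at 0; hence an inequality instead of additivity.\<close>
    moreover have "ennreal (measure lebesgue \<Omega> + ?I (U j)) \<le> ennreal (measure lebesgue \<Omega>) + ennreal (?I (U j))"
      by (simp add: ennreal_plus_if ennreal_leI)
    ultimately show ?thesis
      unfolding area_measure_piecewise_constant[OF \<Omega>(1,2) U(1,2)] fin
      by (meson add_left_mono order_trans)
  qed
  have "(\<lambda>j. ?I (U j)) \<longlonglongrightarrow> ?I u"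
    by (intro tendsto_sum tendsto_minus set_integral_tested_convergence[OF \<Omega>(1) _ _ L1]
        smooth_compact_support_frechet_derivative[OF \<Omega>(1) \<Phi>_smooth])
      (use U(1) uBV in \<open>auto simp: BV_def\<close>)
  then have "(\<lambda>j. ennreal (measure lebesgue \<Omega> + ?I (U j))) \<longlonglongrightarrow> ennreal (measure lebesgue \<Omega> + ?I u)"
    by (intro tendsto_ennrealI tendsto_add tendsto_const)
  then have main: "ennreal (measure lebesgue \<Omega> + ?I u) \<le> area_measure \<Omega> (D_measure \<Omega> u) \<Omega>"
    by (rule LIMSEQ_le[OF _ area]) (use lower in auto)
  have int: "set_integrable lborel \<Omega> h" if "continuous_on UNIV h" for h :: "real^'d \<Rightarrow> real"
    unfolding \<Omega>_def by (rule set_integrable_ball_continuous[OF that])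
  have "area_measure \<Omega> (D_measure \<Omega> u) \<Omega> = ennreal (LINT x:\<Omega>|lborel. s x)"
  proof -
    have "area_measure \<Omega> (D_measure \<Omega> u) \<Omega> = (\<integral>\<^sup>+x. ennreal (indicat_real \<Omega> x *\<^sub>R s x) \<partial>lborel)"
      unfolding area_measure_smooth[OF \<Omega>(1) u uBV]
      by (intro nn_integral_cong) (auto simp: indicator_def s_def G_def)
    also have "\<dots> = ennreal (LINT x:\<Omega>|lborel. s x)"
      unfolding set_lebesgue_integral_def
      by (rule nn_integral_eq_integral)
        (use int[OF sc] s1 in \<open>auto simp: set_integrable_def indicator_def intro: order_trans[OF zero_le_one]\<close>)
    finally show ?thesis .
  qed
  moreover have Iu: "?I u = (LINT x:\<Omega>|lborel. G x \<bullet> \<Phi> x)"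
  proof -
    have ik: "- (LINT x:\<Omega>|lebesgue. u x $ i * ?d i k x) = (LINT x:\<Omega>|lborel. G x $ i $ k * \<Phi> x $ i $ k)" for i k
    proof -
      have ui: "smooth_compact_support \<Omega> (\<lambda>x. u x $ i)"
        by (rule smooth_compact_support_bounded_linear[OF \<Omega>(1) u bounded_linear_vec_nth])
      have "- (LINT x:\<Omega>|lebesgue. u x $ i * ?d i k x) =
          (LINT x:\<Omega>|lebesgue. frechet_derivative (\<lambda>x. u x $ i) (at x) (axis k 1) * \<Phi> x $ i $ k)"
        using integration_by_parts[OF \<Omega>(1) ui \<Phi>_smooth, of i k "axis k 1"] by simp
      also have "\<dots> = (LINT x:\<Omega>|lborel. G x $ i $ k * \<Phi> x $ i $ k)"
      proof (rule set_integral_lebesgue_eq(1)[OF \<Omega>(3)])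
        show "(\<lambda>x. G x $ i $ k * \<Phi> x $ i $ k) \<in> borel_measurable borel"
          by (intro borel_measurable_continuous_onI continuous_intros Gc \<Phi>c)
        show "frechet_derivative (\<lambda>x. u x $ i) (at x) (axis k 1) * \<Phi> x $ i $ k = G x $ i $ k * \<Phi> x $ i $ k"
          if "x \<in> \<Omega>" for x
          using gradient_matrix_entry[OF \<Omega>(1) u that] that by (simp add: G_def gradient_ext_def)
      qed
      finally show ?thesis .
    qed
    have "?I u = (\<Sum>i\<in>UNIV. \<Sum>k\<in>UNIV. LINT x:\<Omega>|lborel. G x $ i $ k * \<Phi> x $ i $ k)"
      by (simp only: ik)
    also have "\<dots> = (LINT x:\<Omega>|lborel. \<Sum>i\<in>UNIV. \<Sum>k\<in>UNIV. G x $ i $ k * \<Phi> x $ i $ k)"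
    proof -
      have *: "integrable lborel (\<lambda>x. indicat_real \<Omega> x *\<^sub>R (G x $ i $ k * \<Phi> x $ i $ k))" for i k
        using int[of "\<lambda>x. G x $ i $ k * \<Phi> x $ i $ k"] unfolding set_integrable_def
        by (simp add: continuous_intros Gc \<Phi>c)
      let ?F = "\<lambda>i k x. indicat_real \<Omega> x *\<^sub>R (G x $ i $ k * \<Phi> x $ i $ k)"
      have "(LINT x|lborel. (\<Sum>i\<in>UNIV. \<Sum>k\<in>UNIV. ?F i k x)) = (\<Sum>i\<in>UNIV. LINT x|lborel. (\<Sum>k\<in>UNIV. ?F i k x))"
        by (intro Bochner_Integration.integral_sum Bochner_Integration.integrable_sum *)
      also have "\<dots> = (\<Sum>i\<in>UNIV. \<Sum>k\<in>UNIV. LINT x|lborel. ?F i k x)"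
        by (intro sum.cong refl Bochner_Integration.integral_sum *)
      finally show ?thesis
        unfolding set_lebesgue_integral_def scaleR_sum_right by (rule sym)
    qed
    finally show ?thesis by (simp add: inner_matrix)
  qed
  moreover have "measure lebesgue \<Omega> = (LINT x:\<Omega>|lborel. 1)"
    using \<Omega>(3) by (simp add: set_lebesgue_integral_def measure_completion)
  ultimately have "ennreal ((LINT x:\<Omega>|lborel. 1) + (LINT x:\<Omega>|lborel. G x \<bullet> \<Phi> x)) \<le> ennreal (LINT x:\<Omega>|lborel. s x)"
    using main by (simp only:)
  moreover have "0 \<le> indicat_real \<Omega> x *\<^sub>R s x" for x
    using s1[of x] by (simp add: indicator_def)
  then have "0 \<le> (LINT x:\<Omega>|lborel. s x)"
    unfolding set_lebesgue_integral_def by (rule Bochner_Integration.integral_nonneg)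
  ultimately have le: "(LINT x:\<Omega>|lborel. 1) + (LINT x:\<Omega>|lborel. G x \<bullet> \<Phi> x) \<le> (LINT x:\<Omega>|lborel. s x)"
    by (simp only: ennreal_le_iff)
  define q where "q x = 1 + G x \<bullet> \<Phi> x - s x" for x
  \<comment> \<open>From s^2 = 1 + |G|^2 it follows that s - |G|^2 / s = 1 / s. So q is nonnegative
    and vanishes exactly where G does.\<close>
  have q: "q x = 1 - 1 / s x" for x
  proof -
    have "s x - G x \<bullet> \<Phi> x = (s x * s x - (norm (G x))\<^sup>2) / s x"
      using s0[of x] by (simp add: \<Phi>_def power2_norm_eq_inner field_simps)
    then show ?thesis by (simp add: q_def s_sq)
  qed
  have q0: "q x \<ge> 0" for x using s1[of x] by (simp add: q)
  have qc: "continuous_on UNIV q" unfolding q_def by (intro continuous_intros Gc \<Phi>c sc)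
  have "(LINT x:\<Omega>|lborel. q x) \<le> 0"
  proof -
    have 1: "set_integrable lborel \<Omega> (\<lambda>x. 1::real)" and G\<Phi>: "set_integrable lborel \<Omega> (\<lambda>x. G x \<bullet> \<Phi> x)"
      by (intro int continuous_intros Gc \<Phi>c)+
    have "(LINT x:\<Omega>|lborel. q x) = (LINT x:\<Omega>|lborel. 1) + (LINT x:\<Omega>|lborel. G x \<bullet> \<Phi> x) - (LINT x:\<Omega>|lborel. s x)"
      by (simp only: q_def set_integral_diff(2)[OF set_integral_add(1)[OF 1 G\<Phi>] int[OF sc]] set_integral_add(2)[OF 1 G\<Phi>])
    then show ?thesis using le by simp
  qed
  then have "(LINT x|lborel. indicat_real \<Omega> x *\<^sub>R q x) = 0"
    using q0 by (intro antisym Bochner_Integration.integral_nonneg) (auto simp: set_lebesgue_integral_def)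
  then have AE: "AE x in lborel. indicat_real \<Omega> x *\<^sub>R q x = 0"
    using int[OF qc] q0 by (subst (asm) integral_nonneg_eq_0_iff_AE) (auto simp: set_integrable_def)
  \<comment> \<open>The set where the continuous q is positive in \<Omega> is open and null, hence
    empty. This turns vanishing almost everywhere into vanishing at every point.\<close>
  define W where "W = \<Omega> \<inter> q -` {0<..}"
  have W: "open W" unfolding W_def
    using \<Omega>(1) continuous_open_preimage[OF qc open_UNIV open_greaterThan, of 0] by auto
  from AE have "AE x in lborel. x \<notin> W"
    by eventually_elim (auto simp: W_def)
  then have "W \<in> null_sets lborel" using W by (subst AE_iff_null_sets) auto
  then have "negligible W"
    using W null_sets_completion_iff[of W lborel] by (simp add: negligible_iff_null_sets)
  then have "W = {}" using W open_not_negligible by blast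
  have "gradient_matrix u x = 0" if "x \<in> \<Omega>" for x
  proof -
    have "q x = 0" using \<open>W = {}\<close> q0[of x] that by (auto simp: W_def)
    then have "s x = 1" using s0[of x] by (simp add: q)
    then have "G x = 0" using s_sq[of x] by simp
    then show ?thesis using that by (simp add: G_def gradient_ext_def)
  qed
  then show False
    using assms(3) smooth_compact_support_gradient_zero[OF assms(2)] by (auto simp: \<Omega>_def)
qed

end
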